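(* Let $V$ be a commutative valuation domain with quotient field $F$, $K/F$ a finite Galois extension with group $G$ which is tamely ramified and defectless, $S$ the integral closure of $V$ in $K$, assume $S$ is finitely generated as a $V$-module, and let $f:G\times G\to S\setminus\{0\}$ be a normalized $2$-cocycle. Then the following are equivalent: (1) $A_f$ is semihereditary; (2) for each maximal ideal $M$ of $S$, $G^T(S_M\mid F)\subseteq H_M$ and there exists a set of right coset representatives $\sigma_1,\ldots,\sigma_m$ of $G^T(S_M\mid F)$ in $G$ with $f(\sigma_i,\sigma_i^{-1})\notin M^2$ for all $i$; (3) for each maximal ideal $M$ of $S$, $A_{f_{(M)}}$ is semihereditary and there exists a set of right coset representatives $\sigma_1,\ldots,\sigma_m$ of $G^T(S_M\mid F)$ in $G$ with $f(\sigma_i,\sigma_i^{-1})\notin M^2$ for all $i$.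
   Context: $V$ has arbitrary Krull dimension. A normalized 2-cocycle satisfies $\sigma(f(\tau,\gamma))f(\sigma,\tau\gamma)=f(\sigma,\tau)f(\sigma\tau,\gamma)$, $f(1,\sigma)=f(\sigma,1)=1$; values need not be units. $A_f=\bigoplus_{\sigma\in G}Sx_\sigma$ (free left $S$-module) with $(sx_\sigma)(tx_\tau)=s\,\sigma(t)f(\sigma,\tau)x_{\sigma\tau}$. Semihereditary: finitely generated one-sided ideals projective. For a maximal ideal $M$ of $S$: $G^Z=\{\sigma\in G:\sigma(S_M)\subseteq S_M\}$; $H_M=\{\sigma\in G^Z: f(\sigma,\sigma^{-1})\notin M\}$; $G^T=G^T(S_M\mid F)=\{\sigma\in G:\sigma(x)-x\in J(S_M)\ \forall x\in S_M\}$ with fixed field $K^T$; $U=K^T\cap S_M$, $T$ the integral closure of $U$ in $K$; $f_{(M)}$ is the restriction of $f$ to $G^T\times G^T$ and $A_{f_{(M)}}=\sum_{\sigma\in G^T}Tx_\sigma$ with the same multiplication rule. Tamely ramified and defectless: $e=[\Gamma_{S_M}:\Gamma_V]$, $r$ = number of maximal ideals of $S$, $[K:F]=e[\overline{S_M}:\overline V]r$, $\mathrm{char}\,\overline V\nmid e$, $\overline{S_M}/\overline V$ separable. *)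

theory Defs
  imports "HOL-Computational_Algebra.Polynomial"
begin

section \<open>Commutative algebra inside a fixed field K (the type 'k)\<close>

definition is_subring :: "'k::field set \<Rightarrow> bool" where
  "is_subring R \<longleftrightarrow> 0 \<in> R \<and> 1 \<in> R \<and> (\<forall>x\<in>R. \<forall>y\<in>R. x + y \<in> R \<and> x * y \<in> R \<and> - x \<in> R)"

definition ideal_in :: "'k::field set \<Rightarrow> 'k set \<Rightarrow> bool" where
  "ideal_in R I \<longleftrightarrow> I \<subseteq> R \<and> 0 \<in> I \<and> (\<forall>x\<in>I. \<forall>y\<in>I. x + y \<in> I) \<and> (\<forall>r\<in>R. \<forall>x\<in>I. r * x \<in> I)"

definition maximal_ideal_in :: "'k::field set \<Rightarrow> 'k set \<Rightarrow> bool" where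
  "maximal_ideal_in R M \<longleftrightarrow> ideal_in R M \<and> M \<noteq> R \<and>
     (\<forall>J. ideal_in R J \<and> M \<subseteq> J \<longrightarrow> J = M \<or> J = R)"

definition jacobson :: "'k::field set \<Rightarrow> 'k set" where
  "jacobson R = \<Inter> {M. maximal_ideal_in R M}"

definition ideal_prod :: "'k::field set \<Rightarrow> 'k set \<Rightarrow> 'k set" where
  "ideal_prod M N = {x. \<exists>(n::nat) a b. (\<forall>i<n. a i \<in> M \<and> b i \<in> N) \<and> x = (\<Sum>i<n. a i * b i)}"

definition frac_field :: "'k::field set \<Rightarrow> 'k set" where
  "frac_field V = {a / b | a b. a \<in> V \<and> b \<in> V \<and> b \<noteq> 0}"

definition valuation_domain :: "'k::field set \<Rightarrow> bool" where
  "valuation_domain V \<longleftrightarrow> is_subring V \<and>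
     (\<forall>x\<in>frac_field V. x \<noteq> 0 \<longrightarrow> x \<in> V \<or> inverse x \<in> V)"

definition integral_closure :: "'k::field set \<Rightarrow> 'k set" where
  "integral_closure R = {x. \<exists>p. lead_coeff p = 1 \<and> (\<forall>i. coeff p i \<in> R) \<and> poly p x = 0}"

definition fg_module :: "'k::field set \<Rightarrow> 'k set \<Rightarrow> bool" where
  "fg_module V S \<longleftrightarrow> (\<exists>B. finite B \<and> B \<subseteq> S \<and>
     (\<forall>s\<in>S. \<exists>c. (\<forall>b\<in>B. c b \<in> V) \<and> s = (\<Sum>b\<in>B. c b * b)))"

definition localization :: "'k::field set \<Rightarrow> 'k set \<Rightarrow> 'k set" where
  "localization S M = {a / b | a b. a \<in> S \<and> b \<in> S \<and> b \<notin> M}"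

definition units_in :: "'k::field set \<Rightarrow> 'k set" where
  "units_in R = {u \<in> R. u \<noteq> 0 \<and> inverse u \<in> R}"

section \<open>Field automorphisms, Galois extensions (K = UNIV :: 'k set)\<close>

definition field_aut :: "('k::field \<Rightarrow> 'k) \<Rightarrow> bool" where
  "field_aut \<sigma> \<longleftrightarrow> bij \<sigma> \<and> (\<forall>x y. \<sigma> (x + y) = \<sigma> x + \<sigma> y \<and> \<sigma> (x * y) = \<sigma> x * \<sigma> y) \<and> \<sigma> 1 = 1"

definition aut_group :: "'k::field set \<Rightarrow> ('k \<Rightarrow> 'k) set" where
  "aut_group F = {\<sigma>. field_aut \<sigma> \<and> (\<forall>x\<in>F. \<sigma> x = x)}"

definition fixed_field :: "('k::field \<Rightarrow> 'k) set \<Rightarrow> 'k set" where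
  "fixed_field H = {x. \<forall>\<sigma>\<in>H. \<sigma> x = x}"

definition has_degree :: "'k::field set \<Rightarrow> nat \<Rightarrow> bool" where
  "has_degree F n \<longleftrightarrow> (\<exists>b :: nat \<Rightarrow> 'k.
     (\<forall>x. \<exists>c. (\<forall>i<n. c i \<in> F) \<and> x = (\<Sum>i<n. c i * b i)) \<and>
     (\<forall>c. (\<forall>i<n. c i \<in> F) \<and> (\<Sum>i<n. c i * b i) = 0 \<longrightarrow> (\<forall>i<n. c i = 0)))"

definition finite_galois :: "'k::field set \<Rightarrow> ('k \<Rightarrow> 'k) set \<Rightarrow> bool" where
  "finite_galois F G \<longleftrightarrow> (\<exists>n. has_degree F n) \<and> G = aut_group F \<and> fixed_field G = F"

text \<open>e = [Gamma_R : Gamma_V] where Gamma_R = K^*/U(R) and Gamma_V is the image of F^*: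
  number of cosets of F^* U(R) in K^*.\<close>
definition ram_index :: "'k::field set \<Rightarrow> 'k set \<Rightarrow> nat" where
  "ram_index V R = card ((UNIV - {0}) // {(x, y). x \<noteq> 0 \<and> y \<noteq> 0 \<and>
      (\<exists>a\<in>frac_field V - {0}. \<exists>u\<in>units_in R. x = a * u * y)})"

definition residue_degree :: "'k::field set \<Rightarrow> 'k set \<Rightarrow> nat \<Rightarrow> bool" where
  "residue_degree V R n \<longleftrightarrow> (\<exists>x :: nat \<Rightarrow> 'k. (\<forall>i<n. x i \<in> R) \<and>
     (\<forall>y\<in>R. \<exists>c. (\<forall>i<n. c i \<in> V) \<and> y - (\<Sum>i<n. c i * x i) \<in> jacobson R) \<and>
     (\<forall>c. (\<forall>i<n. c i \<in> V) \<and> (\<Sum>i<n. c i * x i) \<in> jacobson R \<longrightarrow> (\<forall>i<n. c i \<in> jacobson R)))"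

text \<open>R/J(R) separable over V/J(V): every residue is a root of a monic polynomial over
  V/J(V) which is coprime to its derivative in (V/J(V))[X].\<close>
definition residue_separable :: "'k::field set \<Rightarrow> 'k set \<Rightarrow> bool" where
  "residue_separable V R \<longleftrightarrow> (\<forall>y\<in>R. \<exists>p. (\<forall>i. coeff p i \<in> V) \<and> lead_coeff p = 1 \<and>
     poly p y \<in> jacobson R \<and>
     (\<exists>u w. (\<forall>i. coeff u i \<in> V) \<and> (\<forall>i. coeff w i \<in> V) \<and>
        (\<forall>i. coeff (u * p + w * pderiv p - 1) i \<in> jacobson V)))"

definition tame_defectless :: "'k::field set \<Rightarrow> 'k set \<Rightarrow> bool" where
  "tame_defectless V S \<longleftrightarrow> (\<forall>M. maximal_ideal_in S M \<longrightarrow>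
     (\<exists>fd. residue_degree V (localization S M) fd \<and>
        has_degree (frac_field V)
          (ram_index V (localization S M) * fd * card {N. maximal_ideal_in S N}) \<and>
        of_nat (ram_index V (localization S M)) \<notin> jacobson V \<and>
        residue_separable V (localization S M)))"

definition normalized_cocycle :: "('k::field \<Rightarrow> 'k) set \<Rightarrow> (('k \<Rightarrow> 'k) \<Rightarrow> ('k \<Rightarrow> 'k) \<Rightarrow> 'k) \<Rightarrow> bool" where
  "normalized_cocycle G f \<longleftrightarrow>
     (\<forall>\<sigma>\<in>G. \<forall>\<tau>\<in>G. \<forall>\<gamma>\<in>G. \<sigma> (f \<tau> \<gamma>) * f \<sigma> (\<tau> \<circ> \<gamma>) = f \<sigma> \<tau> * f (\<sigma> \<circ> \<tau>) \<gamma>) \<and>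
     (\<forall>\<sigma>\<in>G. f id \<sigma> = 1 \<and> f \<sigma> id = 1)"

text \<open>Elements of sum_{sigma in H} R x_sigma are coefficient functions H -> R.\<close>
definition cp_carrier :: "'k::field set \<Rightarrow> ('k \<Rightarrow> 'k) set \<Rightarrow> (('k \<Rightarrow> 'k) \<Rightarrow> 'k) set" where
  "cp_carrier R H = {a. (\<forall>\<sigma>\<in>H. a \<sigma> \<in> R) \<and> (\<forall>\<sigma>. \<sigma> \<notin> H \<longrightarrow> a \<sigma> = 0)}"

definition cp_add :: "(('k::field \<Rightarrow> 'k) \<Rightarrow> 'k) \<Rightarrow> (('k \<Rightarrow> 'k) \<Rightarrow> 'k) \<Rightarrow> ('k \<Rightarrow> 'k) \<Rightarrow> 'k" where
  "cp_add a b = (\<lambda>\<sigma>. a \<sigma> + b \<sigma>)"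

definition cp_zero :: "('k::field \<Rightarrow> 'k) \<Rightarrow> 'k" where
  "cp_zero = (\<lambda>_. 0)"

text \<open>(s x_sigma)(t x_tau) = s sigma(t) f(sigma,tau) x_{sigma tau}.\<close>
definition cp_mult :: "('k::field \<Rightarrow> 'k) set \<Rightarrow> (('k \<Rightarrow> 'k) \<Rightarrow> ('k \<Rightarrow> 'k) \<Rightarrow> 'k) \<Rightarrow>
     (('k \<Rightarrow> 'k) \<Rightarrow> 'k) \<Rightarrow> (('k \<Rightarrow> 'k) \<Rightarrow> 'k) \<Rightarrow> ('k \<Rightarrow> 'k) \<Rightarrow> 'k" where
  "cp_mult H f a b = (\<lambda>\<rho>. \<Sum>\<sigma>\<in>H. \<Sum>\<tau>\<in>H. if \<sigma> \<circ> \<tau> = \<rho> then a \<sigma> * \<sigma> (b \<tau>) * f \<sigma> \<tau> else 0)"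

definition left_ideal :: "'a set \<Rightarrow> ('a \<Rightarrow> 'a \<Rightarrow> 'a) \<Rightarrow> 'a \<Rightarrow> ('a \<Rightarrow> 'a \<Rightarrow> 'a) \<Rightarrow> 'a set \<Rightarrow> bool" where
  "left_ideal C add z mul I \<longleftrightarrow> I \<subseteq> C \<and> z \<in> I \<and>
     (\<forall>x\<in>I. \<forall>y\<in>I. add x y \<in> I) \<and> (\<forall>x\<in>I. \<exists>y\<in>I. add x y = z) \<and>
     (\<forall>r\<in>C. \<forall>x\<in>I. mul r x \<in> I)"

definition fg_left_ideal :: "'a set \<Rightarrow> ('a \<Rightarrow> 'a \<Rightarrow> 'a) \<Rightarrow> 'a \<Rightarrow> ('a \<Rightarrow> 'a \<Rightarrow> 'a) \<Rightarrow> 'a set \<Rightarrow> bool" where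
  "fg_left_ideal C add z mul I \<longleftrightarrow> (\<exists>X. finite X \<and> X \<subseteq> C \<and>
     I = \<Inter> {J. left_ideal C add z mul J \<and> X \<subseteq> J})"

definition free_mod :: "'a set \<Rightarrow> 'a \<Rightarrow> nat \<Rightarrow> (nat \<Rightarrow> 'a) set" where
  "free_mod C z n = {v. (\<forall>i<n. v i \<in> C) \<and> (\<forall>i\<ge>n. v i = z)}"

text \<open>A left ideal I is projective iff it is a direct summand (retract) of a free module;
  for finitely generated I a free module of finite rank suffices.\<close>
definition left_projective :: "'a set \<Rightarrow> ('a \<Rightarrow> 'a \<Rightarrow> 'a) \<Rightarrow> 'a \<Rightarrow> ('a \<Rightarrow> 'a \<Rightarrow> 'a) \<Rightarrow> 'a set \<Rightarrow> bool" where
  "left_projective C add z mul I \<longleftrightarrow> (\<exists>n (\<iota> :: 'a \<Rightarrow> nat \<Rightarrow> 'a) (\<pi> :: (nat \<Rightarrow> 'a) \<Rightarrow> 'a).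
     (\<forall>x\<in>I. \<iota> x \<in> free_mod C z n) \<and>
     (\<forall>x\<in>I. \<forall>y\<in>I. \<iota> (add x y) = (\<lambda>i. add (\<iota> x i) (\<iota> y i))) \<and>
     (\<forall>r\<in>C. \<forall>x\<in>I. \<iota> (mul r x) = (\<lambda>i. if i < n then mul r (\<iota> x i) else z)) \<and>
     (\<forall>v\<in>free_mod C z n. \<pi> v \<in> I) \<and>
     (\<forall>v\<in>free_mod C z n. \<forall>w\<in>free_mod C z n. \<pi> (\<lambda>i. add (v i) (w i)) = add (\<pi> v) (\<pi> w)) \<and>
     (\<forall>r\<in>C. \<forall>v\<in>free_mod C z n. \<pi> (\<lambda>i. if i < n then mul r (v i) else z) = mul r (\<pi> v)) \<and>
     (\<forall>x\<in>I. \<pi> (\<iota> x) = x))"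

definition left_semihereditary :: "'a set \<Rightarrow> ('a \<Rightarrow> 'a \<Rightarrow> 'a) \<Rightarrow> 'a \<Rightarrow> ('a \<Rightarrow> 'a \<Rightarrow> 'a) \<Rightarrow> bool" where
  "left_semihereditary C add z mul \<longleftrightarrow>
     (\<forall>I. fg_left_ideal C add z mul I \<longrightarrow> left_projective C add z mul I)"

text \<open>Semihereditary: finitely generated left and right ideals are projective
  (right ideals of R = left ideals of the opposite ring).\<close>
definition semihereditary :: "'a set \<Rightarrow> ('a \<Rightarrow> 'a \<Rightarrow> 'a) \<Rightarrow> 'a \<Rightarrow> ('a \<Rightarrow> 'a \<Rightarrow> 'a) \<Rightarrow> bool" where
  "semihereditary C add z mul \<longleftrightarrow>
     left_semihereditary C add z mul \<and> left_semihereditary C add z (\<lambda>x y. mul y x)"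

definition crossed_product_semihereditary ::
  "'k::field set \<Rightarrow> ('k \<Rightarrow> 'k) set \<Rightarrow> (('k \<Rightarrow> 'k) \<Rightarrow> ('k \<Rightarrow> 'k) \<Rightarrow> 'k) \<Rightarrow> bool" where
  "crossed_product_semihereditary R H f \<longleftrightarrow>
     semihereditary (cp_carrier R H) cp_add cp_zero (cp_mult H f)"

definition decomp_group :: "('k::field \<Rightarrow> 'k) set \<Rightarrow> 'k set \<Rightarrow> ('k \<Rightarrow> 'k) set" where
  "decomp_group G SM = {\<sigma>\<in>G. \<sigma> ` SM \<subseteq> SM}"

definition H_group :: "('k::field \<Rightarrow> 'k) set \<Rightarrow> 'k set \<Rightarrow> 'k set \<Rightarrow>
     (('k \<Rightarrow> 'k) \<Rightarrow> ('k \<Rightarrow> 'k) \<Rightarrow> 'k) \<Rightarrow> ('k \<Rightarrow> 'k) set" where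
  "H_group G S M f = {\<sigma>\<in>decomp_group G (localization S M). f \<sigma> (inv \<sigma>) \<notin> M}"

definition inertia_group :: "('k::field \<Rightarrow> 'k) set \<Rightarrow> 'k set \<Rightarrow> ('k \<Rightarrow> 'k) set" where
  "inertia_group G SM = {\<sigma>\<in>G. \<forall>x\<in>SM. \<sigma> x - x \<in> jacobson SM}"

definition right_coset_reps :: "('k \<Rightarrow> 'k) set \<Rightarrow> ('k \<Rightarrow> 'k) set \<Rightarrow> ('k \<Rightarrow> 'k) set \<Rightarrow> bool" where
  "right_coset_reps G H Rs \<longleftrightarrow> Rs \<subseteq> G \<and>
     (\<forall>\<sigma>\<in>G. \<exists>!\<rho>. \<rho> \<in> Rs \<and> (\<exists>\<tau>\<in>H. \<rho> = \<tau> \<circ> \<sigma>))"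

definition T_ring :: "('k::field \<Rightarrow> 'k) set \<Rightarrow> 'k set \<Rightarrow> 'k set \<Rightarrow> 'k set" where
  "T_ring G S M = integral_closure
     (fixed_field (inertia_group G (localization S M)) \<inter> localization S M)"

end

theory Submission
  imports Defs "Jordan_Normal_Form.Char_Poly"
begin

text \<open>
  Necessity: the left ideal generated by \<open>m \<in> M\<close> and \<open>x_\<rho>\<close> is projective, and comparing
  homogeneous components of a dual basis at \<open>M\<close> shows that \<open>f(\<rho>, \<rho>\<^sup>-\<^sup>1)\<close> divides every
  \<open>m \<in> M\<close> locally; hence it is not in \<open>M\<^sup>2\<close>. For \<open>\<tau>\<close> in the inertia group of \<open>M\<close>, the power
  of \<open>x_\<tau>\<close> with exponent the order of \<open>\<tau>\<close> lies in the fixed field of \<open>\<tau>\<close>, over which \<open>K\<close> is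
  totally tamely ramified, and this forces \<open>f(\<tau>, \<tau>\<^sup>-\<^sup>1)\<close> to be a unit at \<open>M\<close>.

  Sufficiency: a finitely generated left ideal is a quotient of \<open>A_f\<^sup>n\<close> by a submodule \<open>N\<close>. As no
  value of \<open>f\<close> lies in the square of a maximal ideal, Gaussian elimination over \<open>S_M\<close> yields a
  \<open>K\<close>-linear retraction onto \<open>K N\<close> that preserves all the lattices obtained from \<open>A_f\<^sup>n\<close> by
  applying the inverses of the \<open>x_\<sigma>\<close>. Averaging it over \<open>G\<close> with weights \<open>\<sigma>(t)\<close> of sum 1, which
  exist by tameness, gives an \<open>A_f\<close>-linear retraction of \<open>A_f\<^sup>n\<close> onto \<open>N\<close>. The opposite ring is
  again such a crossed product. Finally, the ring \<open>T\<close> of the third condition is \<open>S_M\<close>.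
\<close>

unbundle no m_inv_syntax

section \<open>Subrings of a field\<close>

text \<open>\<open>V\<close> has arbitrary rank, so \<open>M\<close> may be idempotent and a
  uniformizer need not exist. The square condition covers all cases: a value of \<open>f\<close>
  outside \<open>M^2\<close> is a unit at \<open>M\<close> or generates the maximal ideal of the
  localization at \<open>M\<close>.

  The average, the sum of \<open>x_\<sigma> t k x_\<sigma>^-1\<close>, is integral once
  \<open>t k\<close> preserves every lattice \<open>x_\<sigma>^-1 A_f^n\<close>. These lattices
  differ by diagonal rescalings with values of \<open>f\<close>; a pivot good for one could be bad
  for another only if a conjugate of a value of \<open>f\<close> were in \<open>M^2\<close>. The
  retraction \<open>k\<close> is adapted to a single \<open>M\<close>. At another maximal ideal
  \<open>N\<close>, \<open>t\<close> supplies a denominator of \<open>k\<close> and one factor in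
  \<open>N\<close>, which makes up for a division by a value of \<open>f\<close> outside
  \<open>N^2\<close>.

  Tameness enters through the residue characters \<open>\<tau> y / y\<close> of the inertia group.
  Finite generation of \<open>S\<close> provides a least value of \<open>\<tau> x - x\<close>;
  separability attains it on the maximal ideal, which a trivial character would prevent. Finite
  generation also makes \<open>S\<close> integrally closed, and on this rests the valuation property
  of its localizations.\<close>

locale subring_field =
  fixes R :: "'k::field set"
  assumes subring: "is_subring R"
begin

lemma zero_mem [simp, intro]: "0 \<in> R"
  and one_mem [simp, intro]: "1 \<in> R"
  and add_mem [intro]: "x \<in> R \<Longrightarrow> y \<in> R \<Longrightarrow> x + y \<in> R"
  and mult_mem [intro]: "x \<in> R \<Longrightarrow> y \<in> R \<Longrightarrow> x * y \<in> R"
  and uminus_mem [intro]: "x \<in> R \<Longrightarrow> - x \<in> R"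
  using subring by (auto simp: is_subring_def)

lemma diff_mem [intro]: "x \<in> R \<Longrightarrow> y \<in> R \<Longrightarrow> x - y \<in> R"
  using add_mem[of x "- y"] by auto

lemma sum_mem [intro]: "(\<And>i. i \<in> A \<Longrightarrow> g i \<in> R) \<Longrightarrow> (\<Sum>i\<in>A. g i) \<in> R"
  by (induction A rule: infinite_finite_induct) auto

lemma prod_mem [intro]: "(\<And>i. i \<in> A \<Longrightarrow> g i \<in> R) \<Longrightarrow> (\<Prod>i\<in>A. g i) \<in> R"
  by (induction A rule: infinite_finite_induct) auto

lemma power_mem [intro]: "x \<in> R \<Longrightarrow> x ^ n \<in> R"
  by (induction n) auto

lemma of_nat_mem [simp, intro]: "of_nat n \<in> R"
  by (induction n) auto

lemma poly_mem: "(\<And>i. coeff p i \<in> R) \<Longrightarrow> x \<in> R \<Longrightarrow> poly p x \<in> R"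
  unfolding poly_altdef by auto

end

lemma ideal_inD:
  assumes "ideal_in R I"
  shows "I \<subseteq> R" "0 \<in> I" "\<And>x y. x \<in> I \<Longrightarrow> y \<in> I \<Longrightarrow> x + y \<in> I"
    "\<And>r x. r \<in> R \<Longrightarrow> x \<in> I \<Longrightarrow> r * x \<in> I" "\<And>r x. r \<in> R \<Longrightarrow> x \<in> I \<Longrightarrow> x * r \<in> I"
  using assms by (auto simp: ideal_in_def mult.commute)

locale ideal_field = subring_field +
  fixes N :: "'k::field set"
  assumes ideal: "ideal_in R N"
begin

lemma ideal_sub: "x \<in> N \<Longrightarrow> x \<in> R"
  and ideal_zero [simp, intro]: "0 \<in> N"
  and ideal_add [intro]: "x \<in> N \<Longrightarrow> y \<in> N \<Longrightarrow> x + y \<in> N"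
  and ideal_mult_left [intro]: "r \<in> R \<Longrightarrow> x \<in> N \<Longrightarrow> r * x \<in> N"
  and ideal_mult_right [intro]: "r \<in> R \<Longrightarrow> x \<in> N \<Longrightarrow> x * r \<in> N"
  using ideal_inD[OF ideal] by auto

lemma ideal_uminus [intro]: "x \<in> N \<Longrightarrow> - x \<in> N"
  using ideal_mult_left[of "- 1" x] by auto

lemma ideal_diff [intro]: "x \<in> N \<Longrightarrow> y \<in> N \<Longrightarrow> x - y \<in> N"
  using ideal_add[of x "- y"] by auto

lemma ideal_sum [intro]: "(\<And>i. i \<in> A \<Longrightarrow> g i \<in> N) \<Longrightarrow> (\<Sum>i\<in>A. g i) \<in> N"
  by (induction A rule: infinite_finite_induct) auto

lemma ideal_prod_mem:
  "finite A \<Longrightarrow> a \<in> A \<Longrightarrow> g a \<in> N \<Longrightarrow> (\<And>i. i \<in> A \<Longrightarrow> g i \<in> R) \<Longrightarrow> (\<Prod>i\<in>A. g i) \<in> N"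
  by (subst prod.remove[of A a]) auto

end

section \<open>Maximal ideals and localizations\<close>

locale maximal_ideal_field = subring_field +
  fixes N :: "'k::field set"
  assumes maximal: "maximal_ideal_in R N"

sublocale maximal_ideal_field \<subseteq> ideal_field
  using maximal by unfold_locales (auto simp: maximal_ideal_in_def)

definition loc_ideal :: "'k::field set \<Rightarrow> 'k set \<Rightarrow> 'k set" where
  "loc_ideal R N = {a / b | a b. a \<in> N \<and> b \<in> R \<and> b \<notin> N}"

text \<open>The ideal is a parameter, so that \<open>loc_ideal\<close> and \<open>JV\<close> fit as
  they come; \<open>jacobson_eq\<close> and \<open>maximal_iff\<close> then identify it with the
  notions of the theorem.\<close>

locale local_subring = subring_field Q for Q :: "'k::field set" +
  fixes J :: "'k set"
  assumes J_ideal: "ideal_in Q J"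
    and one_notin_J [simp]: "1 \<notin> J"
    and inverse_mem: "x \<in> Q \<Longrightarrow> x \<notin> J \<Longrightarrow> inverse x \<in> Q"

sublocale local_subring \<subseteq> ideal_field Q J
  using J_ideal by unfold_locales

context local_subring
begin

lemma divide_mem: "x \<in> Q \<Longrightarrow> y \<in> Q \<Longrightarrow> y \<notin> J \<Longrightarrow> x / y \<in> Q"
  using inverse_mem[of y] by (auto simp: divide_inverse)

lemma nonunit_iff: "x \<in> Q \<Longrightarrow> x \<in> J \<longleftrightarrow> x = 0 \<or> inverse x \<notin> Q"
  using ideal_mult_left[of "inverse x" x] inverse_mem[of x] one_notin_J by (cases "x = 0") auto

lemma unit_notin_J: "x \<in> Q \<Longrightarrow> inverse x \<in> Q \<Longrightarrow> x \<noteq> 0 \<Longrightarrow> x \<notin> J"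
  using nonunit_iff by auto

lemma J_prime: "a \<in> Q \<Longrightarrow> b \<in> Q \<Longrightarrow> a * b \<in> J \<Longrightarrow> a \<in> J \<or> b \<in> J"
  using inverse_mem[of a] inverse_mem[of b] nonunit_iff[of "a * b"] by auto

lemma units_in_iff: "u \<in> units_in Q \<longleftrightarrow> u \<in> Q \<and> u \<notin> J"
  using nonunit_iff inverse_mem unfolding units_in_def by auto

lemma maximal_iff: "maximal_ideal_in Q P \<longleftrightarrow> P = J"
proof
  have sub: "I \<subseteq> J" if "ideal_in Q I" "I \<noteq> Q" for I
  proof
    fix x assume x: "x \<in> I"
    show "x \<in> J"
    proof (rule ccontr)
      assume n: "x \<notin> J"
      have "x \<in> Q" "x \<noteq> 0" using x n that ideal_inD(1) by auto
      hence "1 \<in> I" using ideal_inD(4)[OF that(1) inverse_mem[of x] x] n by simp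
      hence "I = Q" using ideal_inD[OF that(1)] by (metis mult.right_neutral subsetI subset_antisym)
      thus False using that by simp
    qed
  qed
  show "P = J" if "maximal_ideal_in Q P"
    using that sub[of P] J_ideal one_notin_J one_mem unfolding maximal_ideal_in_def by blast
  have "maximal_ideal_in Q J"
    unfolding maximal_ideal_in_def
  proof (intro conjI allI impI)
    fix I assume "ideal_in Q I \<and> J \<subseteq> I"
    thus "I = J \<or> I = Q" using sub[of I] by auto
  qed (use J_ideal one_notin_J one_mem in blast)+
  thus "maximal_ideal_in Q P" if "P = J" using that by simp
qed

lemma jacobson_eq: "jacobson Q = J"
  unfolding jacobson_def maximal_iff by auto

lemma localization_eq: "localization Q J = Q"
proof
  show "localization Q J \<subseteq> Q" unfolding localization_def by (auto intro: divide_mem)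
  show "Q \<subseteq> localization Q J" unfolding localization_def
    by (metis (mono_tags, lifting) CollectI div_by_1 one_mem one_notin_J subsetI)
qed

end

context maximal_ideal_field
begin

lemma one_notin [simp]: "1 \<notin> N"
proof
  assume "1 \<in> N"
  hence "N = R" using ideal_mult_left[of _ 1] ideal_sub by auto
  thus False using maximal by (auto simp: maximal_ideal_in_def)
qed

lemma inverse_mod: 
  assumes a: "a \<in> R" "a \<notin> N"
  obtains d where "d \<in> R" "a * d - 1 \<in> N"
proof -
  let ?I = "{x + r * a | x r. x \<in> N \<and> r \<in> R}"
  have "ideal_in R ?I"
    unfolding ideal_in_def
  proof (intro conjI ballI)
    show "?I \<subseteq> R" using a ideal_sub by auto
    show "0 \<in> ?I" by (rule CollectI, rule exI[of _ 0], rule exI[of _ 0]) auto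
  next
    fix x y assume "x \<in> ?I" "y \<in> ?I"
    then obtain x1 r1 x2 r2 where *: "x = x1 + r1 * a" "y = x2 + r2 * a" "x1 \<in> N" "x2 \<in> N" "r1 \<in> R" "r2 \<in> R" by auto
    have "x + y = (x1 + x2) + (r1 + r2) * a" using * by (simp add: algebra_simps)
    thus "x + y \<in> ?I" using * by blast
  next
    fix r x assume "r \<in> R" "x \<in> ?I"
    then obtain x1 r1 where *: "x = x1 + r1 * a" "x1 \<in> N" "r1 \<in> R" by auto
    have "r * x = r * x1 + (r * r1) * a" using * by (simp add: algebra_simps)
    thus "r * x \<in> ?I" using * \<open>r \<in> R\<close> by blast
  qed
  moreover have "N \<subseteq> ?I"
  proof
    fix x assume "x \<in> N"
    thus "x \<in> ?I" by (intro CollectI exI[of _ x] exI[of _ 0]) auto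
  qed
  moreover have "a \<in> ?I" by (rule CollectI, rule exI[of _ 0], rule exI[of _ 1]) auto
  ultimately have "?I = R" using maximal a unfolding maximal_ideal_in_def by blast
  hence "1 \<in> ?I" by simp
  then obtain x r where "1 = x + r * a" "x \<in> N" "r \<in> R" by blast
  hence "a * r - 1 = - x" by (simp add: algebra_simps)
  thus thesis using that[of r] \<open>r \<in> R\<close> \<open>x \<in> N\<close> by auto
qed

lemma prime: 
  assumes "a \<in> R" "b \<in> R" "a * b \<in> N"
  shows "a \<in> N \<or> b \<in> N"
proof (rule ccontr)
  assume n: "\<not> (a \<in> N \<or> b \<in> N)"
  then obtain d where d: "d \<in> R" "a * d - 1 \<in> N" using inverse_mod assms by blast
  have "b = d * (a * b) - b * (a * d - 1)" by (simp add: algebra_simps)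
  also have "\<dots> \<in> N"
    using ideal_diff[OF ideal_mult_left[OF d(1) assms(3)] ideal_mult_left[OF assms(2) d(2)]] .
  finally show False using n by simp
qed

lemma prod_notin: "(\<And>i. i \<in> A \<Longrightarrow> g i \<in> R \<and> g i \<notin> N) \<Longrightarrow> (\<Prod>i\<in>A. g i) \<notin> N"
proof (induction A rule: infinite_finite_induct)
  case (insert a A)
  have "(\<Prod>i\<in>A. g i) \<in> R" using insert by auto
  thus ?case using insert prime[of "g a" "\<Prod>i\<in>A. g i"] by auto
qed auto

abbreviation "RN \<equiv> localization R N"
abbreviation "JN \<equiv> loc_ideal R N"

lemma locI: "a \<in> R \<Longrightarrow> b \<in> R \<Longrightarrow> b \<notin> N \<Longrightarrow> a / b \<in> RN"
  unfolding localization_def by auto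

lemma locE: 
  assumes "x \<in> RN"
  obtains a b where "x = a / b" "a \<in> R" "b \<in> R" "b \<notin> N" "b \<noteq> 0"
  using assms unfolding localization_def by fastforce

lemma loc_idealI: "a \<in> N \<Longrightarrow> b \<in> R \<Longrightarrow> b \<notin> N \<Longrightarrow> a / b \<in> JN"
  unfolding loc_ideal_def by auto

lemma loc_idealE: 
  assumes "x \<in> JN"
  obtains a b where "x = a / b" "a \<in> N" "b \<in> R" "b \<notin> N" "b \<noteq> 0"
  using assms unfolding loc_ideal_def by fastforce

lemma sub_loc: "x \<in> R \<Longrightarrow> x \<in> RN"
  using locI[of x 1] by simp

lemma ideal_sub_loc: "x \<in> N \<Longrightarrow> x \<in> JN"
  using loc_idealI[of x 1] by simp

lemma mult_notin: "a \<in> R \<Longrightarrow> b \<in> R \<Longrightarrow> a \<notin> N \<Longrightarrow> b \<notin> N \<Longrightarrow> a * b \<notin> N"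
  using prime by blast

lemma loc_ideal_Int: "x \<in> R \<Longrightarrow> x \<in> JN \<Longrightarrow> x \<in> N"
proof (elim loc_idealE)
  fix a b assume *: "x \<in> R" "x = a / b" "a \<in> N" "b \<in> R" "b \<notin> N" "b \<noteq> 0"
  hence "b * x \<in> N" by simp
  thus "x \<in> N" using prime[of b x] * by auto
qed

lemma local_subring_loc: "local_subring RN JN"
proof
  show "is_subring RN" unfolding is_subring_def
  proof (intro conjI ballI)
    fix x y assume "x \<in> RN" "y \<in> RN"
    then obtain a b c d where *: "x = a / b" "a \<in> R" "b \<in> R" "b \<notin> N" "b \<noteq> 0"
      "y = c / d" "c \<in> R" "d \<in> R" "d \<notin> N" "d \<noteq> 0" by (elim locE)
    have "x + y = (a * d + c * b) / (b * d)" "x * y = (a * c) / (b * d)" "- x = (- a) / b"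
      using * by (auto simp: field_simps)
    thus "x + y \<in> RN" "x * y \<in> RN" "- x \<in> RN"
      using * mult_notin locI[of "a * d + c * b" "b * d"] locI[of "a * c" "b * d"] locI[of "- a" b]
      by auto
  qed (auto intro: sub_loc)
  show "ideal_in RN JN" unfolding ideal_in_def
  proof (intro conjI ballI)
    show "JN \<subseteq> RN" by (auto elim!: loc_idealE intro!: locI ideal_sub)
    show "0 \<in> JN" by (auto intro: ideal_sub_loc)
  next
    fix x y assume "x \<in> JN" "y \<in> JN"
    then obtain a b c d where *: "x = a / b" "a \<in> N" "b \<in> R" "b \<notin> N" "b \<noteq> 0"
      "y = c / d" "c \<in> N" "d \<in> R" "d \<notin> N" "d \<noteq> 0" by (elim loc_idealE)
    have "x + y = (a * d + c * b) / (b * d)" using * by (auto simp: field_simps)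
    thus "x + y \<in> JN" using * mult_notin by (auto intro!: loc_idealI)
  next
    fix x y assume "x \<in> RN" "y \<in> JN"
    then obtain a b c d where *: "x = a / b" "a \<in> R" "b \<in> R" "b \<notin> N" "b \<noteq> 0"
      "y = c / d" "c \<in> N" "d \<in> R" "d \<notin> N" "d \<noteq> 0" by (elim locE loc_idealE)
    have "x * y = (a * c) / (b * d)" using * by (auto simp: field_simps)
    thus "x * y \<in> JN" using * mult_notin by (auto intro!: loc_idealI)
  qed
  show "1 \<notin> JN" using loc_ideal_Int[of 1] by auto
next
  fix x assume *: "x \<in> RN" "x \<notin> JN"
  then obtain a b where ab: "x = a / b" "a \<in> R" "b \<in> R" "b \<notin> N" "b \<noteq> 0" by (elim locE)
  hence "a \<notin> N" using * by (auto intro: loc_idealI)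
  thus "inverse x \<in> RN" using ab locI[of b a] by simp
qed

end

sublocale maximal_ideal_field \<subseteq> loc: local_subring "localization R N" "loc_ideal R N"
  by (rule local_subring_loc)

section \<open>Squares of a maximal ideal\<close>

lemma ideal_prodE:
  assumes "x \<in> ideal_prod M N"
  obtains n :: nat and a b where "\<forall>i<n. a i \<in> M \<and> b i \<in> N" "x = (\<Sum>i<n. a i * b i)"
  using assms unfolding ideal_prod_def by (elim CollectE exE conjE) (rule that)

lemma ideal_prod_memI:
  fixes n :: nat
  assumes "x = (\<Sum>i<n. a i * b i)" "\<And>i. i < n \<Longrightarrow> a i \<in> M" "\<And>i. i < n \<Longrightarrow> b i \<in> N"
  shows "x \<in> ideal_prod M N"
  unfolding ideal_prod_def
  by (intro CollectI exI[of _ n] exI[of _ a] exI[of _ b] conjI allI impI assms)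

context ideal_field
begin

lemma ideal_prod_ideal: "ideal_in R (ideal_prod N N)"
  unfolding ideal_in_def
proof (intro conjI ballI)
  show "ideal_prod N N \<subseteq> R" unfolding ideal_prod_def using ideal_sub by auto
  show "0 \<in> ideal_prod N N" unfolding ideal_prod_def
    by (rule CollectI, rule exI[of _ 0]) auto
next
  fix x y assume x: "x \<in> ideal_prod N N" and y: "y \<in> ideal_prod N N"
  obtain n :: nat and a b where 1: "\<forall>i<n. a i \<in> N \<and> b i \<in> N" "x = (\<Sum>i<n. a i * b i)"
    using x by (rule ideal_prodE)
  obtain m :: nat and c d where 2: "\<forall>i<m. c i \<in> N \<and> d i \<in> N" "y = (\<Sum>i<m. c i * d i)"
    using y by (rule ideal_prodE)
  let ?a = "\<lambda>i. if i < n then a i else c (i - n)" and ?b = "\<lambda>i. if i < n then b i else d (i - n)"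
  have split: "{..<n+m} = {..<n} \<union> {n..<n+m}" by auto
  have "(\<Sum>i<n+m. ?a i * ?b i) = (\<Sum>i<n. ?a i * ?b i) + (\<Sum>i\<in>{n..<n+m}. ?a i * ?b i)"
    unfolding split by (rule sum.union_disjoint) auto
  also have "(\<Sum>i\<in>{n..<n+m}. ?a i * ?b i) = (\<Sum>i<m. c i * d i)"
    by (rule sum.reindex_bij_witness[of _ "\<lambda>i. i + n" "\<lambda>i. i - n"]) auto
  finally have "x + y = (\<Sum>i<n+m. ?a i * ?b i)" using 1 2 by simp
  thus "x + y \<in> ideal_prod N N" by (rule ideal_prod_memI) (use 1 2 in auto)
next
  fix r x assume r: "r \<in> R" and x: "x \<in> ideal_prod N N"
  obtain n :: nat and a b where *: "\<forall>i<n. a i \<in> N \<and> b i \<in> N" "x = (\<Sum>i<n. a i * b i)"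
    using x by (rule ideal_prodE)
  have "r * x = (\<Sum>i<n. (r * a i) * b i)" using * by (simp add: sum_distrib_left mult_ac)
  thus "r * x \<in> ideal_prod N N" using * r by (intro ideal_prod_memI) auto
qed

lemma ideal_prodI: "a \<in> N \<Longrightarrow> b \<in> N \<Longrightarrow> a * b \<in> ideal_prod N N"
  unfolding ideal_prod_def
  by (rule CollectI, rule exI[of _ 1], rule exI[of _ "\<lambda>_. a"], rule exI[of _ "\<lambda>_. b"]) auto

lemma ideal_prod_sub: "x \<in> ideal_prod N N \<Longrightarrow> x \<in> N"
  unfolding ideal_prod_def using ideal_sub by (auto intro!: ideal_sum)

end

context maximal_ideal_field
begin

abbreviation "N2 \<equiv> ideal_prod N N"

sublocale sq: ideal_field R "ideal_prod N N"
  using ideal_prod_ideal by unfold_locales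

text \<open>If \<open>d\<close> inverts \<open>s\<close> modulo \<open>N\<close>, the square of
  \<open>s * d - 1\<close> lies in \<open>N2\<close> and differs from 1 by a multiple of
  \<open>s\<close>; multiplied by \<open>x\<close>, it becomes \<open>x\<close> plus a multiple of
  \<open>s * x\<close>.\<close>

lemma sq_primary:
  assumes "s \<in> R" "s \<notin> N" "x \<in> R" "s * x \<in> N2"
  shows "x \<in> N2"
proof -
  obtain d where d: "d \<in> R" "s * d - 1 \<in> N" using inverse_mod assms by blast
  have "(s * d - 1) * (s * d - 1) \<in> N2" using d by (intro ideal_prodI) auto
  moreover have "x = x * ((s * d - 1) * (s * d - 1)) - (s * x) * (d * (s * d - 2))"
    by (simp add: algebra_simps)
  moreover have "d * (s * d - 2) \<in> R" using d assms of_nat_mem[of 2] by auto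
  ultimately show ?thesis
    using sq.ideal_diff[OF sq.ideal_mult_left[OF assms(3)] sq.ideal_mult_right[OF _ assms(4)]] by metis
qed

text \<open>Clearing denominators puts a multiple of \<open>x\<close> by an element outside
  \<open>N\<close> into \<open>N2\<close>, and \<open>sq_primary\<close> cancels that element. In
  this form, factorizations found in the local ring are confronted with the square
  condition.\<close>

lemma loc_sq_mult:
  assumes "x \<in> R" "a \<in> JN" "b \<in> JN" "x = a * b"
  shows "x \<in> N2"
proof -
  obtain c d c' d' where *: "a = c / d" "c \<in> N" "d \<in> R" "d \<notin> N" "d \<noteq> 0"
    "b = c' / d'" "c' \<in> N" "d' \<in> R" "d' \<notin> N" "d' \<noteq> 0" using assms by (elim loc_idealE)
  have "(d * d') * x = c * c'" using * assms by simp
  hence "(d * d') * x \<in> N2" using * ideal_prodI by simp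
  thus ?thesis using sq_primary[of "d * d'" x] * assms mult_notin by auto
qed

end

section \<open>Existence of maximal ideals and the local-global principle\<close>

context subring_field
begin

lemma ex_maximal_ideal:
  assumes I: "ideal_in R I" "1 \<notin> I"
  obtains N where "maximal_ideal_in R N" "I \<subseteq> N"
proof -
  let ?A = "{I'. ideal_in R I' \<and> I \<subseteq> I' \<and> 1 \<notin> I'}"
  have "\<exists>M\<in>?A. \<forall>X\<in>?A. M \<subseteq> X \<longrightarrow> X = M"
  proof (rule subset_Zorn)
    fix C assume C: "subset.chain ?A C"
    hence sub: "C \<subseteq> ?A" and lin: "\<And>X Y. X \<in> C \<Longrightarrow> Y \<in> C \<Longrightarrow> X \<subseteq> Y \<or> Y \<subseteq> X"
      by (auto simp: subset_chain_def)
    show "\<exists>U\<in>?A. \<forall>X\<in>C. X \<subseteq> U"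
    proof (cases "C = {}")
      case False
      have "ideal_in R (\<Union>C)" unfolding ideal_in_def
      proof (intro conjI ballI)
        show "\<Union>C \<subseteq> R" using sub ideal_inD(1) by blast
        show "0 \<in> \<Union>C" using sub False ideal_inD(2) by blast
        fix x y assume "x \<in> \<Union>C" "y \<in> \<Union>C"
        then obtain X Y where XY: "X \<in> C" "Y \<in> C" "x \<in> X" "y \<in> Y" by auto
        then obtain Z where "Z \<in> C" "x \<in> Z" "y \<in> Z" using lin by blast
        thus "x + y \<in> \<Union>C" using sub ideal_inD(3) by blast
      next
        fix r x assume "r \<in> R" "x \<in> \<Union>C"
        thus "r * x \<in> \<Union>C" using sub ideal_inD(4) by blast
      qed
      hence "\<Union>C \<in> ?A" using False sub by auto
      thus ?thesis by (intro bexI[of _ "\<Union>C"]) auto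
    qed (use I in auto)
  qed
  then obtain M where M: "ideal_in R M" "I \<subseteq> M" "1 \<notin> M" 
    "\<And>X. ideal_in R X \<Longrightarrow> I \<subseteq> X \<Longrightarrow> 1 \<notin> X \<Longrightarrow> M \<subseteq> X \<Longrightarrow> X = M" by auto
  have "maximal_ideal_in R M" unfolding maximal_ideal_in_def
  proof (intro conjI allI impI)
    show "M \<noteq> R" using M by auto
    fix J assume J: "ideal_in R J \<and> M \<subseteq> J"
    show "J = M \<or> J = R"
    proof (cases "1 \<in> J")
      case True
      hence "J = R" using ideal_inD[of R J] J by (metis mult.right_neutral subsetI subset_antisym)
      thus ?thesis ..
    qed (use J M in blast)
  qed (use M in auto)
  thus thesis using that M by blast
qed

text \<open>The denominators of \<open>x\<close> form an ideal. If it were proper, some maximal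
  ideal would contain it, although \<open>x\<close> has a denominator outside that maximal
  ideal.\<close>

lemma mem_of_all_localizations:
  assumes "\<And>N. maximal_ideal_in R N \<Longrightarrow> x \<in> localization R N"
  shows "x \<in> R"
proof (rule ccontr)
  assume x: "x \<notin> R"
  let ?I = "{s \<in> R. s * x \<in> R}"
  have "ideal_in R ?I" unfolding ideal_in_def
  proof (intro conjI ballI)
    fix r s assume "r \<in> R" "s \<in> ?I"
    thus "r * s \<in> ?I" using mult_mem[of r "s * x"] by (auto simp: mult.assoc)
  qed (auto simp: distrib_right)
  moreover have "1 \<notin> ?I" using x by simp
  ultimately obtain N where N: "maximal_ideal_in R N" "?I \<subseteq> N" using ex_maximal_ideal by metis
  then interpret maximal_ideal_field R N by unfold_locales
  obtain a b where ab: "x = a / b" "a \<in> R" "b \<in> R" "b \<notin> N" "b \<noteq> 0" using assms[OF N(1)] by (elim locE)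
  hence "b \<in> ?I" by simp
  thus False using N ab by auto
qed

end

section \<open>Finite groups of field automorphisms\<close>

lemma field_aut_zero: "field_aut \<sigma> \<Longrightarrow> \<sigma> 0 = 0"
  unfolding field_aut_def by (metis add_cancel_right_right)

text \<open>Kept abstract because the Galois group, the decomposition group and the inertia group
  are all instances, each with its own traces and norms.\<close>

locale aut_grp =
  fixes G :: "('k::field \<Rightarrow> 'k) set"
  assumes finite_G [simp]: "finite G"
    and id_mem [simp, intro]: "id \<in> G"
    and comp_mem [simp, intro]: "\<sigma> \<in> G \<Longrightarrow> \<tau> \<in> G \<Longrightarrow> \<sigma> \<circ> \<tau> \<in> G"
    and inv_mem [simp, intro]: "\<sigma> \<in> G \<Longrightarrow> inv \<sigma> \<in> G"
    and aut: "\<sigma> \<in> G \<Longrightarrow> field_aut \<sigma>"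
begin

lemma bij: "\<sigma> \<in> G \<Longrightarrow> bij \<sigma>"
  using aut by (auto simp: field_aut_def)

lemma aut_add [simp]: "\<sigma> \<in> G \<Longrightarrow> \<sigma> (x + y) = \<sigma> x + \<sigma> y"
  and aut_mult [simp]: "\<sigma> \<in> G \<Longrightarrow> \<sigma> (x * y) = \<sigma> x * \<sigma> y"
  and aut_one [simp]: "\<sigma> \<in> G \<Longrightarrow> \<sigma> 1 = 1"
  using aut by (auto simp: field_aut_def)

lemma aut_zero [simp]: "\<sigma> \<in> G \<Longrightarrow> \<sigma> 0 = 0"
  using field_aut_zero aut by auto

lemma aut_eq_iff [simp]: "\<sigma> \<in> G \<Longrightarrow> \<sigma> x = \<sigma> y \<longleftrightarrow> x = y"
  using bij[of \<sigma>] by (auto simp: bij_def inj_def)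

lemma aut_eq_0_iff [simp]: "\<sigma> \<in> G \<Longrightarrow> \<sigma> x = 0 \<longleftrightarrow> x = 0"
  using aut_eq_iff[of \<sigma> x 0] by auto

lemma aut_uminus [simp]: "\<sigma> \<in> G \<Longrightarrow> \<sigma> (- x) = - \<sigma> x"
  using aut_add[of \<sigma> x "- x"] by (simp add: eq_neg_iff_add_eq_0 add.commute)

lemma aut_diff [simp]: "\<sigma> \<in> G \<Longrightarrow> \<sigma> (x - y) = \<sigma> x - \<sigma> y"
  using aut_add[of \<sigma> x "- y"] by simp

lemma aut_inverse [simp]: "\<sigma> \<in> G \<Longrightarrow> \<sigma> (inverse x) = inverse (\<sigma> x)"
  using aut_mult[of \<sigma> x "inverse x"] by (cases "x = 0") (auto intro: inverse_unique[symmetric])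

lemma aut_divide [simp]: "\<sigma> \<in> G \<Longrightarrow> \<sigma> (x / y) = \<sigma> x / \<sigma> y"
  by (simp add: divide_inverse)

lemma aut_sum [simp]: "\<sigma> \<in> G \<Longrightarrow> \<sigma> (\<Sum>i\<in>A. g i) = (\<Sum>i\<in>A. \<sigma> (g i))"
  by (induction A rule: infinite_finite_induct) auto

lemma aut_prod [simp]: "\<sigma> \<in> G \<Longrightarrow> \<sigma> (\<Prod>i\<in>A. g i) = (\<Prod>i\<in>A. \<sigma> (g i))"
  by (induction A rule: infinite_finite_induct) auto

lemma aut_power [simp]: "\<sigma> \<in> G \<Longrightarrow> \<sigma> (x ^ n) = \<sigma> x ^ n"
  by (induction n) auto

lemma inv_aut [simp]: "\<sigma> \<in> G \<Longrightarrow> inv \<sigma> (\<sigma> x) = x"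
  and aut_inv [simp]: "\<sigma> \<in> G \<Longrightarrow> \<sigma> (inv \<sigma> x) = x"
  using bij[of \<sigma>] by (auto simp: bij_is_surj bij_is_inj surj_f_inv_f inv_f_f)

lemma inv_comp [simp]: "\<sigma> \<in> G \<Longrightarrow> inv \<sigma> \<circ> \<sigma> = id"
  and comp_inv [simp]: "\<sigma> \<in> G \<Longrightarrow> \<sigma> \<circ> inv \<sigma> = id"
  by auto

lemma inv_comp_comp [simp]: "\<sigma> \<in> G \<Longrightarrow> inv \<sigma> \<circ> (\<sigma> \<circ> \<tau>) = \<tau>"
  and comp_inv_comp [simp]: "\<sigma> \<in> G \<Longrightarrow> \<sigma> \<circ> (inv \<sigma> \<circ> \<tau>) = \<tau>"
  by (auto simp: fun_eq_iff)

lemma inv_inv [simp]: "\<sigma> \<in> G \<Longrightarrow> inv (inv \<sigma>) = \<sigma>"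
  using bij inv_inv_eq by blast

lemma inv_comp_distrib [simp]: "\<sigma> \<in> G \<Longrightarrow> \<tau> \<in> G \<Longrightarrow> inv (\<sigma> \<circ> \<tau>) = inv \<tau> \<circ> inv \<sigma>"
  by (simp add: bij o_inv_distrib)

lemma comp_eq_iff: "\<sigma> \<in> G \<Longrightarrow> \<tau> \<in> G \<Longrightarrow> \<rho> \<in> G \<Longrightarrow> \<sigma> \<circ> \<tau> = \<rho> \<longleftrightarrow> \<tau> = inv \<sigma> \<circ> \<rho>"
  by auto

lemma sum_left_shift: "\<tau> \<in> G \<Longrightarrow> (\<Sum>\<sigma>\<in>G. h (\<tau> \<circ> \<sigma>)) = (\<Sum>\<sigma>\<in>G. h \<sigma>)"
  by (rule sum.reindex_bij_witness[of _ "\<lambda>\<sigma>. inv \<tau> \<circ> \<sigma>" "\<lambda>\<sigma>. \<tau> \<circ> \<sigma>"]) auto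

lemma prod_left_shift: "\<tau> \<in> G \<Longrightarrow> (\<Prod>\<sigma>\<in>G. h (\<tau> \<circ> \<sigma>)) = (\<Prod>\<sigma>\<in>G. h \<sigma>)"
  by (rule prod.reindex_bij_witness[of _ "\<lambda>\<sigma>. inv \<tau> \<circ> \<sigma>" "\<lambda>\<sigma>. \<tau> \<circ> \<sigma>"]) auto

lemma trace_fixed: "\<tau> \<in> G \<Longrightarrow> \<tau> (\<Sum>\<sigma>\<in>G. \<sigma> x) = (\<Sum>\<sigma>\<in>G. \<sigma> x)"
  using sum_left_shift[of \<tau> "\<lambda>\<sigma>. \<sigma> x"] by simp

lemma norm_fixed: "\<tau> \<in> G \<Longrightarrow> \<tau> (\<Prod>\<sigma>\<in>G. \<sigma> x) = (\<Prod>\<sigma>\<in>G. \<sigma> x)"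
  using prod_left_shift[of \<tau> "\<lambda>\<sigma>. \<sigma> x"] by simp

end

section \<open>Crossed products\<close>

text \<open>Group and ring are arbitrary, so that one development serves \<open>A_f\<close>, its
  opposite, the crossed product of the inertia group over the localization and, with trivial
  cocycle, the mere action of the group on ideals.\<close>

locale crossed = aut_grp G + subring_field R
  for G :: "('k::field \<Rightarrow> 'k) set" and R :: "'k set" +
  fixes f :: "('k \<Rightarrow> 'k) \<Rightarrow> ('k \<Rightarrow> 'k) \<Rightarrow> 'k"
  assumes stable: "\<sigma> \<in> G \<Longrightarrow> x \<in> R \<Longrightarrow> \<sigma> x \<in> R"
    and f_mem [intro]: "\<sigma> \<in> G \<Longrightarrow> \<tau> \<in> G \<Longrightarrow> f \<sigma> \<tau> \<in> R"
    and f_nonzero [simp]: "\<sigma> \<in> G \<Longrightarrow> \<tau> \<in> G \<Longrightarrow> f \<sigma> \<tau> \<noteq> 0"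
    and normalized: "normalized_cocycle G f"
begin

abbreviation "C \<equiv> cp_carrier R G"
abbreviation mul (infixl \<open>\<star>\<close> 70) where "a \<star> b \<equiv> cp_mult G f a b"

lemma f_id [simp]: "\<sigma> \<in> G \<Longrightarrow> f id \<sigma> = 1" "\<sigma> \<in> G \<Longrightarrow> f \<sigma> id = 1"
  using normalized by (auto simp: normalized_cocycle_def)

lemma cocycle:
  "\<sigma> \<in> G \<Longrightarrow> \<tau> \<in> G \<Longrightarrow> \<gamma> \<in> G \<Longrightarrow> \<sigma> (f \<tau> \<gamma>) * f \<sigma> (\<tau> \<circ> \<gamma>) = f \<sigma> \<tau> * f (\<sigma> \<circ> \<tau>) \<gamma>"
  using normalized by (auto simp: normalized_cocycle_def)

text \<open>This is the cocycle identity for \<open>\<sigma>\<close>, \<open>inv \<sigma>\<close>,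
  \<open>\<sigma> \<circ> \<tau>\<close>. It lets conditions on the values
  \<open>f \<sigma> (inv \<sigma>)\<close> control all values of \<open>f\<close>.\<close>

lemma f_dvd: "\<sigma> \<in> G \<Longrightarrow> \<tau> \<in> G \<Longrightarrow> f \<sigma> \<tau> * \<sigma> (f (inv \<sigma>) (\<sigma> \<circ> \<tau>)) = f \<sigma> (inv \<sigma>)"
  using cocycle[of \<sigma> "inv \<sigma>" "\<sigma> \<circ> \<tau>"] by (simp add: mult.commute)

lemma f_inv: "\<sigma> \<in> G \<Longrightarrow> \<sigma> (f (inv \<sigma>) \<sigma>) = f \<sigma> (inv \<sigma>)"
  using cocycle[of \<sigma> "inv \<sigma>" \<sigma>] by simp

text \<open>Left multiplication by \<open>x_\<sigma>\<close>, a \<open>\<sigma>\<close>-semilinear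
  map on functions with coefficients anywhere in \<open>K\<close>. Written with it, products become
  single sums over \<open>G\<close>.\<close>

definition act :: "('k \<Rightarrow> 'k) \<Rightarrow> (('k \<Rightarrow> 'k) \<Rightarrow> 'k) \<Rightarrow> ('k \<Rightarrow> 'k) \<Rightarrow> 'k" where
  "act \<sigma> b = (\<lambda>\<rho>. if \<rho> \<in> G then \<sigma> (b (inv \<sigma> \<circ> \<rho>)) * f \<sigma> (inv \<sigma> \<circ> \<rho>) else 0)"

lemma mult_act: "a \<star> b = (\<lambda>\<rho>. \<Sum>\<sigma>\<in>G. a \<sigma> * act \<sigma> b \<rho>)"
proof
  fix \<rho>
  have "(\<Sum>\<tau>\<in>G. if \<sigma> \<circ> \<tau> = \<rho> then a \<sigma> * \<sigma> (b \<tau>) * f \<sigma> \<tau> else 0) = a \<sigma> * act \<sigma> b \<rho>"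
    if s: "\<sigma> \<in> G" for \<sigma>
  proof (cases "\<rho> \<in> G")
    case True
    have "(\<Sum>\<tau>\<in>G. if \<sigma> \<circ> \<tau> = \<rho> then a \<sigma> * \<sigma> (b \<tau>) * f \<sigma> \<tau> else 0)
        = (\<Sum>\<tau>\<in>G. if \<tau> = inv \<sigma> \<circ> \<rho> then a \<sigma> * \<sigma> (b \<tau>) * f \<sigma> \<tau> else 0)"
      using comp_eq_iff[OF s _ True] by (intro sum.cong) auto
    also have "\<dots> = a \<sigma> * act \<sigma> b \<rho>" using s True by (simp add: act_def)
    finally show ?thesis .
  next
    case False
    hence "\<sigma> \<circ> \<tau> \<noteq> \<rho>" if "\<tau> \<in> G" for \<tau> using s that by auto
    thus ?thesis using False by (simp add: act_def)
  qed
  thus "(a \<star> b) \<rho> = (\<Sum>\<sigma>\<in>G. a \<sigma> * act \<sigma> b \<rho>)" unfolding cp_mult_def by simp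
qed

text \<open>The relation \<open>x_\<sigma> x_\<tau> = f \<sigma> \<tau> x_(\<sigma>\<tau>)\<close>,
  which amounts to the cocycle identity; associativity is derived from it.\<close>

lemma act_act:
  assumes "\<sigma> \<in> G" "\<tau> \<in> G"
  shows "act \<sigma> (act \<tau> b) \<rho> = f \<sigma> \<tau> * act (\<sigma> \<circ> \<tau>) b \<rho>"
proof (cases "\<rho> \<in> G")
  case True
  have "f \<sigma> \<tau> * f (\<sigma> \<circ> \<tau>) (inv \<tau> \<circ> (inv \<sigma> \<circ> \<rho>)) =
      \<sigma> (f \<tau> (inv \<tau> \<circ> (inv \<sigma> \<circ> \<rho>))) * f \<sigma> (inv \<sigma> \<circ> \<rho>)"
    using cocycle[of \<sigma> \<tau> "inv \<tau> \<circ> (inv \<sigma> \<circ> \<rho>)"] assms True by simp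
  thus ?thesis using assms True by (simp add: act_def o_assoc[symmetric])
qed (simp add: act_def)

lemma act_add: "\<sigma> \<in> G \<Longrightarrow> act \<sigma> (\<lambda>\<rho>. a \<rho> + b \<rho>) \<rho> = act \<sigma> a \<rho> + act \<sigma> b \<rho>"
  by (simp add: act_def distrib_right)

lemma act_scale: "\<sigma> \<in> G \<Longrightarrow> act \<sigma> (\<lambda>\<rho>. s * b \<rho>) \<rho> = \<sigma> s * act \<sigma> b \<rho>"
  by (simp add: act_def)

lemma act_sum: "\<sigma> \<in> G \<Longrightarrow> act \<sigma> (\<lambda>\<rho>. \<Sum>i\<in>A. g i \<rho>) \<rho> = (\<Sum>i\<in>A. act \<sigma> (g i) \<rho>)"
  by (simp add: act_def sum_distrib_right)

lemma act_mult: "\<sigma> \<in> G \<Longrightarrow> act \<sigma> (a \<star> b) \<rho> = (act \<sigma> a \<star> b) \<rho>"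
proof -
  assume s: "\<sigma> \<in> G"
  have "(act \<sigma> a \<star> b) \<rho> = (\<Sum>\<tau>\<in>G. act \<sigma> a (\<sigma> \<circ> \<tau>) * act (\<sigma> \<circ> \<tau>) b \<rho>)"
    unfolding mult_act using sum_left_shift[OF s, of "\<lambda>\<tau>. act \<sigma> a \<tau> * act \<tau> b \<rho>"] by simp
  also have "\<dots> = (\<Sum>\<tau>\<in>G. \<sigma> (a \<tau>) * (f \<sigma> \<tau> * act (\<sigma> \<circ> \<tau>) b \<rho>))"
    using s by (intro sum.cong) (simp_all add: act_def[of \<sigma>])
  also have "\<dots> = (\<Sum>\<tau>\<in>G. \<sigma> (a \<tau>) * act \<sigma> (act \<tau> b) \<rho>)"
    using s by (intro sum.cong) (simp_all add: act_act)
  also have "\<dots> = act \<sigma> (a \<star> b) \<rho>"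
    unfolding mult_act using s by (simp add: act_sum act_scale)
  finally show ?thesis ..
qed

lemma mult_assoc: "(a \<star> b) \<star> c = a \<star> (b \<star> c)"
proof
  fix \<rho>
  have "(a \<star> (b \<star> c)) \<rho> = (\<Sum>\<sigma>\<in>G. a \<sigma> * (act \<sigma> b \<star> c) \<rho>)"
    unfolding mult_act[of a] by (simp add: act_mult)
  also have "\<dots> = (\<Sum>\<xi>\<in>G. \<Sum>\<sigma>\<in>G. a \<sigma> * act \<sigma> b \<xi> * act \<xi> c \<rho>)"
    unfolding mult_act[of _ c] by (subst sum.swap) (simp add: sum_distrib_left mult.assoc)
  also have "\<dots> = ((a \<star> b) \<star> c) \<rho>"
    unfolding mult_act[of _ c] mult_act[of a b] by (simp add: sum_distrib_right)
  finally show "((a \<star> b) \<star> c) \<rho> = (a \<star> (b \<star> c)) \<rho>" ..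
qed

lemma mult_add_left: "((\<lambda>\<rho>. a \<rho> + b \<rho>) \<star> c) \<rho> = (a \<star> c) \<rho> + (b \<star> c) \<rho>"
  by (simp add: mult_act distrib_right sum.distrib)

lemma mult_add_right: "(a \<star> (\<lambda>\<rho>. b \<rho> + c \<rho>)) \<rho> = (a \<star> b) \<rho> + (a \<star> c) \<rho>"
  by (simp add: mult_act act_add distrib_left sum.distrib)

lemma mult_scale: "((\<lambda>\<rho>. s * a \<rho>) \<star> c) \<rho> = s * (a \<star> c) \<rho>"
  by (simp add: mult_act sum_distrib_left mult.assoc)

lemma mult_uminus_left: "((\<lambda>\<rho>. - a \<rho>) \<star> c) \<rho> = - (a \<star> c) \<rho>"
  using mult_scale[of "- 1" a c] by simp

lemma mult_sum_left: "((\<lambda>\<rho>. \<Sum>i\<in>A. g i \<rho>) \<star> c) \<rho> = (\<Sum>i\<in>A. (g i \<star> c) \<rho>)"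
  by (simp add: mult_act sum_distrib_right) (rule sum.swap)

lemma mult_sum_right: "(a \<star> (\<lambda>\<rho>. \<Sum>i\<in>A. g i \<rho>)) \<rho> = (\<Sum>i\<in>A. (a \<star> g i) \<rho>)"
  by (simp add: mult_act act_sum sum_distrib_left) (rule sum.swap)

lemma mult_zero_left [simp]: "(\<lambda>_. 0) \<star> c = (\<lambda>_. 0)"
  by (simp add: mult_act)

lemma mult_outside: "\<rho> \<notin> G \<Longrightarrow> (a \<star> b) \<rho> = 0"
  by (simp add: mult_act act_def)

text \<open>The monomial \<open>s x_\<sigma>\<close>.\<close>

definition single :: "'k \<Rightarrow> ('k \<Rightarrow> 'k) \<Rightarrow> ('k \<Rightarrow> 'k) \<Rightarrow> 'k" where
  "single s \<sigma> = (\<lambda>\<rho>. if \<rho> = \<sigma> then s else 0)"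

lemma single_mem [intro]: "s \<in> R \<Longrightarrow> \<sigma> \<in> G \<Longrightarrow> single s \<sigma> \<in> C"
  by (auto simp: single_def cp_carrier_def)

lemma single_mult: "\<sigma> \<in> G \<Longrightarrow> (single s \<sigma> \<star> b) \<rho> = s * act \<sigma> b \<rho>"
  by (simp add: mult_act single_def if_distrib[of "\<lambda>x. x * _"] cong: if_cong)

lemma mult_single: "\<sigma> \<in> G \<Longrightarrow> \<rho> \<in> G \<Longrightarrow>
  (a \<star> single s \<sigma>) \<rho> = a (\<rho> \<circ> inv \<sigma>) * (\<rho> \<circ> inv \<sigma>) s * f (\<rho> \<circ> inv \<sigma>) \<sigma>"
proof -
  assume s: "\<sigma> \<in> G" and r: "\<rho> \<in> G"
  have eq: "inv \<tau> \<circ> \<rho> = \<sigma> \<longleftrightarrow> \<tau> = \<rho> \<circ> inv \<sigma>" if "\<tau> \<in> G" for \<tau>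
    using s r that by (auto simp: o_assoc[symmetric])
  have "(a \<star> single s \<sigma>) \<rho> = (\<Sum>\<tau>\<in>G. if \<tau> = \<rho> \<circ> inv \<sigma> then a \<tau> * \<tau> s * f \<tau> \<sigma> else 0)"
    unfolding mult_act using s r by (intro sum.cong) (auto simp: act_def single_def eq o_assoc[symmetric])
  thus ?thesis using s r by simp
qed

lemma act_id: "b \<in> cp_carrier X G \<Longrightarrow> act id b = b"
  by (auto simp: act_def fun_eq_iff cp_carrier_def)

lemma one_mult: "b \<in> cp_carrier X G \<Longrightarrow> single 1 id \<star> b = b"
  using act_id[of b] by (auto simp: fun_eq_iff single_mult)

lemma act_mem: "\<sigma> \<in> G \<Longrightarrow> b \<in> C \<Longrightarrow> act \<sigma> b \<in> C"
  by (auto simp: act_def cp_carrier_def intro!: mult_mem f_mem stable[of \<sigma>])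

lemma mult_closed: "a \<in> C \<Longrightarrow> b \<in> C \<Longrightarrow> a \<star> b \<in> C"
  unfolding mult_act using act_mem[of _ b]
  by (auto simp: cp_carrier_def intro!: sum_mem sum.neutral)

lemma carrier_sum: "(\<And>i. i \<in> A \<Longrightarrow> g i \<in> C) \<Longrightarrow> (\<lambda>\<rho>. \<Sum>i\<in>A. g i \<rho>) \<in> C"
  by (auto simp: cp_carrier_def intro!: sum_mem sum.neutral)

text \<open>The homomorphism from the free module of rank \<open>n\<close> given by the generators
  \<open>y\<close>: its image is the left ideal they generate, its kernel their module of relations.
  Coefficients may lie in \<open>K\<close>, so that relations can also be taken over
  \<open>K\<close>.\<close>

definition comb :: "nat \<Rightarrow> (nat \<Rightarrow> ('k \<Rightarrow> 'k) \<Rightarrow> 'k) \<Rightarrow> (nat \<Rightarrow> ('k \<Rightarrow> 'k) \<Rightarrow> 'k) \<Rightarrow> ('k \<Rightarrow> 'k) \<Rightarrow> 'k"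
  where "comb n y v = (\<lambda>\<rho>. \<Sum>i<n. (v i \<star> y i) \<rho>)"

lemma comb_add: "comb n y (\<lambda>i \<rho>. v i \<rho> + w i \<rho>) \<rho> = comb n y v \<rho> + comb n y w \<rho>"
  by (simp add: comb_def mult_add_left sum.distrib)

lemma comb_mult: "comb n y (\<lambda>i. a \<star> v i) = a \<star> comb n y v"
  by (simp add: comb_def mult_sum_right mult_assoc fun_eq_iff)

lemma comb_closed: "(\<And>i. i < n \<Longrightarrow> v i \<in> C) \<Longrightarrow> (\<And>i. i < n \<Longrightarrow> y i \<in> C) \<Longrightarrow> comb n y v \<in> C"
  unfolding comb_def by (auto intro!: carrier_sum mult_closed)


lemma left_ideal_comb:
  assumes y: "\<And>i. i < n \<Longrightarrow> y i \<in> C"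
  shows "left_ideal C cp_add cp_zero (cp_mult G f) {comb n y v | v. \<forall>i<n. v i \<in> C}"
  unfolding left_ideal_def
proof (intro conjI ballI)
  let ?I = "{comb n y v | v. \<forall>i<n. v i \<in> C}"
  show "?I \<subseteq> C" using y by (auto intro: comb_closed)
  have "cp_zero = comb n y (\<lambda>_ _. 0)" by (simp add: comb_def cp_zero_def)
  moreover have "(\<lambda>_. 0) \<in> C" by (auto simp: cp_carrier_def)
  ultimately show "cp_zero \<in> ?I" by auto
next
  let ?I = "{comb n y v | v. \<forall>i<n. v i \<in> C}"
  fix a b assume "a \<in> ?I" "b \<in> ?I"
  then obtain v w where vw: "a = comb n y v" "b = comb n y w" "\<forall>i<n. v i \<in> C" "\<forall>i<n. w i \<in> C" by auto
  have "cp_add a b = comb n y (\<lambda>i \<rho>. v i \<rho> + w i \<rho>)"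
    using vw by (simp add: cp_add_def comb_add fun_eq_iff)
  moreover have "\<forall>i<n. (\<lambda>\<rho>. v i \<rho> + w i \<rho>) \<in> C" using vw by (auto simp: cp_carrier_def)
  ultimately show "cp_add a b \<in> ?I" by (intro CollectI exI conjI)
next
  let ?I = "{comb n y v | v. \<forall>i<n. v i \<in> C}"
  fix a assume "a \<in> ?I"
  then obtain v where v: "a = comb n y v" "\<forall>i<n. v i \<in> C" by auto
  let ?b = "comb n y (\<lambda>i \<rho>. - v i \<rho>)"
  have "cp_add a ?b = cp_zero"
    using v by (simp add: cp_add_def cp_zero_def comb_def mult_uminus_left fun_eq_iff sum_negf)
  moreover have "\<forall>i<n. (\<lambda>\<rho>. - v i \<rho>) \<in> C" using v by (auto simp: cp_carrier_def)
  hence "?b \<in> ?I" by (intro CollectI exI conjI) auto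
  ultimately show "\<exists>b\<in>?I. cp_add a b = cp_zero" by blast
next
  let ?I = "{comb n y v | v. \<forall>i<n. v i \<in> C}"
  fix r a assume r: "r \<in> C" and "a \<in> ?I"
  then obtain v where v: "a = comb n y v" "\<forall>i<n. v i \<in> C" by auto
  have "r \<star> a = comb n y (\<lambda>i. r \<star> v i)" using v by (simp add: comb_mult)
  moreover have "\<forall>i<n. r \<star> v i \<in> C" using v r mult_closed by auto
  ultimately show "r \<star> a \<in> ?I" by (intro CollectI exI conjI)
qed

lemma gen_mem_comb:
  assumes y: "\<And>i. i < n \<Longrightarrow> y i \<in> C" and i: "i < n"
  shows "y i \<in> {comb n y v | v. \<forall>i<n. v i \<in> C}"
proof -
  let ?v = "\<lambda>j. if j = i then single 1 id else (\<lambda>_. 0)"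
  have "(?v j \<star> y j) \<rho> = (if j = i then y i \<rho> else 0)" for j \<rho>
    using one_mult[OF y[OF i]] by auto
  hence "comb n y ?v = y i" using i by (simp add: comb_def fun_eq_iff)
  moreover have "\<forall>j<n. ?v j \<in> C" by (auto simp: cp_carrier_def single_def)
  ultimately show ?thesis by (intro CollectI exI[of _ ?v] conjI) auto
qed

lemma comb_mem_ideal:
  assumes J: "left_ideal C cp_add cp_zero (cp_mult G f) J"
    and y: "\<And>i. i < n \<Longrightarrow> y i \<in> J" and v: "\<And>i. i < n \<Longrightarrow> v i \<in> C"
  shows "comb n y v \<in> J"
  using y v
proof (induction n)
  case 0
  have "comb 0 y v = cp_zero" by (simp add: comb_def cp_zero_def)
  thus ?case using J by (simp add: left_ideal_def)
next
  case (Suc n)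
  have "comb (Suc n) y v = cp_add (comb n y v) (v n \<star> y n)"
    by (simp add: comb_def cp_add_def)
  moreover have "comb n y v \<in> J" using Suc by auto
  moreover have "v n \<star> y n \<in> J" using Suc J by (auto simp: left_ideal_def)
  ultimately show ?case using J by (simp add: left_ideal_def)
qed

lemma generated_left_ideal:
  assumes y: "\<And>i. i < n \<Longrightarrow> y i \<in> C"
  shows "\<Inter> {J. left_ideal C cp_add cp_zero (cp_mult G f) J \<and> y ` {..<n} \<subseteq> J}
    = {comb n y v | v. \<forall>i<n. v i \<in> C}"
proof
  show "\<Inter> {J. left_ideal C cp_add cp_zero (cp_mult G f) J \<and> y ` {..<n} \<subseteq> J}
    \<subseteq> {comb n y v | v. \<forall>i<n. v i \<in> C}"
    using left_ideal_comb[of n y, OF y] gen_mem_comb[of n y, OF y] by blast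
  show "{comb n y v | v. \<forall>i<n. v i \<in> C}
    \<subseteq> \<Inter> {J. left_ideal C cp_add cp_zero (cp_mult G f) J \<and> y ` {..<n} \<subseteq> J}"
    by (auto intro: comb_mem_ideal)
qed

end

section \<open>Projective left ideals and the necessity of the square condition\<close>

definition projective_data :: "'a set \<Rightarrow> ('a \<Rightarrow> 'a \<Rightarrow> 'a) \<Rightarrow> 'a \<Rightarrow> ('a \<Rightarrow> 'a \<Rightarrow> 'a) \<Rightarrow> 'a set \<Rightarrow>
    nat \<Rightarrow> ('a \<Rightarrow> nat \<Rightarrow> 'a) \<Rightarrow> ((nat \<Rightarrow> 'a) \<Rightarrow> 'a) \<Rightarrow> bool" where
  "projective_data C pl z mul I n \<iota> \<pi> \<longleftrightarrow>
     (\<forall>x\<in>I. \<iota> x \<in> free_mod C z n) \<and>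
     (\<forall>x\<in>I. \<forall>y\<in>I. \<iota> (pl x y) = (\<lambda>i. pl (\<iota> x i) (\<iota> y i))) \<and>
     (\<forall>r\<in>C. \<forall>x\<in>I. \<iota> (mul r x) = (\<lambda>i. if i < n then mul r (\<iota> x i) else z)) \<and>
     (\<forall>v\<in>free_mod C z n. \<pi> v \<in> I) \<and>
     (\<forall>v\<in>free_mod C z n. \<forall>w\<in>free_mod C z n. \<pi> (\<lambda>i. pl (v i) (w i)) = pl (\<pi> v) (\<pi> w)) \<and>
     (\<forall>r\<in>C. \<forall>v\<in>free_mod C z n. \<pi> (\<lambda>i. if i < n then mul r (v i) else z) = mul r (\<pi> v)) \<and>
     (\<forall>x\<in>I. \<pi> (\<iota> x) = x)"

lemma left_projective_iff:
  "left_projective C pl z mul I \<longleftrightarrow> (\<exists>n \<iota> \<pi>. projective_data C pl z mul I n \<iota> \<pi>)"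
  unfolding left_projective_def projective_data_def ..

lemmas projective_dataD =
  projective_data_def[THEN iffD1, THEN conjunct1]
  projective_data_def[THEN iffD1, THEN conjunct2, THEN conjunct1]
  projective_data_def[THEN iffD1, THEN conjunct2, THEN conjunct2, THEN conjunct1]
  projective_data_def[THEN iffD1, THEN conjunct2, THEN conjunct2, THEN conjunct2, THEN conjunct1]
  projective_data_def[THEN iffD1, THEN conjunct2, THEN conjunct2, THEN conjunct2, THEN conjunct2, THEN conjunct1]
  projective_data_def[THEN iffD1, THEN conjunct2, THEN conjunct2, THEN conjunct2, THEN conjunct2, THEN conjunct2, THEN conjunct1]
  projective_data_def[THEN iffD1, THEN conjunct2, THEN conjunct2, THEN conjunct2, THEN conjunct2, THEN conjunct2, THEN conjunct2]

context crossed
begin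

text \<open>A left linear map on a free module is right multiplication by the images of the basis
  vectors. It has to be derived because \<open>\<pi>\<close> is an arbitrary function, linear only
  on \<open>free_mod\<close>.\<close>

lemma projection_eq_comb:
  fixes \<pi> :: "(nat \<Rightarrow> ('k \<Rightarrow> 'k) \<Rightarrow> 'k) \<Rightarrow> ('k \<Rightarrow> 'k) \<Rightarrow> 'k"
  assumes add: "\<forall>v\<in>free_mod C cp_zero n. \<forall>w\<in>free_mod C cp_zero n.
      \<pi> (\<lambda>i. cp_add (v i) (w i)) = cp_add (\<pi> v) (\<pi> w)"
    and mul: "\<forall>r\<in>C. \<forall>v\<in>free_mod C cp_zero n. \<pi> (\<lambda>i. if i < n then r \<star> v i else cp_zero) = r \<star> \<pi> v"
    and v: "v \<in> free_mod C cp_zero n"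
  shows "\<pi> v = comb n (\<lambda>j. \<pi> (\<lambda>i. if i = j then single 1 id else cp_zero)) v"
proof -
  let ?e = "\<lambda>j i. if i = j then single 1 id else cp_zero"
  have zero_mem: "cp_zero \<in> C" by (auto simp: cp_zero_def cp_carrier_def)
  have e_mem: "?e j \<in> free_mod C cp_zero n" if "j < n" for j
    using that zero_mem by (auto simp: free_mod_def)
  \<comment> \<open>Coordinates are switched on one at a time, since additivity is available for two
    summands only.\<close>
  have "\<pi> (\<lambda>i. if i < k then v i else cp_zero) = comb k (\<lambda>j. \<pi> (?e j)) v" if "k \<le> n" for k
    using that
  proof (induction k)
    case 0
    have z: "(\<lambda>_. cp_zero) \<in> free_mod C cp_zero n" using zero_mem by (auto simp: free_mod_def)
    have z0: "cp_add cp_zero cp_zero = cp_zero" by (simp add: cp_add_def cp_zero_def)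
    have "\<pi> (\<lambda>_. cp_zero) = cp_add (\<pi> (\<lambda>_. cp_zero)) (\<pi> (\<lambda>_. cp_zero))"
      using bspec[OF bspec[OF add z] z] unfolding z0 .
    hence "\<pi> (\<lambda>_. cp_zero) x = \<pi> (\<lambda>_. cp_zero) x + \<pi> (\<lambda>_. cp_zero) x" for x
      unfolding cp_add_def by (rule fun_cong)
    hence "\<pi> (\<lambda>_. cp_zero) x = 0" for x using add_cancel_right_right by metis
    thus ?case by (simp add: comb_def fun_eq_iff)
  next
    case (Suc k)
    let ?w = "\<lambda>i. if i < k then v i else cp_zero" and ?u = "\<lambda>i. if i < n then v k \<star> ?e k i else cp_zero"
    have vk: "v k \<in> C" using v Suc by (auto simp: free_mod_def)
    have vk1: "v k \<star> single 1 id = v k"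
    proof
      fix \<rho> show "(v k \<star> single 1 id) \<rho> = v k \<rho>"
      proof (cases "\<rho> \<in> G")
        case True
        thus ?thesis using mult_single[of id \<rho> "v k" 1] by (simp add: inv_id)
      next
        case False
        thus ?thesis using vk by (simp add: mult_outside cp_carrier_def)
      qed
    qed
    have vk0: "v k \<star> cp_zero = cp_zero"
      by (auto simp: mult_act act_def cp_zero_def fun_eq_iff intro!: sum.neutral)
    have "(\<lambda>i. if i < Suc k then v i else cp_zero) = (\<lambda>i. cp_add (?w i) (?u i))"
      using Suc.prems by (auto simp: fun_eq_iff less_Suc_eq cp_add_def cp_zero_def vk1 vk0[unfolded cp_zero_def])
    moreover have "?w \<in> free_mod C cp_zero n" using v Suc.prems zero_mem by (auto simp: free_mod_def)
    moreover have "?u \<in> free_mod C cp_zero n"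
      using e_mem[of k] Suc.prems vk by (auto simp: free_mod_def intro!: mult_closed)
    ultimately have "\<pi> (\<lambda>i. if i < Suc k then v i else cp_zero) = cp_add (\<pi> ?w) (\<pi> ?u)"
      using add by simp
    also have "\<pi> ?u = v k \<star> \<pi> (?e k)" using mul vk e_mem[of k] Suc.prems by simp
    finally show ?case using Suc by (simp add: comb_def cp_add_def)
  qed
  from this[of n] have "\<pi> (\<lambda>i. if i < n then v i else cp_zero) = comb n (\<lambda>j. \<pi> (?e j)) v" by simp
  moreover have "(\<lambda>i. if i < n then v i else cp_zero) = v"
    using v by (auto simp: free_mod_def fun_eq_iff)
  ultimately show ?thesis by simp
qed

text \<open>The left ideal generated by \<open>m\<close> and \<open>x_\<rho>\<close> is projective, so that \<open>1\<close> is a sum of products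
  \<open>q y\<close> with \<open>y\<close> in the ideal and \<open>q\<close> mapping the ideal into the order by right multiplication.
  Localizing the coefficient of \<open>x_1\<close> at \<open>N\<close>, one of these products has to be a unit there.\<close>

lemma semihereditary_divides:
  assumes sh: "left_semihereditary C cp_add cp_zero (cp_mult G f)"
    and \<rho>: "\<rho> \<in> G" and N: "maximal_ideal_in R N" and m: "m \<in> N" "m \<noteq> 0"
  shows "m / f (inv \<rho>) \<rho> \<in> localization R N"
proof -
  interpret N: maximal_ideal_field R N using N by unfold_locales
  have mR: "m \<in> R" using m N.ideal_sub by auto
  define y where "y = (\<lambda>i::nat. if i = 0 then single m id else single 1 \<rho>)"
  have y: "y i \<in> C" for i using mR \<rho> by (auto simp: y_def)
  define I where "I = \<Inter> {J. left_ideal C cp_add cp_zero (cp_mult G f) J \<and> y ` {..<2} \<subseteq> J}"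
  have I_eq: "I = {comb 2 y v | v. \<forall>i<2. v i \<in> C}"
    unfolding I_def by (rule generated_left_ideal) (rule y)
  have "fg_left_ideal C cp_add cp_zero (cp_mult G f) I"
    unfolding fg_left_ideal_def I_def
  proof (intro exI[of _ "y ` {..<2}"] conjI)
    show "y ` {..<2} \<subseteq> C" using y by blast
  qed auto
  hence "left_projective C cp_add cp_zero (cp_mult G f) I" using sh by (auto simp: left_semihereditary_def)
  then obtain n :: nat and \<iota> \<pi> where "projective_data C cp_add cp_zero (cp_mult G f) I n \<iota> \<pi>"
    unfolding left_projective_iff by auto
  note data = projective_dataD[OF this]
  note \<iota> = data(1) and \<iota>_mul = data(3) and \<pi> = data(4) and \<pi>_add = data(5) and \<pi>_mul = data(6)
    and \<pi>\<iota> = data(7)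
  define z where "z = (\<lambda>j. \<pi> (\<lambda>i. if i = j then single 1 id else cp_zero))"
  have zero_mem: "cp_zero \<in> C" by (auto simp: cp_zero_def cp_carrier_def)
  have z: "z j \<in> I" if "j < n" for j
    unfolding z_def by (rule bspec[OF \<pi>]) (use that zero_mem in \<open>auto simp: free_mod_def\<close>)
  let ?\<mu> = "single m id" and ?x = "single 1 \<rho>"
  have "y 0 \<in> I" "y 1 \<in> I" unfolding I_eq using gen_mem_comb[of 2 y, OF y] by auto
  hence \<mu>I: "?\<mu> \<in> I" and xI: "?x \<in> I" by (auto simp: y_def)
  \<comment> \<open>Extended to \<open>K\<close>, the \<open>i\<close>-th coordinate of
    \<open>\<iota>\<close> is right multiplication by some \<open>q\<close>. Applied to
    \<open>m\<close> it gives \<open>\<beta> i = m q\<close>, so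
    \<open>\<beta> i \<sigma> / m\<close> is the coefficient of \<open>q\<close> at
    \<open>\<sigma>\<close>.\<close>
  define \<beta> where "\<beta> = (\<lambda>i \<sigma>. \<iota> ?\<mu> i \<sigma>)"
  have \<beta>: "\<beta> i \<in> C" if "i < n" for i using \<iota> \<mu>I that by (auto simp: \<beta>_def free_mod_def)
  have "?\<mu> = comb n z (\<iota> ?\<mu>)"
    using projection_eq_comb[OF \<pi>_add \<pi>_mul, of "\<iota> ?\<mu>"] \<iota> \<mu>I \<pi>\<iota> unfolding z_def by simp
  hence "m = comb n z \<beta> id" unfolding \<beta>_def by (metis single_def)
  also have "\<dots> = (\<Sum>i<n. \<Sum>\<sigma>\<in>G. \<beta> i \<sigma> * (\<sigma> (z i (inv \<sigma>)) * f \<sigma> (inv \<sigma>)))"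
    unfolding comb_def mult_act by (simp add: act_def)
  finally have "1 = (\<Sum>i<n. \<Sum>\<sigma>\<in>G. \<beta> i \<sigma> * (\<sigma> (z i (inv \<sigma>)) * f \<sigma> (inv \<sigma>))) / m"
    using m by simp
  also have "\<dots> = (\<Sum>i<n. \<Sum>\<sigma>\<in>G. \<beta> i \<sigma> / m * (\<sigma> (z i (inv \<sigma>)) * f \<sigma> (inv \<sigma>)))"
    by (simp add: sum_divide_distrib)
  finally have sum1: "1 = (\<Sum>i<n. \<Sum>\<sigma>\<in>G. \<beta> i \<sigma> / m * (\<sigma> (z i (inv \<sigma>)) * f \<sigma> (inv \<sigma>)))" .
  have "\<exists>i<n. \<exists>\<sigma>\<in>G. \<beta> i \<sigma> / m * (\<sigma> (z i (inv \<sigma>)) * f \<sigma> (inv \<sigma>)) \<notin> N.JN"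
  proof (rule ccontr)
    assume "\<not> ?thesis"
    hence "(\<Sum>i<n. \<Sum>\<sigma>\<in>G. \<beta> i \<sigma> / m * (\<sigma> (z i (inv \<sigma>)) * f \<sigma> (inv \<sigma>))) \<in> N.JN"
      by (intro N.loc.ideal_sum) auto
    thus False unfolding sum1[symmetric] by simp
  qed
  then obtain i \<sigma> where i: "i < n" and \<sigma>: "\<sigma> \<in> G"
    and T: "\<beta> i \<sigma> / m * (\<sigma> (z i (inv \<sigma>)) * f \<sigma> (inv \<sigma>)) \<notin> N.JN"
    by auto
  define \<gamma> where "\<gamma> = \<beta> i \<sigma> / m"
  have m\<gamma>: "m * \<gamma> \<in> R" using \<beta>[OF i] \<sigma> m by (auto simp: \<gamma>_def cp_carrier_def)
  have "\<rho> \<gamma> * f \<rho> \<sigma> \<in> R"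
  proof -
    \<comment> \<open>Coordinates are linear over \<open>C\<close> only, so \<open>x_\<rho>\<close>
      has to be reached from \<open>m\<close> without division:
      \<open>(\<rho>(m') x_\<rho>) m = n0 x_\<rho>\<close>, where the norm
      \<open>n0 = m * m'\<close> is fixed by \<open>G\<close>.\<close>
    define n0 where "n0 = (\<Prod>\<tau>\<in>G. \<tau> m)"
    define m' where "m' = (\<Prod>\<tau>\<in>G-{id}. \<tau> m)"
    have n0: "n0 = m * m'" unfolding n0_def m'_def by (subst prod.remove[of G id]) auto
    have n0_nz: "n0 \<noteq> 0" unfolding n0_def using m by auto
    have m'R: "m' \<in> R" unfolding m'_def by (intro prod_mem stable[OF _ mR]) auto
    have fixed: "\<tau> n0 = n0" if "\<tau> \<in> G" for \<tau> using norm_fixed[OF that] unfolding n0_def .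
    have c: "single (\<rho> m') \<rho> \<in> C" using stable[OF \<rho> m'R] \<rho> by auto
    have n0C: "single n0 id \<in> C" using m'R mR n0 by auto
    have "single (\<rho> m') \<rho> \<star> ?\<mu> = single n0 id \<star> ?x"
    proof
      fix \<tau>
      have "\<rho> m' * \<rho> m = n0" using fixed[OF \<rho>] n0 \<rho> by (simp add: mult.commute)
      moreover have "inv \<rho> \<circ> \<tau> = id \<longleftrightarrow> \<tau> = \<rho>" if "\<tau> \<in> G"
        using \<rho> that by (metis comp_inv_comp inv_comp comp_id)
      ultimately show "(single (\<rho> m') \<rho> \<star> ?\<mu>) \<tau> = (single n0 id \<star> ?x) \<tau>"
        unfolding single_mult[OF \<rho>] single_mult[OF id_mem]
        using \<rho> by (auto simp: act_def single_def inv_id)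
    qed
    hence "\<iota> (single (\<rho> m') \<rho> \<star> ?\<mu>) i = \<iota> (single n0 id \<star> ?x) i" by simp
    hence "single (\<rho> m') \<rho> \<star> \<iota> ?\<mu> i = single n0 id \<star> \<iota> ?x i"
      using \<iota>_mul c n0C \<mu>I xI i by simp
    hence "(single (\<rho> m') \<rho> \<star> \<beta> i) (\<rho> \<circ> \<sigma>) = (single n0 id \<star> \<iota> ?x i) (\<rho> \<circ> \<sigma>)" by (simp add: \<beta>_def)
    hence "\<rho> m' * (\<rho> (\<beta> i \<sigma>) * f \<rho> \<sigma>) = n0 * \<iota> ?x i (\<rho> \<circ> \<sigma>)"
      using \<rho> \<sigma> by (simp add: single_mult act_def inv_id)
    moreover have "\<rho> m' * \<rho> m = n0" using fixed[OF \<rho>] n0 \<rho> by (simp add: mult.commute)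
    ultimately have "\<rho> \<gamma> * f \<rho> \<sigma> = \<iota> ?x i (\<rho> \<circ> \<sigma>)"
      using n0_nz \<rho> m unfolding \<gamma>_def by (auto simp: field_simps)
    moreover have "\<iota> ?x i \<in> C" using \<iota> xI i by (auto simp: free_mod_def)
    ultimately show ?thesis using \<rho> \<sigma> by (auto simp: cp_carrier_def)
  qed
  hence "inv \<rho> (\<rho> \<gamma> * f \<rho> \<sigma>) \<in> R" by (rule stable[OF inv_mem[OF \<rho>]])
  hence \<gamma>f: "\<gamma> * inv \<rho> (f \<rho> \<sigma>) \<in> R" using \<rho> by simp
  \<comment> \<open>The summand outside the ideal equals
    \<open>c * \<sigma> (z i (inv \<sigma>))\<close>. That \<open>c\<close> is integral follows from
    the bound just shown, as \<open>f \<rho> \<sigma>\<close> divides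
    \<open>\<rho> (f \<sigma> (inv \<sigma>))\<close>.\<close>
  define c where "c = \<gamma> * f \<sigma> (inv \<sigma>)"
  have c: "c \<in> R"
  proof -
    have "\<rho> (f \<sigma> (inv \<sigma>)) = f \<rho> \<sigma> * f (\<rho> \<circ> \<sigma>) (inv \<sigma>)" using cocycle[of \<rho> \<sigma> "inv \<sigma>"] \<rho> \<sigma> by simp
    hence "inv \<rho> (\<rho> (f \<sigma> (inv \<sigma>))) = inv \<rho> (f \<rho> \<sigma>) * inv \<rho> (f (\<rho> \<circ> \<sigma>) (inv \<sigma>))"
      using \<rho> by (metis aut_mult inv_mem)
    hence "c = (\<gamma> * inv \<rho> (f \<rho> \<sigma>)) * inv \<rho> (f (\<rho> \<circ> \<sigma>) (inv \<sigma>))" unfolding c_def using \<rho> by simp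
    thus ?thesis
      using mult_mem[OF \<gamma>f stable[OF inv_mem[OF \<rho>] f_mem[OF comp_mem[OF \<rho> \<sigma>] inv_mem[OF \<sigma>]]]] by simp
  qed
  \<comment> \<open>\<open>z i\<close> is \<open>v 0\<close> times \<open>m\<close> plus
    \<open>v 1\<close> times \<open>x_\<rho>\<close>, and \<open>\<phi>\<close> is the factor of the
    second part. The first part contributes an element of \<open>N\<close>, so neither
    \<open>c\<close> nor \<open>\<phi>\<close> can lie in \<open>N\<close>.\<close>
  define \<phi> where "\<phi> = \<sigma> (f (inv \<sigma> \<circ> inv \<rho>) \<rho>)"
  have \<phi>R: "\<phi> \<in> R" unfolding \<phi>_def using \<sigma> \<rho> by (intro stable[OF \<sigma>] f_mem) auto
  obtain v where v: "z i = comb 2 y v" "v 0 \<in> C" "v 1 \<in> C" using z[OF i] unfolding I_eq by auto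
  have "z i (inv \<sigma>) = v 0 (inv \<sigma>) * inv \<sigma> m + v 1 (inv \<sigma> \<circ> inv \<rho>) * f (inv \<sigma> \<circ> inv \<rho>) \<rho>"
    unfolding v comb_def y_def using \<sigma> \<rho> by (simp add: numeral_2_eq_2 mult_single inv_id)
  hence "\<sigma> (z i (inv \<sigma>)) = \<sigma> (v 0 (inv \<sigma>)) * m + \<sigma> (v 1 (inv \<sigma> \<circ> inv \<rho>)) * \<phi>"
    using \<sigma> by (simp add: \<phi>_def)
  hence "c * (\<sigma> (v 0 (inv \<sigma>)) * m + \<sigma> (v 1 (inv \<sigma> \<circ> inv \<rho>)) * \<phi>) \<notin> N.JN"
    using T unfolding c_def \<gamma>_def[symmetric] by (simp add: mult_ac)
  moreover have v': "\<sigma> (v 0 (inv \<sigma>)) \<in> R" "\<sigma> (v 1 (inv \<sigma> \<circ> inv \<rho>)) \<in> R"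
    using v \<sigma> \<rho> by (intro stable[OF \<sigma>]; simp add: cp_carrier_def)+
  ultimately have nN: "c * (\<sigma> (v 0 (inv \<sigma>)) * m + \<sigma> (v 1 (inv \<sigma> \<circ> inv \<rho>)) * \<phi>) \<notin> N"
    using N.ideal_sub_loc by blast
  have cN: "c \<notin> N"
    using nN N.ideal_mult_right[of "\<sigma> (v 0 (inv \<sigma>)) * m + \<sigma> (v 1 (inv \<sigma> \<circ> inv \<rho>)) * \<phi>" c] v' mR \<phi>R by auto
  have \<phi>N: "\<phi> \<notin> N"
    using nN N.ideal_mult_left[OF c N.ideal_add[OF N.ideal_mult_left[OF v'(1) m(1)] N.ideal_mult_left[OF v'(2)]]]
    by blast
  \<comment> \<open>The cocycle identity trades \<open>f (inv \<rho>) \<rho>\<close> for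
    \<open>\<phi> * f \<sigma> (inv \<sigma>)\<close>. Multiplied by \<open>\<gamma>\<close> this is
    \<open>c * \<phi>\<close>, a unit at \<open>N\<close>, while \<open>m * \<gamma>\<close> is
    integral.\<close>
  have "\<phi> * f \<sigma> (inv \<sigma>) = f \<sigma> (inv \<sigma> \<circ> inv \<rho>) * f (inv \<rho>) \<rho>"
    unfolding \<phi>_def using cocycle[of \<sigma> "inv \<sigma> \<circ> inv \<rho>" \<rho>] \<sigma> \<rho> by (simp add: o_assoc[symmetric])
  moreover have "m * \<gamma> * f \<sigma> (inv \<sigma>) = m * c" by (simp add: c_def mult.assoc)
  ultimately have "m / f (inv \<rho>) \<rho> = (m * \<gamma> * f \<sigma> (inv \<sigma> \<circ> inv \<rho>)) / (c * \<phi>)"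
    using cN \<phi>N \<sigma> \<rho> by (auto simp: field_simps)
  moreover have "m * \<gamma> * f \<sigma> (inv \<sigma> \<circ> inv \<rho>) \<in> R" using m\<gamma> \<sigma> \<rho> by (auto intro!: mult_mem f_mem)
  ultimately show ?thesis using N.mult_notin[OF c \<phi>R cN \<phi>N] c \<phi>R N.locI by auto
qed

text \<open>In a sum of products of elements of \<open>N\<close>, divide each first factor by
  \<open>f \<rho> (inv \<rho>)\<close>: by \<open>semihereditary_divides\<close> the quotients are
  local, so 1 would lie in the ideal at \<open>N\<close>.\<close>

lemma semihereditary_notin_square:
  assumes sh: "left_semihereditary C cp_add cp_zero (cp_mult G f)"
    and \<rho>: "\<rho> \<in> G" and N: "maximal_ideal_in R N"
  shows "f \<rho> (inv \<rho>) \<notin> ideal_prod N N"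
proof
  interpret N: maximal_ideal_field R N using N by unfold_locales
  assume "f \<rho> (inv \<rho>) \<in> ideal_prod N N"
  then obtain n :: nat and a b where ab: "\<forall>i<n. a i \<in> N \<and> b i \<in> N" "f \<rho> (inv \<rho>) = (\<Sum>i<n. a i * b i)"
    by (rule ideal_prodE)
  have *: "a i / f \<rho> (inv \<rho>) \<in> localization R N" if "i < n" for i
    using semihereditary_divides[OF sh, of "inv \<rho>" N "a i"] \<rho> N ab that N.loc.zero_mem by (cases "a i = 0") auto
  have "1 = (\<Sum>i<n. a i / f \<rho> (inv \<rho>) * b i)"
    using ab(2) f_nonzero[OF \<rho> inv_mem[OF \<rho>]] by (simp add: sum_divide_distrib[symmetric])
  also have "\<dots> \<in> loc_ideal R N"
    using ab * N.ideal_sub_loc by (intro N.loc.ideal_sum N.loc.ideal_mult_left) auto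
  finally show False by simp
qed

end

section \<open>Integral retractions onto subspaces\<close>

locale val_ring = local_subring Q J for Q J :: "'k::field set" +
  assumes val: "z \<noteq> 0 \<Longrightarrow> z \<in> Q \<or> inverse z \<in> Q"
begin

lemma notin_inverse: "z \<notin> Q \<Longrightarrow> z \<noteq> 0 \<and> inverse z \<in> J"
  using val[of z] nonunit_iff[of "inverse z"] by (cases "z = 0") auto

end

text \<open>In its uses the preorder is divisibility in a valuation ring: for the pivot, for the
  polynomial coefficient of least value and for the least difference
  \<open>\<tau> b - b\<close>.\<close>

lemma finite_total_preorder_least:
  assumes "finite A" "A \<noteq> {}"
    and total: "\<And>a b. a \<in> A \<Longrightarrow> b \<in> A \<Longrightarrow> P a b \<or> P b a"
    and trans: "\<And>a b c. a \<in> A \<Longrightarrow> b \<in> A \<Longrightarrow> c \<in> A \<Longrightarrow> P a b \<Longrightarrow> P b c \<Longrightarrow> P a c"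
  shows "\<exists>a\<in>A. \<forall>b\<in>A. P a b"
  using assms
proof (induction A rule: finite_ne_induct)
  case (singleton x)
  thus ?case by blast
next
  case (insert x A)
  have "\<exists>a\<in>A. \<forall>b\<in>A. P a b" by (rule insert.IH) (use insert.prems in blast)+
  then obtain a where a: "a \<in> A" "\<forall>b\<in>A. P a b" by blast
  show ?case
  proof (cases "P a x")
    case False
    hence xa: "P x a" using insert.prems(1)[of a x] a by auto
    have "P x b" if "b \<in> insert x A" for b
    proof (cases "b = x")
      case True
      thus ?thesis using insert.prems(1)[of x x] by auto
    next
      case False
      thus ?thesis using insert.prems(2)[of x a b] a xa that by auto
    qed
    thus ?thesis by blast
  qed (use a in blast)
qed

context val_ring
begin

text \<open>Gaussian elimination. Because no cross ratio of the weights lies in the square of the maximal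
  ideal, one pivot is optimal for all weights at the same time.\<close>

lemma integral_retraction:
  fixes E :: "'e set" and g :: "'i \<Rightarrow> 'e \<Rightarrow> 'k"
  assumes E: "finite E"
    and g: "\<And>i e. i \<in> I \<Longrightarrow> e \<in> E \<Longrightarrow> g i e \<noteq> 0"
    and cross: "\<And>i j e e' a b. i \<in> I \<Longrightarrow> j \<in> I \<Longrightarrow> e \<in> E \<Longrightarrow> e' \<in> E \<Longrightarrow> a \<in> J \<Longrightarrow> b \<in> J \<Longrightarrow>
      g j e' * g i e \<noteq> a * b * (g j e * g i e')"
    and "D \<subseteq> E"
    and "(\<lambda>_. 0) \<in> N" "\<And>c d. c \<in> N \<Longrightarrow> d \<in> N \<Longrightarrow> (\<lambda>e. c e + d e) \<in> N"
      "\<And>s c. c \<in> N \<Longrightarrow> (\<lambda>e. s * c e) \<in> N"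
    and "\<And>c e. c \<in> N \<Longrightarrow> e \<notin> D \<Longrightarrow> c e = 0"
  shows "\<exists>k. (\<forall>c. (\<lambda>e'. \<Sum>e\<in>E. k e' e * c e) \<in> N) \<and> (\<forall>c\<in>N. (\<lambda>e'. \<Sum>e\<in>E. k e' e * c e) = c) \<and>
    (\<forall>i\<in>I. \<forall>e\<in>E. \<forall>e'\<in>E. k e' e * g i e' / g i e \<in> Q)"
  using finite_subset[OF \<open>D \<subseteq> E\<close> E] assms(4-)
proof (induction D arbitrary: N rule: finite_psubset_induct)
  case (psubset D)
  note zero = psubset.prems(2) and add = psubset.prems(3) and scale = psubset.prems(4)
    and supp = psubset.prems(5)
  show ?case
  proof (cases "N = {\<lambda>_. 0}")
    case True
    thus ?thesis by (intro exI[of _ "\<lambda>_ _. 0"]) auto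
  next
    case False
    then obtain z where z: "z \<in> N" "z \<noteq> (\<lambda>_. 0)" using zero by auto
    define A where "A = {e \<in> D. z e \<noteq> 0}"
    obtain x where "z x \<noteq> 0" using z(2) by auto
    hence "x \<in> A" using supp[OF z(1)] by (auto simp: A_def)
    hence A: "finite A" "A \<noteq> {}" "A \<subseteq> E" using psubset.hyps psubset.prems(1) by (auto simp: A_def)
    \<comment> \<open>The \<open>i\<close>-th lattice consists of the vectors \<open>c\<close> with
      all \<open>c e * g i e\<close> in \<open>Q\<close>. \<open>P a b\<close> says that, measured
      by any weight, the entry of \<open>z\<close> at \<open>a\<close> divides the one at
      \<open>b\<close>.\<close>
    define P where "P = (\<lambda>a b. \<forall>i\<in>I. z b * g i b / (z a * g i a) \<in> Q)"
    have "\<exists>a\<in>A. \<forall>b\<in>A. P a b"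
    proof (rule finite_total_preorder_least[OF A(1,2)])
      fix a b assume ab: "a \<in> A" "b \<in> A"
      hence abE: "a \<in> E" "b \<in> E" "z a \<noteq> 0" "z b \<noteq> 0" using A by (auto simp: A_def)
      show "P a b \<or> P b a"
      proof (rule ccontr)
        \<comment> \<open>If weight \<open>i\<close> forbids the pivot \<open>a\<close> and weight
          \<open>j\<close> the pivot \<open>b\<close>, both defects are in \<open>J\<close> and
          their product is a cross ratio, against \<open>cross\<close>.\<close>
        assume "\<not> (P a b \<or> P b a)"
        then obtain i j where ij: "i \<in> I" "j \<in> I" and
          1: "z b * g i b / (z a * g i a) \<notin> Q" and 2: "z a * g j a / (z b * g j b) \<notin> Q"
          by (auto simp: P_def)
        have 3: "z a * g i a / (z b * g i b) \<in> J" using notin_inverse[OF 1] by simp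
        have 4: "z b * g j b / (z a * g j a) \<in> J" using notin_inverse[OF 2] by simp
        have "g j b * g i a = (z a * g i a / (z b * g i b)) * (z b * g j b / (z a * g j a)) * (g j a * g i b)"
          using abE g[OF ij(1) abE(1)] g[OF ij(1) abE(2)] g[OF ij(2) abE(1)] g[OF ij(2) abE(2)]
          by (simp add: field_simps)
        thus False using cross[OF ij(1,2) abE(1,2) 3 4] by simp
      qed
    next
      fix a b c assume abc: "a \<in> A" "b \<in> A" "c \<in> A" and P: "P a b" "P b c"
      show "P a c" unfolding P_def
      proof
        fix i assume i: "i \<in> I"
        have "z c * g i c / (z a * g i a) = z b * g i b / (z a * g i a) * (z c * g i c / (z b * g i b))"
          using abc A g[OF i, of b] by (auto simp: A_def)
        also have "\<dots> \<in> Q" using P i unfolding P_def by (intro mult_mem) auto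
        finally show "z c * g i c / (z a * g i a) \<in> Q" .
      qed
    qed
    then obtain p where p: "p \<in> A" "\<And>b. b \<in> A \<Longrightarrow> P p b" by blast
    have zp: "z p \<noteq> 0" "p \<in> D" "p \<in> E" using p A by (auto simp: A_def)
    have zQ: "z e * g i e / (z p * g i p) \<in> Q" if "e \<in> E" "i \<in> I" for e i
    proof (cases "e \<in> A")
      case True
      thus ?thesis using p that by (auto simp: P_def)
    next
      case False
      hence "z e = 0" using supp[OF z(1)] by (auto simp: A_def)
      thus ?thesis by simp
    qed
    \<comment> \<open>Vectors vanishing at the pivot are supported on fewer indices, which drives
      the induction.\<close>
    let ?N = "{c \<in> N. c p = 0}"
    have "\<exists>k. (\<forall>c. (\<lambda>e'. \<Sum>e\<in>E. k e' e * c e) \<in> ?N) \<and> (\<forall>c\<in>?N. (\<lambda>e'. \<Sum>e\<in>E. k e' e * c e) = c) \<and>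
      (\<forall>i\<in>I. \<forall>e\<in>E. \<forall>e'\<in>E. k e' e * g i e' / g i e \<in> Q)"
    proof (rule psubset.IH[of "D - {p}"])
      fix c e assume "c \<in> ?N" "e \<notin> D - {p}"
      thus "c e = 0" using supp[of c e] by auto
    qed (use zp psubset.prems in auto)
    then obtain k where k: "\<And>c. (\<lambda>e'. \<Sum>e\<in>E. k e' e * c e) \<in> ?N"
      "\<And>c. c \<in> ?N \<Longrightarrow> (\<lambda>e'. \<Sum>e\<in>E. k e' e * c e) = c"
      "\<And>i e e'. i \<in> I \<Longrightarrow> e \<in> E \<Longrightarrow> e' \<in> E \<Longrightarrow> k e' e * g i e' / g i e \<in> Q" by blast
    define w where "w = (\<lambda>e'. \<Sum>e\<in>E. k e' e * z e)"
    have w: "w \<in> N" using k(1)[of z] by (simp add: w_def)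
    \<comment> \<open>The retract \<open>w\<close> of \<open>z\<close> vanishes at \<open>p\<close>,
      so \<open>u\<close> is 1 there; adding \<open>c p\<close> times \<open>u\<close> to the
      retraction makes it fix \<open>z\<close> too.\<close>
    define u where "u = (\<lambda>e'. (z e' - w e') / z p)"
    have "(\<lambda>e. z e + (- 1) * w e) \<in> N" using add[OF z(1) scale[OF w]] .
    hence uN: "u \<in> N" using scale[of "\<lambda>e. z e + (- 1) * w e" "inverse (z p)"]
      by (simp add: u_def divide_inverse mult.commute)
    define k' where "k' = (\<lambda>e' e. k e' e + (if e = p then u e' else 0))"
    have k': "(\<Sum>e\<in>E. k' e' e * c e) = (\<Sum>e\<in>E. k e' e * c e) + c p * u e'" for c e'
    proof -
      have "(\<Sum>e\<in>E. k' e' e * c e) = (\<Sum>e\<in>E. k e' e * c e + (if e = p then c e * u e' else 0))"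
        by (intro sum.cong) (auto simp: k'_def algebra_simps)
      thus ?thesis using zp E by (simp add: sum.distrib)
    qed
    show ?thesis
    proof (intro exI[of _ k'] conjI allI ballI)
      fix c
      show "(\<lambda>e'. \<Sum>e\<in>E. k' e' e * c e) \<in> N"
        unfolding k' using k(1)[of c] uN by (intro add scale) auto
    next
      fix c assume c: "c \<in> N"
      let ?d = "\<lambda>e. c e + (- (c p / z p)) * z e"
      have "?d \<in> N" by (rule add[OF c scale[OF z(1)]])
      hence "?d \<in> ?N" using zp by simp
      from k(2)[OF this] have d: "(\<Sum>e\<in>E. k e' e * ?d e) = ?d e'" for e' by metis
      have d': "(\<Sum>e\<in>E. k e' e * ?d e) = (\<Sum>e\<in>E. k e' e * c e) - (c p / z p) * w e'" for e'
        by (simp add: w_def algebra_simps sum_subtractf sum_distrib_left)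
      have "(\<Sum>e\<in>E. k e' e * c e) = ?d e' + (c p / z p) * w e'" for e'
        using trans[OF d'[symmetric] d] by (simp only: diff_eq_eq)
      thus "(\<lambda>e'. \<Sum>e\<in>E. k' e' e * c e) = c" unfolding k' u_def using zp by (auto simp: field_simps)
    next
      fix i e e' assume i: "i \<in> I" and e: "e \<in> E" "e' \<in> E"
      have "u e' * g i e' / g i p \<in> Q"
      proof -
        have "w e' * g i e' / (z p * g i p) = (\<Sum>d\<in>E. (k e' d * g i e' / g i d) * (z d * g i d / (z p * g i p)))"
          unfolding w_def sum_distrib_right sum_divide_distrib using g[OF i] by (intro sum.cong) auto
        also have "\<dots> \<in> Q" using k(3) zQ i e by (intro sum_mem mult_mem) auto
        finally have "z e' * g i e' / (z p * g i p) - w e' * g i e' / (z p * g i p) \<in> Q"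
          using zQ[OF e(2) i] by auto
        moreover have "u e' * g i e' / g i p = z e' * g i e' / (z p * g i p) - w e' * g i e' / (z p * g i p)"
          by (simp add: u_def diff_divide_distrib left_diff_distrib)
        ultimately show ?thesis by simp
      qed
      thus "k' e' e * g i e' / g i e \<in> Q"
        using k(3)[OF i e] by (auto simp: k'_def distrib_right add_divide_distrib)
    qed
  qed
qed

end

section \<open>A criterion for semiheredity\<close>

context crossed
begin

text \<open>The presentation by \<open>comb n y\<close> splits: \<open>v - T v\<close> depends only
  on \<open>comb n y v\<close>, because \<open>T\<close> fixes relations, and has the same image as
  \<open>v\<close>, because \<open>T v\<close> is a relation.\<close>

lemma projective_of_retraction:
  assumes y: "\<And>i. i < n \<Longrightarrow> y i \<in> C"
    and T_mem: "\<And>v. v \<in> free_mod C cp_zero n \<Longrightarrow> T v \<in> free_mod C cp_zero n"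
    and T_add: "\<And>v w. T (\<lambda>i \<rho>. v i \<rho> + w i \<rho>) = (\<lambda>i \<rho>. T v i \<rho> + T w i \<rho>)"
    and T_mult: "\<And>a v. T (\<lambda>i. a \<star> v i) = (\<lambda>i. a \<star> T v i)"
    and T_ker: "\<And>v. comb n y (T v) = (\<lambda>_. 0)"
    and T_id: "\<And>v. v \<in> free_mod C cp_zero n \<Longrightarrow> comb n y v = (\<lambda>_. 0) \<Longrightarrow> T v = v"
  shows "left_projective C cp_add cp_zero (cp_mult G f) {comb n y v | v. \<forall>i<n. v i \<in> C}"
proof -
  let ?I = "{comb n y v | v. \<forall>i<n. v i \<in> C}" and ?F = "free_mod C cp_zero n"
  have zero_mem: "cp_zero \<in> C" by (auto simp: cp_zero_def cp_carrier_def)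
  have minus: "(\<lambda>i \<rho>. v i \<rho> - w i \<rho>) \<in> ?F" if "v \<in> ?F" "w \<in> ?F" for v w
    using that by (auto simp: free_mod_def cp_carrier_def cp_zero_def)
  have plus: "(\<lambda>i. cp_add (v i) (w i)) \<in> ?F" if "v \<in> ?F" "w \<in> ?F" for v w
    using that by (auto simp: free_mod_def cp_carrier_def cp_zero_def cp_add_def)
  have zero_right: "a \<star> cp_zero = cp_zero" for a
    by (auto simp: mult_act act_def cp_zero_def fun_eq_iff intro!: sum.neutral)
  have times_eq: "(\<lambda>i. if i < n then a \<star> v i else cp_zero) = (\<lambda>i. a \<star> v i)" if "v \<in> ?F" for a v
    using that zero_right by (intro ext[where 'a = nat]) (auto simp: free_mod_def not_less)
  have times: "(\<lambda>i. a \<star> v i) \<in> ?F" if "v \<in> ?F" "a \<in> C" for a v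
    using that zero_right by (auto simp: free_mod_def mult_closed)
  have T_minus: "T (\<lambda>i \<rho>. v i \<rho> - w i \<rho>) = (\<lambda>i \<rho>. T v i \<rho> - T w i \<rho>)" for v w
    using T_add[of "\<lambda>i \<rho>. v i \<rho> - w i \<rho>" w] by (auto simp: fun_eq_iff)
  have comb_minus: "comb n y (\<lambda>i \<rho>. v i \<rho> - w i \<rho>) = (\<lambda>\<rho>. comb n y v \<rho> - comb n y w \<rho>)" for v w
    using comb_add[of n y "\<lambda>i \<rho>. v i \<rho> - w i \<rho>" w] by (auto simp: fun_eq_iff)
  \<comment> \<open>An arbitrary preimage; \<open>\<iota>\<close> below does not depend on the
    choice.\<close>
  define rep where "rep = (\<lambda>x. SOME v. v \<in> ?F \<and> comb n y v = x)"
  have rep: "rep x \<in> ?F" "comb n y (rep x) = x" if x: "x \<in> ?I" for x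
  proof -
    obtain v where v: "x = comb n y v" "\<forall>i<n. v i \<in> C" using x by auto
    let ?v = "\<lambda>i. if i < n then v i else cp_zero"
    have "?v \<in> ?F \<and> comb n y ?v = x" using v by (auto simp: free_mod_def comb_def fun_eq_iff)
    hence "rep x \<in> ?F \<and> comb n y (rep x) = x" unfolding rep_def by (rule someI[where x = ?v])
    thus "rep x \<in> ?F" "comb n y (rep x) = x" by auto
  qed
  define \<iota> where "\<iota> = (\<lambda>x i \<rho>. rep x i \<rho> - T (rep x) i \<rho>)"
  have \<iota>: "\<iota> (comb n y v) = (\<lambda>i \<rho>. v i \<rho> - T v i \<rho>)" if v: "v \<in> ?F" for v
  proof -
    have "comb n y v \<in> ?I" using v by (auto simp: free_mod_def)
    note r = rep[OF this]
    have "T (\<lambda>i \<rho>. rep (comb n y v) i \<rho> - v i \<rho>) = (\<lambda>i \<rho>. rep (comb n y v) i \<rho> - v i \<rho>)"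
      by (rule T_id) (use r v minus in \<open>auto simp: comb_minus\<close>)
    thus ?thesis unfolding T_minus \<iota>_def by (auto simp: fun_eq_iff algebra_simps)
  qed
  have "projective_data C cp_add cp_zero (cp_mult G f) ?I n \<iota> (comb n y)"
    unfolding projective_data_def
  proof (intro conjI ballI)
    fix x assume x: "x \<in> ?I"
    show "\<iota> x \<in> ?F" unfolding \<iota>_def using minus T_mem rep[OF x] by auto
    show "comb n y (\<iota> x) = x" unfolding \<iota>_def using rep[OF x] T_ker by (simp add: comb_minus)
    {
      fix x' assume x': "x' \<in> ?I"
      have "cp_add x x' = comb n y (\<lambda>i \<rho>. rep x i \<rho> + rep x' i \<rho>)"
        using rep[OF x] rep[OF x'] by (auto simp: cp_add_def comb_add fun_eq_iff)
      hence "\<iota> (cp_add x x') = (\<lambda>i \<rho>. (rep x i \<rho> + rep x' i \<rho>) - T (\<lambda>i \<rho>. rep x i \<rho> + rep x' i \<rho>) i \<rho>)"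
        using \<iota>[of "\<lambda>i \<rho>. rep x i \<rho> + rep x' i \<rho>"] plus[OF rep(1)[OF x] rep(1)[OF x']] by (simp add: cp_add_def)
      thus "\<iota> (cp_add x x') = (\<lambda>i. cp_add (\<iota> x i) (\<iota> x' i))"
        unfolding T_add by (auto simp: \<iota>_def cp_add_def fun_eq_iff)
    }
    {
      fix r assume r: "r \<in> C"
      have "r \<star> x = comb n y (\<lambda>i. r \<star> rep x i)" using rep[OF x] by (simp add: comb_mult)
      hence "\<iota> (r \<star> x) = (\<lambda>i \<rho>. (r \<star> rep x i) \<rho> - (r \<star> T (rep x) i) \<rho>)"
        using \<iota>[OF times[OF rep(1)[OF x] r]] by (simp add: T_mult)
      also have "\<dots> = (\<lambda>i. r \<star> \<iota> x i)"
      proof (intro ext)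
        fix i \<rho>
        have "r \<star> rep x i = r \<star> (\<lambda>\<rho>. \<iota> x i \<rho> + T (rep x) i \<rho>)" by (simp add: \<iota>_def)
        thus "(r \<star> rep x i) \<rho> - (r \<star> T (rep x) i) \<rho> = (r \<star> \<iota> x i) \<rho>" by (simp add: mult_add_right)
      qed
      also have "\<dots> = (\<lambda>i. if i < n then r \<star> \<iota> x i else cp_zero)"
        using times_eq[of "\<iota> x" r] minus T_mem rep[OF x] unfolding \<iota>_def by auto
      finally show "\<iota> (r \<star> x) = (\<lambda>i. if i < n then r \<star> \<iota> x i else cp_zero)" .
    }
  next
    fix v assume v: "v \<in> ?F"
    show "comb n y v \<in> ?I" using v by (auto simp: free_mod_def)
    show "comb n y (\<lambda>i. cp_add (v i) (w i)) = cp_add (comb n y v) (comb n y w)" for w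
      by (auto simp: cp_add_def comb_add fun_eq_iff)
    show "comb n y (\<lambda>i. if i < n then r \<star> v i else cp_zero) = r \<star> comb n y v" for r
      unfolding times_eq[OF v] by (rule comb_mult)
  qed
  thus ?thesis unfolding left_projective_iff by blast
qed

text \<open>The inverse of \<open>act \<sigma>\<close>. The division by
  \<open>f \<sigma> \<rho>\<close> leads out of \<open>R\<close> and is the origin of the weighted
  lattices in the criterion.\<close>

definition iact :: "('k \<Rightarrow> 'k) \<Rightarrow> (('k \<Rightarrow> 'k) \<Rightarrow> 'k) \<Rightarrow> ('k \<Rightarrow> 'k) \<Rightarrow> 'k" where
  "iact \<sigma> b = (\<lambda>\<rho>. if \<rho> \<in> G then inv \<sigma> (b (\<sigma> \<circ> \<rho>) / f \<sigma> \<rho>) else 0)"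

lemma act_iact: "\<sigma> \<in> G \<Longrightarrow> (\<And>\<rho>. \<rho> \<notin> G \<Longrightarrow> b \<rho> = 0) \<Longrightarrow> act \<sigma> (iact \<sigma> b) = b"
  by (auto simp: act_def iact_def fun_eq_iff)

text \<open>With \<open>\<eta> = inv \<tau> \<circ> \<sigma>\<close>, the relation
  \<open>x_\<tau> x_\<eta> = f \<tau> \<eta> x_\<sigma>\<close> is solved for
  \<open>x_\<sigma>^-1 x_\<tau>\<close>; moving the scalar to the left applies
  \<open>inv \<sigma>\<close> to it.\<close>

lemma iact_act:
  assumes "\<sigma> \<in> G" "\<tau> \<in> G"
  shows "iact \<sigma> (act \<tau> b) \<rho> = inv \<sigma> (f \<tau> (inv \<tau> \<circ> \<sigma>)) * iact (inv \<tau> \<circ> \<sigma>) b \<rho>"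
proof (cases "\<rho> \<in> G")
  case True
  let ?\<eta> = "inv \<tau> \<circ> \<sigma>"
  have "\<tau> (f ?\<eta> \<rho>) * f \<tau> (?\<eta> \<circ> \<rho>) = f \<tau> ?\<eta> * f \<sigma> \<rho>"
    using cocycle[of \<tau> ?\<eta> \<rho>] assms True by simp
  from arg_cong[OF this, of "inv \<sigma>"]
  have "inv \<sigma> (\<tau> (f ?\<eta> \<rho>)) * inv \<sigma> (f \<tau> (?\<eta> \<circ> \<rho>)) = inv \<sigma> (f \<tau> ?\<eta>) * inv \<sigma> (f \<sigma> \<rho>)"
    using assms by simp
  thus ?thesis using assms True
    by (simp add: iact_def act_def o_assoc[symmetric] field_simps)
qed (simp add: iact_def)

lemma iact_add: "\<sigma> \<in> G \<Longrightarrow> iact \<sigma> (\<lambda>\<rho>. a \<rho> + b \<rho>) \<rho> = iact \<sigma> a \<rho> + iact \<sigma> b \<rho>"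
  by (simp add: iact_def add_divide_distrib)

lemma iact_scale: "\<sigma> \<in> G \<Longrightarrow> iact \<sigma> (\<lambda>\<rho>. s * b \<rho>) \<rho> = inv \<sigma> s * iact \<sigma> b \<rho>"
  by (simp add: iact_def)

text \<open>Right multiplication by the \<open>y i\<close> commutes with left multiplication by
  \<open>x_\<sigma>\<close>, so relations over \<open>K\<close> are stable under
  \<open>x_\<sigma>\<close> and, this being invertible, under its inverse.\<close>

lemma comb_iact:
  assumes s: "\<sigma> \<in> G" and v: "\<And>i \<rho>. \<rho> \<notin> G \<Longrightarrow> v i \<rho> = 0" and z: "comb n y v = (\<lambda>_. 0)"
  shows "comb n y (\<lambda>i. iact \<sigma> (v i)) = (\<lambda>_. 0)"
proof -
  have "act \<sigma> (comb n y (\<lambda>i. iact \<sigma> (v i))) = comb n y (\<lambda>i. act \<sigma> (iact \<sigma> (v i)))"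
    using s by (auto simp: comb_def act_sum act_mult fun_eq_iff)
  also have "\<dots> = (\<lambda>_. 0)" using act_iact[OF s] v z by simp
  finally have *: "act \<sigma> (comb n y (\<lambda>i. iact \<sigma> (v i))) \<rho> = 0" for \<rho> by simp
  show ?thesis
  proof
    fix \<rho> show "comb n y (\<lambda>i. iact \<sigma> (v i)) \<rho> = 0"
    proof (cases "\<rho> \<in> G")
      case True
      thus ?thesis using *[of "\<sigma> \<circ> \<rho>"] s by (simp add: act_def)
    qed (simp add: comb_def mult_outside)
  qed
qed

lemma comb_act:
  assumes "\<sigma> \<in> G" "comb n y v = (\<lambda>_. 0)"
  shows "comb n y (\<lambda>i. act \<sigma> (v i)) = (\<lambda>_. 0)"
proof -
  have "comb n y (\<lambda>i. act \<sigma> (v i)) = act \<sigma> (comb n y v)"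
    using assms(1) by (auto simp: comb_def act_sum act_mult fun_eq_iff)
  thus ?thesis using assms by (simp add: act_def fun_eq_iff)
qed

section \<open>Transport of ideals and localizations along automorphisms\<close>

lemma ideal_image:
  assumes s: "\<sigma> \<in> G" and I: "ideal_in R I"
  shows "ideal_in R (\<sigma> ` I)"
  unfolding ideal_in_def
proof (intro conjI ballI)
  note D = ideal_inD[OF I]
  show "\<sigma> ` I \<subseteq> R" using D stable[OF s] by auto
  show "0 \<in> \<sigma> ` I" using D(2) s by (intro image_eqI[of _ _ 0]) auto
  fix x y assume "x \<in> \<sigma> ` I" "y \<in> \<sigma> ` I"
  then obtain a b where "x = \<sigma> a" "y = \<sigma> b" "a \<in> I" "b \<in> I" by auto
  thus "x + y \<in> \<sigma> ` I" using D(3) s by (intro image_eqI[of _ _ "a + b"]) auto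
next
  note D = ideal_inD[OF I]
  fix r x assume r: "r \<in> R" and "x \<in> \<sigma> ` I"
  then obtain a where "x = \<sigma> a" "a \<in> I" by auto
  moreover have "inv \<sigma> r \<in> R" using stable[of "inv \<sigma>" r] s r by auto
  ultimately show "r * x \<in> \<sigma> ` I" using D(4) s by (intro image_eqI[of _ _ "inv \<sigma> r * a"]) auto
qed

lemma image_inv_image: "\<sigma> \<in> G \<Longrightarrow> \<sigma> ` (inv \<sigma> ` X) = X"
  by (auto simp: image_image)

lemma inv_image_image: "\<sigma> \<in> G \<Longrightarrow> inv \<sigma> ` (\<sigma> ` X) = X"
  by (auto simp: image_image)

lemma maximal_image:
  assumes s: "\<sigma> \<in> G" and N: "maximal_ideal_in R N"
  shows "maximal_ideal_in R (\<sigma> ` N)"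
proof -
  have R: "\<tau> ` R = R" if "\<tau> \<in> G" for \<tau>
  proof
    show "\<tau> ` R \<subseteq> R" using stable[OF that] by auto
    show "R \<subseteq> \<tau> ` R" using image_inv_image[OF that, of R] stable[OF inv_mem[OF that]] by blast
  qed
  show ?thesis
    unfolding maximal_ideal_in_def
  proof (intro conjI allI impI)
    show "ideal_in R (\<sigma> ` N)" using ideal_image s N by (auto simp: maximal_ideal_in_def)
    show "\<sigma> ` N \<noteq> R" 
    proof
      assume "\<sigma> ` N = R"
      hence "inv \<sigma> ` \<sigma> ` N = inv \<sigma> ` R" by simp
      hence "N = R" using inv_image_image[OF s, of N] R[OF inv_mem[OF s]] by simp
      thus False using N by (simp add: maximal_ideal_in_def)
    qed
  next
    fix J assume J: "ideal_in R J \<and> \<sigma> ` N \<subseteq> J"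
    hence "ideal_in R (inv \<sigma> ` J)" using ideal_image s by auto
    moreover have "N \<subseteq> inv \<sigma> ` J" using J inv_image_image[OF s, of N] by blast
    ultimately have "inv \<sigma> ` J = N \<or> inv \<sigma> ` J = R" using N by (simp add: maximal_ideal_in_def)
    hence "\<sigma> ` inv \<sigma> ` J = \<sigma> ` N \<or> \<sigma> ` inv \<sigma> ` J = \<sigma> ` R" by auto
    thus "J = \<sigma> ` N \<or> J = R" using image_inv_image[OF s, of J] R[OF s] by simp
  qed
qed

lemma ideal_prod_image:
  assumes s: "\<sigma> \<in> G" and x: "x \<in> ideal_prod N N"
  shows "\<sigma> x \<in> ideal_prod (\<sigma> ` N) (\<sigma> ` N)"
proof -
  obtain n :: nat and a b where ab: "\<forall>i<n. a i \<in> N \<and> b i \<in> N" "x = (\<Sum>i<n. a i * b i)"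
    using x by (rule ideal_prodE)
  have "\<sigma> x = (\<Sum>i<n. \<sigma> (a i) * \<sigma> (b i))" using ab s by simp
  thus ?thesis by (rule ideal_prod_memI) (use ab in auto)
qed

lemma localization_image:
  assumes s: "\<sigma> \<in> G"
  shows "\<sigma> ` localization R N = localization R (\<sigma> ` N)"
proof -
  have sub: "\<tau> ` localization R N \<subseteq> localization R (\<tau> ` N)" if t: "\<tau> \<in> G" for \<tau> N
  proof
    fix y assume "y \<in> \<tau> ` localization R N"
    then obtain a b where ab: "y = \<tau> (a / b)" "a \<in> R" "b \<in> R" "b \<notin> N" by (auto simp: localization_def)
    have "\<tau> b \<notin> \<tau> ` N" using ab t by auto
    moreover have "y = \<tau> a / \<tau> b" "\<tau> a \<in> R" "\<tau> b \<in> R" using ab t stable by auto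
    ultimately show "y \<in> localization R (\<tau> ` N)" unfolding localization_def by blast
  qed
  have "inv \<sigma> ` localization R (\<sigma> ` N) \<subseteq> localization R N"
    using sub[of "inv \<sigma>" "\<sigma> ` N"] s inv_image_image[OF s, of N] by simp
  hence "\<sigma> ` inv \<sigma> ` localization R (\<sigma> ` N) \<subseteq> \<sigma> ` localization R N" by blast
  thus ?thesis using sub[OF s, of N] image_inv_image[OF s, of "localization R (\<sigma> ` N)"] by blast
qed

text \<open>Every value of \<open>f\<close> divides one of the form
  \<open>f \<sigma> (inv \<sigma>)\<close>, and the hypothesis concerns all maximal ideals at once,
  so \<open>\<xi>\<close> can be undone by moving \<open>N\<close>.\<close>

lemma f_notin_square:
  assumes sq: "\<And>N \<sigma>. maximal_ideal_in R N \<Longrightarrow> \<sigma> \<in> G \<Longrightarrow> f \<sigma> (inv \<sigma>) \<notin> ideal_prod N N"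
    and N: "maximal_ideal_in R N" and s: "\<sigma> \<in> G" "\<tau> \<in> G" "\<xi> \<in> G"
  shows "\<xi> (f \<sigma> \<tau>) \<notin> ideal_prod N N"
proof
  assume "\<xi> (f \<sigma> \<tau>) \<in> ideal_prod N N"
  hence 1: "f \<sigma> \<tau> \<in> ideal_prod (inv \<xi> ` N) (inv \<xi> ` N)"
    using ideal_prod_image[of "inv \<xi>" "\<xi> (f \<sigma> \<tau>)" N] s by simp
  have max: "maximal_ideal_in R (inv \<xi> ` N)" by (rule maximal_image[OF inv_mem[OF s(3)] N])
  then interpret N: maximal_ideal_field R "inv \<xi> ` N" by unfold_locales
  have "\<sigma> (f (inv \<sigma>) (\<sigma> \<circ> \<tau>)) \<in> R" using s by (intro stable[OF s(1)] f_mem) auto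
  hence "f \<sigma> (inv \<sigma>) \<in> ideal_prod (inv \<xi> ` N) (inv \<xi> ` N)"
    using N.sq.ideal_mult_right[OF _ 1] f_dvd[OF s(1,2)] by metis
  thus False using sq[OF max s(1)] by simp
qed

text \<open>The element \<open>c\<close> is a multiple of the denominator \<open>s\<close>,
  congruent to 1 at \<open>M\<close> and to 0 at the other maximal ideals. The trace of
  \<open>t0 * c\<close> is fixed by \<open>G\<close> and outside \<open>M\<close>, hence a unit, and
  division by it normalizes the trace.\<close>

lemma ex_trace_one:
  assumes finmax: "finite {N. maximal_ideal_in R N}" and M: "maximal_ideal_in R M"
    and t0: "t0 \<in> R" "\<And>c. c \<in> R \<Longrightarrow> c - 1 \<in> M \<Longrightarrow>
      (\<And>N. maximal_ideal_in R N \<Longrightarrow> N \<noteq> M \<Longrightarrow> c \<in> N) \<Longrightarrow> (\<Sum>\<sigma>\<in>G. \<sigma> (t0 * c)) \<notin> M"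
    and unit: "\<And>\<theta>. \<theta> \<in> R \<Longrightarrow> (\<And>\<sigma>. \<sigma> \<in> G \<Longrightarrow> \<sigma> \<theta> = \<theta>) \<Longrightarrow> \<theta> \<notin> M \<Longrightarrow> inverse \<theta> \<in> R"
    and s: "s \<in> R" "s \<notin> M"
  obtains a where "a \<in> R" "(\<Sum>\<sigma>\<in>G. \<sigma> (s * a)) = 1"
    "\<And>N. maximal_ideal_in R N \<Longrightarrow> N \<noteq> M \<Longrightarrow> a \<in> N"
proof -
  interpret M: maximal_ideal_field R M using M by unfold_locales
  let ?X = "{N. maximal_ideal_in R N} - {M}"
  have "\<exists>c. c \<in> N \<and> c \<notin> M" if "N \<in> ?X" for N
    using that M unfolding maximal_ideal_in_def by blast
  then obtain c0 where c0: "\<And>N. N \<in> ?X \<Longrightarrow> c0 N \<in> N \<and> c0 N \<notin> M" by metis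
  have c0R: "c0 N \<in> R" if "N \<in> ?X" for N
    using c0[OF that] that by (auto simp: maximal_ideal_in_def ideal_in_def)
  define c' where "c' = (\<Prod>N\<in>?X. c0 N)"
  have c'R: "c' \<in> R" unfolding c'_def using c0R by (rule prod_mem)
  have c'M: "c' \<notin> M" unfolding c'_def using c0 c0R by (intro M.prod_notin) auto
  have c'N: "c' \<in> N" if N: "maximal_ideal_in R N" "N \<noteq> M" for N
  proof -
    interpret N: maximal_ideal_field R N using N by unfold_locales
    show ?thesis unfolding c'_def
      by (rule N.ideal_prod_mem[of ?X N]) (use finmax N c0 c0R in auto)
  qed
  obtain d where d: "d \<in> R" "(s * c') * d - 1 \<in> M"
    using M.inverse_mod[of "s * c'"] M.mult_notin[OF s(1) c'R s(2) c'M] s c'R by auto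
  define c where "c = s * c' * d"
  have c: "c \<in> R" "c - 1 \<in> M" using s c'R d by (auto simp: c_def)
  have cN: "c \<in> N" if N: "maximal_ideal_in R N" "N \<noteq> M" for N
  proof -
    interpret N: maximal_ideal_field R N using N by unfold_locales
    show ?thesis unfolding c_def
      by (rule N.ideal_mult_right[OF d(1) N.ideal_mult_left[OF s(1) c'N[OF N]]])
  qed
  define \<theta> where "\<theta> = (\<Sum>\<sigma>\<in>G. \<sigma> (t0 * c))"
  have \<theta>M: "\<theta> \<notin> M" unfolding \<theta>_def using t0(2)[OF c cN] by auto
  have \<theta>R: "\<theta> \<in> R" unfolding \<theta>_def by (rule sum_mem) (rule stable[OF _ mult_mem[OF t0(1) c(1)]])
  have \<theta>_fixed: "\<sigma> \<theta> = \<theta>" if "\<sigma> \<in> G" for \<sigma> using trace_fixed[OF that] unfolding \<theta>_def .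
  have inv\<theta>: "inverse \<theta> \<in> R" by (rule unit[of \<theta>], rule \<theta>R, erule \<theta>_fixed, rule \<theta>M)
  have \<theta>0: "\<theta> \<noteq> 0" using \<theta>M by auto
  \<comment> \<open>Chosen so that \<open>s * a = t0 * c * inverse \<theta>\<close>; the factor
    \<open>c'\<close> puts \<open>a\<close> into the other maximal ideals.\<close>
  define a where "a = c' * (d * t0 * inverse \<theta>)"
  have aR: "a \<in> R" unfolding a_def by (intro mult_mem c'R d(1) t0(1) inv\<theta>)
  moreover have "(\<Sum>\<sigma>\<in>G. \<sigma> (s * a)) = 1"
  proof -
    have "s * a = t0 * c * inverse \<theta>" by (simp add: a_def c_def)
    hence "(\<Sum>\<sigma>\<in>G. \<sigma> (s * a)) = (\<Sum>\<sigma>\<in>G. \<sigma> (t0 * c) * inverse \<theta>)"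
      using \<theta>_fixed by (intro sum.cong) auto
    also have "\<dots> = \<theta> * inverse \<theta>" by (simp add: \<theta>_def sum_distrib_right)
    finally show ?thesis using \<theta>0 by simp
  qed
  moreover have "a \<in> N" if N: "maximal_ideal_in R N" "N \<noteq> M" for N
  proof -
    interpret N: maximal_ideal_field R N using N by unfold_locales
    show ?thesis unfolding a_def
      by (intro N.ideal_mult_right[OF _ c'N[OF N]] mult_mem d(1) t0(1) inv\<theta>)
  qed
  ultimately show thesis by (rule that)
qed

lemma common_denominator:
  assumes M: "maximal_ideal_in R M" and X: "finite X" "X \<subseteq> localization R M"
  obtains s where "s \<in> R" "s \<notin> M" "\<And>x. x \<in> X \<Longrightarrow> s * x \<in> R"
proof -
  interpret M: maximal_ideal_field R M using M by unfold_locales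
  from X have "\<exists>s\<in>R. s \<notin> M \<and> (\<forall>x\<in>X. s * x \<in> R)"
  proof (induction X rule: finite_induct)
    case empty
    show ?case by (intro bexI[of _ 1]) auto
  next
    case (insert x X)
    then obtain s where s: "s \<in> R" "s \<notin> M" "\<forall>x\<in>X. s * x \<in> R" by auto
    have "x \<in> localization R M" using insert by auto
    then obtain a b where ab: "x = a / b" "a \<in> R" "b \<in> R" "b \<notin> M" "b \<noteq> 0" by (rule M.locE)
    have "b * s * x' \<in> R" if "x' \<in> insert x X" for x'
    proof (cases "x' = x")
      case True
      have eq: "b * s * x = s * a" using ab by simp
      show ?thesis unfolding True eq by (rule mult_mem[OF s(1) ab(2)])
    next
      case False
      thus ?thesis using that s mult_mem[OF ab(3), of "s * x'"] by (simp add: mult.assoc)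
    qed
    moreover have "b * s \<in> R" "b * s \<notin> M" using ab s M.mult_notin by auto
    ultimately show ?case by blast
  qed
  thus thesis using that by blast
qed

text \<open>The sum over \<open>\<sigma>\<close> of \<open>x_\<sigma> (t k) x_\<sigma>^-1\<close>,
  where the \<open>K\<close>-linear map \<open>k\<close> is given by a matrix indexed by pairs of a
  coordinate and a group element.\<close>

definition avg :: "'k \<Rightarrow> nat \<Rightarrow> (nat \<times> ('k \<Rightarrow> 'k) \<Rightarrow> nat \<times> ('k \<Rightarrow> 'k) \<Rightarrow> 'k) \<Rightarrow>
    (nat \<Rightarrow> ('k \<Rightarrow> 'k) \<Rightarrow> 'k) \<Rightarrow> nat \<Rightarrow> ('k \<Rightarrow> 'k) \<Rightarrow> 'k" where
  "avg t n k v = (\<lambda>i \<rho>. \<Sum>\<sigma>\<in>G. act \<sigma>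
     (\<lambda>\<rho>. t * (\<Sum>(j, \<xi>)\<in>{..<n}\<times>G. k (i, \<rho>) (j, \<xi>) * iact \<sigma> (v j) \<xi>)) \<rho>)"

lemma avg_add: "avg t n k (\<lambda>i \<rho>. v i \<rho> + w i \<rho>) = (\<lambda>i \<rho>. avg t n k v i \<rho> + avg t n k w i \<rho>)"
proof (intro ext)
  fix i \<rho>
  have "act \<sigma> (\<lambda>\<rho>. t * (\<Sum>(j, \<xi>)\<in>{..<n}\<times>G. k (i, \<rho>) (j, \<xi>) * iact \<sigma> (\<lambda>\<rho>. v j \<rho> + w j \<rho>) \<xi>)) \<rho>
    = act \<sigma> (\<lambda>\<rho>. t * (\<Sum>(j, \<xi>)\<in>{..<n}\<times>G. k (i, \<rho>) (j, \<xi>) * iact \<sigma> (v j) \<xi>)) \<rho>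
    + act \<sigma> (\<lambda>\<rho>. t * (\<Sum>(j, \<xi>)\<in>{..<n}\<times>G. k (i, \<rho>) (j, \<xi>) * iact \<sigma> (w j) \<xi>)) \<rho>"
    if s: "\<sigma> \<in> G" for \<sigma>
    unfolding act_add[OF s, symmetric]
    by (simp add: iact_add[OF s] distrib_left sum.distrib case_prod_unfold)
  thus "avg t n k (\<lambda>i \<rho>. v i \<rho> + w i \<rho>) i \<rho> = avg t n k v i \<rho> + avg t n k w i \<rho>"
    unfolding avg_def by (simp add: sum.distrib)
qed

text \<open>Left multiplication by \<open>x_\<tau>\<close> permutes the conjugates: the scalar that
  \<open>iact_act\<close> produces on one side is absorbed by \<open>act_act\<close> on the other,
  and \<open>\<sigma>\<close> is replaced by \<open>inv \<tau> \<circ> \<sigma>\<close>.\<close>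

lemma avg_scale_act:
  assumes t: "\<tau> \<in> G"
  shows "avg t n k (\<lambda>i \<rho>. s * act \<tau> (v i) \<rho>) i \<rho> = s * act \<tau> (avg t n k v i) \<rho>"
proof -
  let ?h = "\<lambda>\<sigma> v. (\<lambda>\<rho>. t * (\<Sum>(j, \<xi>)\<in>{..<n}\<times>G. k (i, \<rho>) (j, \<xi>) * iact \<sigma> (v j) \<xi>))"
  have "act \<sigma> (?h \<sigma> (\<lambda>i \<rho>. s * act \<tau> (v i) \<rho>)) \<rho> = s * act \<tau> (act (inv \<tau> \<circ> \<sigma>) (?h (inv \<tau> \<circ> \<sigma>) v)) \<rho>"
    if s: "\<sigma> \<in> G" for \<sigma>
  proof -
    have "?h \<sigma> (\<lambda>i \<rho>. s * act \<tau> (v i) \<rho>) = (\<lambda>\<rho>. inv \<sigma> (s * f \<tau> (inv \<tau> \<circ> \<sigma>)) * ?h (inv \<tau> \<circ> \<sigma>) v \<rho>)"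
    proof
      fix \<rho>
      have "iact \<sigma> (\<lambda>\<rho>. s * act \<tau> (v j) \<rho>) \<xi> =
          inv \<sigma> (s * f \<tau> (inv \<tau> \<circ> \<sigma>)) * iact (inv \<tau> \<circ> \<sigma>) (v j) \<xi>" for j \<xi>
        unfolding iact_scale[OF s] iact_act[OF s t] using s by simp
      thus "?h \<sigma> (\<lambda>i \<rho>. s * act \<tau> (v i) \<rho>) \<rho> = inv \<sigma> (s * f \<tau> (inv \<tau> \<circ> \<sigma>)) * ?h (inv \<tau> \<circ> \<sigma>) v \<rho>"
        by (simp add: sum_distrib_left case_prod_unfold mult_ac)
    qed
    hence "act \<sigma> (?h \<sigma> (\<lambda>i \<rho>. s * act \<tau> (v i) \<rho>)) \<rho> =
        s * f \<tau> (inv \<tau> \<circ> \<sigma>) * act \<sigma> (?h (inv \<tau> \<circ> \<sigma>) v) \<rho>"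
      using s by (simp only: act_scale aut_inv)
    thus ?thesis using act_act[OF t comp_mem[OF inv_mem[OF t] s], of "?h (inv \<tau> \<circ> \<sigma>) v" \<rho>] s t by simp
  qed
  hence "avg t n k (\<lambda>i \<rho>. s * act \<tau> (v i) \<rho>) i \<rho>
      = (\<Sum>\<sigma>\<in>G. s * act \<tau> (act (inv \<tau> \<circ> \<sigma>) (?h (inv \<tau> \<circ> \<sigma>) v)) \<rho>)"
    unfolding avg_def by simp
  also have "\<dots> = (\<Sum>\<sigma>\<in>G. s * act \<tau> (act \<sigma> (?h \<sigma> v)) \<rho>)"
    using sum_left_shift[OF inv_mem[OF t], of "\<lambda>\<sigma>. s * act \<tau> (act \<sigma> (?h \<sigma> v)) \<rho>"] .
  also have "\<dots> = s * act \<tau> (avg t n k v i) \<rho>"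
    unfolding avg_def act_sum[OF t] by (simp add: sum_distrib_left)
  finally show ?thesis .
qed

lemma avg_zero: "avg t n k (\<lambda>i \<rho>. 0) = (\<lambda>i \<rho>. 0)"
  by (auto simp: avg_def fun_eq_iff act_def iact_def intro!: sum.neutral)

lemma avg_mult: "avg t n k (\<lambda>i. a \<star> v i) = (\<lambda>i. a \<star> avg t n k v i)"
proof (intro ext)
  fix i \<rho>
  have "avg t n k (\<lambda>i \<rho>. \<Sum>\<tau>\<in>H. a \<tau> * act \<tau> (v i) \<rho>) i \<rho> = (\<Sum>\<tau>\<in>H. a \<tau> * act \<tau> (avg t n k v i) \<rho>)"
    if "finite H" "H \<subseteq> G" for H
    using that
  proof (induction H rule: finite_induct)
    case (insert \<tau> H)
    thus ?case by (simp add: avg_add avg_scale_act)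
  qed (simp add: avg_zero)
  from this[of G] show "avg t n k (\<lambda>i. a \<star> v i) i \<rho> = (a \<star> avg t n k v i) \<rho>"
    unfolding mult_act by simp
qed

text \<open>The trace hypotheses are what tameness supplies, both for \<open>S\<close> and for its
  localization at \<open>M\<close>; in this abstract form they cover \<open>A_f\<close>, its
  opposite and the crossed product of the inertia group.\<close>

lemma left_semihereditary_criterion:
  assumes finmax: "finite {N. maximal_ideal_in R N}"
    and val: "\<And>N z. maximal_ideal_in R N \<Longrightarrow> z \<noteq> 0 \<Longrightarrow> z \<in> localization R N \<or> inverse z \<in> localization R N"
    and sq: "\<And>N \<sigma>. maximal_ideal_in R N \<Longrightarrow> \<sigma> \<in> G \<Longrightarrow> f \<sigma> (inv \<sigma>) \<notin> ideal_prod N N"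
    and M: "maximal_ideal_in R M"
    and t0: "t0 \<in> R" "\<And>c. c \<in> R \<Longrightarrow> c - 1 \<in> M \<Longrightarrow>
      (\<And>N. maximal_ideal_in R N \<Longrightarrow> N \<noteq> M \<Longrightarrow> c \<in> N) \<Longrightarrow> (\<Sum>\<sigma>\<in>G. \<sigma> (t0 * c)) \<notin> M"
    and unit: "\<And>\<theta>. \<theta> \<in> R \<Longrightarrow> (\<And>\<sigma>. \<sigma> \<in> G \<Longrightarrow> \<sigma> \<theta> = \<theta>) \<Longrightarrow> \<theta> \<notin> M \<Longrightarrow> inverse \<theta> \<in> R"
  shows "left_semihereditary C cp_add cp_zero (cp_mult G f)"
  unfolding left_semihereditary_def
proof (intro allI impI)
  fix I assume "fg_left_ideal C cp_add cp_zero (cp_mult G f) I"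
  then obtain X where X: "finite X" "X \<subseteq> C"
    and I: "I = \<Inter> {J. left_ideal C cp_add cp_zero (cp_mult G f) J \<and> X \<subseteq> J}"
    unfolding fg_left_ideal_def by auto
  define n where "n = card X"
  obtain y where "bij_betw y {0..<n} X" using ex_bij_betw_nat_finite[OF X(1)] unfolding n_def by auto
  hence yX: "X = y ` {..<n}" by (simp add: bij_betw_def atLeast0LessThan)
  have y: "y i \<in> C" if "i < n" for i using X(2) yX that by auto
  have I_eq: "I = {comb n y v | v. \<forall>i<n. v i \<in> C}"
    unfolding I yX by (rule generated_left_ideal[OF y])
  interpret M: maximal_ideal_field R M using M by unfold_locales
  interpret Q: val_ring "localization R M" "loc_ideal R M"
    using val[OF M] by unfold_locales auto
  define E where "E = {..<n} \<times> G"
  \<comment> \<open>\<open>x_\<sigma>^-1\<close> maps the free module onto the lattice of all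
    \<open>c\<close> supported on \<open>E\<close> with \<open>c e * g \<sigma> e\<close> in
    \<open>R\<close>.\<close>
  define g where "g = (\<lambda>\<sigma> (e :: nat \<times> ('k \<Rightarrow> 'k)). inv \<sigma> (f \<sigma> (snd e)))"
  define Ns where "Ns = {c. (\<forall>e. e \<notin> E \<longrightarrow> c e = 0) \<and> comb n y (\<lambda>i \<rho>. c (i, \<rho>)) = (\<lambda>_. 0)}"
  have E: "finite E" by (simp add: E_def)
  have gR: "g \<sigma> e \<in> R" and g0: "g \<sigma> e \<noteq> 0" if "\<sigma> \<in> G" "e \<in> E" for \<sigma> e
    using that stable[OF inv_mem[OF that(1)] f_mem[OF that(1)], of "snd e"] by (auto simp: g_def E_def)
  have "\<exists>k. (\<forall>c. (\<lambda>e'. \<Sum>e\<in>E. k e' e * c e) \<in> Ns) \<and> (\<forall>c\<in>Ns. (\<lambda>e'. \<Sum>e\<in>E. k e' e * c e) = c) \<and>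
    (\<forall>\<sigma>\<in>G. \<forall>e\<in>E. \<forall>e'\<in>E. k e' e * g \<sigma> e' / g \<sigma> e \<in> localization R M)"
  proof (rule Q.integral_retraction[OF E])
    fix \<sigma> \<sigma>' e e' a b
    assume s: "\<sigma> \<in> G" "\<sigma>' \<in> G" and e: "e \<in> E" "e' \<in> E" and ab: "a \<in> loc_ideal R M" "b \<in> loc_ideal R M"
    let ?\<gamma> = "\<sigma>' \<circ> inv \<sigma>"
    \<comment> \<open>The cocycle identity for \<open>\<sigma>' = ?\<gamma> \<circ> \<sigma>\<close>
      shows that \<open>g \<sigma>'\<close> and \<open>g \<sigma>\<close> differ by \<open>u\<close>
      up to a constant factor. A forbidden cross ratio becomes \<open>u e' = a * u e * b\<close>,
      which puts a conjugate of a value of \<open>f\<close> into the square of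
      \<open>M\<close>.\<close>
    define u where "u = (\<lambda>e :: nat \<times> ('k \<Rightarrow> 'k). inv \<sigma>' (f ?\<gamma> (\<sigma> \<circ> snd e)))"
    have *: "g \<sigma>' d * inv \<sigma>' (f ?\<gamma> \<sigma>) = g \<sigma> d * u d" if "d \<in> E" for d
    proof -
      have d: "snd d \<in> G" using that by (auto simp: E_def)
      have "?\<gamma> (f \<sigma> (snd d)) * f ?\<gamma> (\<sigma> \<circ> snd d) = f ?\<gamma> \<sigma> * f \<sigma>' (snd d)"
        using cocycle[of ?\<gamma> \<sigma> "snd d"] s d by (simp add: o_assoc[symmetric])
      from arg_cong[OF this, of "inv \<sigma>'"] show ?thesis
        unfolding g_def u_def using s by (simp add: mult.commute)
    qed
    have \<kappa>: "inv \<sigma>' (f ?\<gamma> \<sigma>) \<noteq> 0" using s by simp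
    have uR: "u d \<in> R" if "d \<in> E" for d
      unfolding u_def using that s by (intro stable[OF inv_mem[OF s(2)]] f_mem) (auto simp: E_def)
    show "g \<sigma>' e' * g \<sigma> e \<noteq> a * b * (g \<sigma>' e * g \<sigma> e')"
    proof
      assume eq: "g \<sigma>' e' * g \<sigma> e = a * b * (g \<sigma>' e * g \<sigma> e')"
      have "(g \<sigma> e' * g \<sigma> e) * u e' = (g \<sigma>' e' * inv \<sigma>' (f ?\<gamma> \<sigma>)) * g \<sigma> e"
        unfolding *[OF e(2)] by (simp add: mult_ac)
      also have "\<dots> = a * b * ((g \<sigma>' e * inv \<sigma>' (f ?\<gamma> \<sigma>)) * g \<sigma> e')"
        using arg_cong[OF eq, of "\<lambda>x. x * inv \<sigma>' (f ?\<gamma> \<sigma>)"] by (simp add: mult_ac)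
      also have "\<dots> = (g \<sigma> e' * g \<sigma> e) * ((a * u e) * b)"
        unfolding *[OF e(1)] by (simp add: mult_ac)
      finally have "u e' = (a * u e) * b" using g0[OF s(1)] e by simp
      moreover have "a * u e \<in> loc_ideal R M"
        using M.loc.ideal_mult_right[OF M.sub_loc[OF uR[OF e(1)]] ab(1)] .
      ultimately have "u e' \<in> ideal_prod M M" using M.loc_sq_mult[OF uR[OF e(2)] _ ab(2)] by blast
      moreover have "u e' \<notin> ideal_prod M M"
        unfolding u_def using e
        by (intro f_notin_square[OF sq M comp_mem[OF s(2) inv_mem[OF s(1)]] comp_mem[OF s(1)] inv_mem[OF s(2)]])
          (auto simp: E_def)
      ultimately show False by simp
    qed
  next
    show "(\<lambda>_. 0) \<in> Ns" by (simp add: Ns_def comb_def)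
  next
    fix c d assume "c \<in> Ns" "d \<in> Ns"
    thus "(\<lambda>e. c e + d e) \<in> Ns"
      using comb_add[of n y "\<lambda>i \<rho>. c (i, \<rho>)" "\<lambda>i \<rho>. d (i, \<rho>)"] by (auto simp: Ns_def fun_eq_iff)
  next
    fix s c assume "c \<in> Ns"
    thus "(\<lambda>e. s * c e) \<in> Ns"
      by (auto simp: Ns_def comb_def mult_scale sum_distrib_left[symmetric] fun_eq_iff)
  next
    fix c e assume "c \<in> Ns" "e \<notin> E"
    thus "c e = 0" unfolding Ns_def by blast
  qed (use g0 in auto)
  then obtain k where k1: "\<And>c. (\<lambda>e'. \<Sum>e\<in>E. k e' e * c e) \<in> Ns"
    and k2: "\<And>c. c \<in> Ns \<Longrightarrow> (\<lambda>e'. \<Sum>e\<in>E. k e' e * c e) = c"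
    and k3: "\<And>\<sigma> e e'. \<sigma> \<in> G \<Longrightarrow> e \<in> E \<Longrightarrow> e' \<in> E \<Longrightarrow> k e' e * g \<sigma> e' / g \<sigma> e \<in> localization R M"
    by blast
  \<comment> \<open>The weight of \<open>id\<close> is constantly 1 by normalization, so the entries
    of \<open>k\<close> themselves are local at \<open>M\<close>.\<close>
  have "k e' e \<in> localization R M" if "e \<in> E" "e' \<in> E" for e e'
  proof -
    have "g id e = 1" "g id e' = 1" using that by (auto simp: g_def E_def)
    thus ?thesis using k3[OF id_mem that] by simp
  qed
  hence "(\<lambda>(e', e). k e' e) ` (E \<times> E) \<subseteq> localization R M" by auto
  then obtain s where s: "s \<in> R" "s \<notin> M" "\<And>x. x \<in> (\<lambda>(e', e). k e' e) ` (E \<times> E) \<Longrightarrow> s * x \<in> R"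
    using common_denominator[OF M, of "(\<lambda>(e', e). k e' e) ` (E \<times> E)"] E by blast
  have sk: "s * k e' e \<in> R" if "e \<in> E" "e' \<in> E" for e e' using s(3)[of "k e' e"] that by auto
  obtain a where a: "a \<in> R" "(\<Sum>\<sigma>\<in>G. \<sigma> (s * a)) = 1"
    "\<And>N. maximal_ideal_in R N \<Longrightarrow> N \<noteq> M \<Longrightarrow> a \<in> N"
    using ex_trace_one[OF finmax M t0 unit s(1,2)] by blast
  define t where "t = s * a"
  have tR: "t \<in> R" unfolding t_def using s a by auto
  \<comment> \<open>Integrality of \<open>t k\<close> in each lattice. At \<open>M\<close> it is
    built into \<open>k\<close>; elsewhere \<open>s\<close> clears the entry of \<open>k\<close>,
    and \<open>a\<close> has to absorb the denominator \<open>g \<sigma> e\<close>.\<close>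
  have key: "t * k e' e * g \<sigma> e' / g \<sigma> e \<in> R" if \<sigma>: "\<sigma> \<in> G" and e: "e \<in> E" "e' \<in> E" for \<sigma> e e'
  proof (rule mem_of_all_localizations)
    fix N assume N: "maximal_ideal_in R N"
    interpret N: maximal_ideal_field R N using N by unfold_locales
    show "t * k e' e * g \<sigma> e' / g \<sigma> e \<in> localization R N"
    proof (cases "N = M")
      case True
      have "t * (k e' e * g \<sigma> e' / g \<sigma> e) \<in> localization R M"
        by (rule M.loc.mult_mem[OF M.sub_loc[OF tR] k3[OF \<sigma> e]])
      thus ?thesis using True by (simp add: mult.assoc)
    next
      case False
      interpret QN: val_ring "localization R N" "loc_ideal R N"
        using val[OF N] by unfold_locales auto
      have aN: "a \<in> N" using a(3)[OF N False] .
      \<comment> \<open>Here one factor \<open>a\<close> from \<open>N\<close> is enough, because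
        \<open>g \<sigma> e\<close> is outside the square of \<open>N\<close>.\<close>
      have "a / g \<sigma> e \<in> localization R N"
      proof (rule ccontr)
        assume "a / g \<sigma> e \<notin> localization R N"
        hence 1: "g \<sigma> e / a \<in> loc_ideal R N" and "a \<noteq> 0"
          using QN.notin_inverse[of "a / g \<sigma> e"] by auto
        hence "g \<sigma> e = a * (g \<sigma> e / a)" by simp
        hence "g \<sigma> e \<in> ideal_prod N N"
          using N.loc_sq_mult[OF gR[OF \<sigma> e(1)] N.ideal_sub_loc[OF aN] 1] by simp
        moreover have "g \<sigma> e \<notin> ideal_prod N N"
          unfolding g_def using e
          by (intro f_notin_square[OF sq N \<sigma> _ inv_mem[OF \<sigma>]]) (auto simp: E_def)
        ultimately show False by simp
      qed
      hence "(a / g \<sigma> e) * ((s * k e' e) * g \<sigma> e') \<in> localization R N"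
        by (rule N.loc.mult_mem[OF _ N.sub_loc[OF mult_mem[OF sk[OF e] gR[OF \<sigma> e(2)]]]])
      thus ?thesis by (simp add: t_def mult_ac)
    qed
  qed
  \<comment> \<open>\<open>w v \<sigma>\<close> is \<open>k\<close> applied to
    \<open>x_\<sigma>^-1 v\<close>.\<close>
  define w where "w = (\<lambda>v \<sigma> i \<rho>. \<Sum>(j, \<xi>)\<in>{..<n}\<times>G. k (i, \<rho>) (j, \<xi>) * iact \<sigma> (v j) \<xi>)"
  have avg_w: "avg t n k v = (\<lambda>i \<rho>. \<Sum>\<sigma>\<in>G. act \<sigma> (\<lambda>\<rho>. t * w v \<sigma> i \<rho>) \<rho>)" for v
    unfolding avg_def w_def ..
  have w_eq: "(\<lambda>(i, \<rho>). w v \<sigma> i \<rho>) = (\<lambda>e'. \<Sum>e\<in>E. k e' e * (\<lambda>(j, \<xi>). iact \<sigma> (v j) \<xi>) e)" for v \<sigma>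
    unfolding w_def E_def by (auto simp: fun_eq_iff case_prod_unfold)
  have wN: "(\<lambda>(i, \<rho>). w v \<sigma> i \<rho>) \<in> Ns" for v \<sigma> unfolding w_eq by (rule k1)
  have w_supp: "w v \<sigma> i \<rho> = 0" if "(i, \<rho>) \<notin> E" for v \<sigma> i \<rho>
    using wN[of v \<sigma>] that by (auto simp: Ns_def)
  have w_comb: "comb n y (w v \<sigma>) = (\<lambda>_. 0)" for v \<sigma> using wN[of v \<sigma>] by (simp add: Ns_def)
  show "left_projective C cp_add cp_zero (cp_mult G f) I"
    unfolding I_eq
  proof (rule projective_of_retraction[where T = "avg t n k"])
    fix v assume v: "v \<in> free_mod C cp_zero n"
    have "avg t n k v i = cp_zero" if "i \<ge> n" for i
      unfolding avg_w cp_zero_def using w_supp that by (auto simp: act_def E_def fun_eq_iff intro!: sum.neutral)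
    moreover have "avg t n k v i \<in> C" if i: "i < n" for i
      unfolding avg_w
    proof (rule carrier_sum)
      fix \<sigma> assume \<sigma>: "\<sigma> \<in> G"
      have "act \<sigma> (\<lambda>\<rho>. t * w v \<sigma> i \<rho>) \<rho> \<in> R" if \<rho>: "\<rho> \<in> G" for \<rho>
      proof -
        let ?e' = "(i, inv \<sigma> \<circ> \<rho>)"
        have e': "?e' \<in> E" using i \<rho> \<sigma> by (auto simp: E_def)
        have "act \<sigma> (\<lambda>\<rho>. t * w v \<sigma> i \<rho>) \<rho> = \<sigma> (t * w v \<sigma> i (inv \<sigma> \<circ> \<rho>) * g \<sigma> ?e')"
          using \<rho> \<sigma> by (simp add: act_def g_def)
        also have "w v \<sigma> i (inv \<sigma> \<circ> \<rho>) = (\<Sum>e\<in>E. k ?e' e * (inv \<sigma> (v (fst e) (\<sigma> \<circ> snd e)) / g \<sigma> e))"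
          unfolding w_def E_def using \<sigma> by (intro sum.cong) (auto simp: iact_def g_def)
        also have "t * \<dots> * g \<sigma> ?e' =
            (\<Sum>e\<in>E. (t * k ?e' e * g \<sigma> ?e' / g \<sigma> e) * inv \<sigma> (v (fst e) (\<sigma> \<circ> snd e)))"
          by (simp add: sum_distrib_left sum_distrib_right mult_ac)
        finally have eq: "act \<sigma> (\<lambda>\<rho>. t * w v \<sigma> i \<rho>) \<rho> =
          \<sigma> (\<Sum>e\<in>E. (t * k ?e' e * g \<sigma> ?e' / g \<sigma> e) * inv \<sigma> (v (fst e) (\<sigma> \<circ> snd e)))" .
        show ?thesis unfolding eq
        proof (rule stable[OF \<sigma> sum_mem], rule mult_mem)
          fix e assume e: "e \<in> E"
          show "t * k ?e' e * g \<sigma> ?e' / g \<sigma> e \<in> R" by (rule key[OF \<sigma> e e'])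
          have "v (fst e) (\<sigma> \<circ> snd e) \<in> R"
            using v e \<sigma> by (auto simp: E_def free_mod_def cp_carrier_def)
          thus "inv \<sigma> (v (fst e) (\<sigma> \<circ> snd e)) \<in> R" by (rule stable[OF inv_mem[OF \<sigma>]])
        qed
      qed
      thus "act \<sigma> (\<lambda>\<rho>. t * w v \<sigma> i \<rho>) \<in> C" by (auto simp: cp_carrier_def act_def)
    qed
    ultimately show "avg t n k v \<in> free_mod C cp_zero n" by (simp add: free_mod_def)
  next
    fix v
    have "comb n y (\<lambda>i \<rho>. t * w v \<sigma> i \<rho>) = (\<lambda>_. 0)" for \<sigma>
      using w_comb[of v \<sigma>] by (simp add: comb_def mult_scale sum_distrib_left[symmetric] fun_eq_iff)
    hence "comb n y (\<lambda>i. act \<sigma> (\<lambda>\<rho>. t * w v \<sigma> i \<rho>)) = (\<lambda>_. 0)" if "\<sigma> \<in> G" for \<sigma>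
      using comb_act[OF that] by blast
    hence "(\<Sum>\<sigma>\<in>G. comb n y (\<lambda>i. act \<sigma> (\<lambda>\<rho>. t * w v \<sigma> i \<rho>)) \<rho>) = 0" for \<rho> by simp
    thus "comb n y (avg t n k v) = (\<lambda>_. 0)"
      unfolding avg_w comb_def mult_sum_left by (subst sum.swap) simp
  next
    fix v assume v: "v \<in> free_mod C cp_zero n" and ker: "comb n y v = (\<lambda>_. 0)"
    have v0: "v i \<rho> = 0" if "\<rho> \<notin> G \<or> i \<ge> n" for i \<rho>
      using v that by (cases "i < n") (auto simp: free_mod_def cp_carrier_def cp_zero_def)
    have w_id: "w v \<sigma> i = iact \<sigma> (v i)" if \<sigma>: "\<sigma> \<in> G" for \<sigma> i
    proof -
      have "(\<lambda>(j, \<xi>). iact \<sigma> (v j) \<xi>) \<in> Ns"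
        using comb_iact[OF \<sigma> _ ker] v0 \<sigma> by (auto simp: Ns_def E_def iact_def)
      from fun_cong[OF k2[OF this]] have "(\<lambda>(i, \<rho>). w v \<sigma> i \<rho>) (i, \<rho>) = iact \<sigma> (v i) \<rho>" for \<rho>
        unfolding w_eq by simp
      thus ?thesis by auto
    qed
    show "avg t n k v = v"
    proof (intro ext)
      fix i \<rho>
      have "avg t n k v i \<rho> = (\<Sum>\<sigma>\<in>G. \<sigma> t * act \<sigma> (iact \<sigma> (v i)) \<rho>)"
        unfolding avg_w by (intro sum.cong) (auto simp: w_id act_scale)
      also have "\<dots> = (\<Sum>\<sigma>\<in>G. \<sigma> t * v i \<rho>)" using act_iact v0 by (intro sum.cong) auto
      also have "\<dots> = v i \<rho>" using a(2) by (simp add: t_def sum_distrib_right[symmetric])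
      finally show "avg t n k v i \<rho> = v i \<rho>" .
    qed
  qed (use y avg_add avg_mult in auto)
qed

end

section \<open>The opposite crossed product\<close>

text \<open>Closure of the carriers under the operations is supplied by the assumption that each
  carrier is a left ideal of itself.\<close>

locale ring_iso =
  fixes C :: "'a set" and pl :: "'a \<Rightarrow> 'a \<Rightarrow> 'a" and z :: 'a and ml :: "'a \<Rightarrow> 'a \<Rightarrow> 'a"
    and C' :: "'b set" and pl' :: "'b \<Rightarrow> 'b \<Rightarrow> 'b" and z' :: 'b and ml' :: "'b \<Rightarrow> 'b \<Rightarrow> 'b"
    and h :: "'a \<Rightarrow> 'b" and h' :: "'b \<Rightarrow> 'a"
  assumes h_mem: "x \<in> C \<Longrightarrow> h x \<in> C'" and h'_mem: "x' \<in> C' \<Longrightarrow> h' x' \<in> C"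
    and h'h: "x \<in> C \<Longrightarrow> h' (h x) = x" and hh': "x' \<in> C' \<Longrightarrow> h (h' x') = x'"
    and h_add: "x \<in> C \<Longrightarrow> y \<in> C \<Longrightarrow> h (pl x y) = pl' (h x) (h y)"
    and h_mult: "x \<in> C \<Longrightarrow> y \<in> C \<Longrightarrow> h (ml x y) = ml' (h x) (h y)"
    and h_zero: "h z = z'"
    and ideal_C: "left_ideal C pl z ml C" and ideal_C': "left_ideal C' pl' z' ml' C'"
begin

lemma closed: "z \<in> C" "x \<in> C \<Longrightarrow> y \<in> C \<Longrightarrow> pl x y \<in> C" "x \<in> C \<Longrightarrow> y \<in> C \<Longrightarrow> ml x y \<in> C"
  and closed': "z' \<in> C'" "x' \<in> C' \<Longrightarrow> y' \<in> C' \<Longrightarrow> pl' x' y' \<in> C'" "x' \<in> C' \<Longrightarrow> y' \<in> C' \<Longrightarrow> ml' x' y' \<in> C'"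
  using ideal_C ideal_C' by (simp_all add: left_ideal_def)

lemma inverse_iso: "ring_iso C' pl' z' ml' C pl z ml h' h"
proof
  fix x y assume "x \<in> C'" "y \<in> C'"
  thus "h' (pl' x y) = pl (h' x) (h' y)" "h' (ml' x y) = ml (h' x) (h' y)"
    using h_add[of "h' x" "h' y"] h_mult[of "h' x" "h' y"] h'h closed h'_mem hh' by metis+
next
  show "h' z' = z" using h'h[OF closed(1)] h_zero by simp
qed (use h_mem h'_mem h'h hh' ideal_C ideal_C' in auto)

lemma left_ideal_image:
  assumes "left_ideal C pl z ml J"
  shows "left_ideal C' pl' z' ml' (h ` J)"
proof -
  have J: "J \<subseteq> C" "z \<in> J" "\<And>x y. x \<in> J \<Longrightarrow> y \<in> J \<Longrightarrow> pl x y \<in> J"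
    "\<And>x. x \<in> J \<Longrightarrow> \<exists>y\<in>J. pl x y = z" "\<And>r x. r \<in> C \<Longrightarrow> x \<in> J \<Longrightarrow> ml r x \<in> J"
    using assms by (auto simp: left_ideal_def)
  show ?thesis unfolding left_ideal_def
  proof (intro conjI ballI)
    show "h ` J \<subseteq> C'" using J h_mem by auto
    show "z' \<in> h ` J" using J(2) h_zero by (metis imageI)
  next
    fix x y assume "x \<in> h ` J" "y \<in> h ` J"
    then obtain a b where "x = h a" "y = h b" "a \<in> J" "b \<in> J" by auto
    moreover have "a \<in> C" "b \<in> C" using calculation J by auto
    ultimately show "pl' x y \<in> h ` J" using J(3)[of a b] h_add[of a b] by (metis imageI)
  next
    fix x assume "x \<in> h ` J"
    then obtain a where a: "x = h a" "a \<in> J" by auto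
    then obtain b where b: "b \<in> J" "pl a b = z" using J(4) by auto
    hence "pl' x (h b) = z'" using a h_add[OF subsetD[OF J(1)] subsetD[OF J(1)], of a b] h_zero by simp
    thus "\<exists>y\<in>h ` J. pl' x y = z'" using b by auto
  next
    fix r x assume r: "r \<in> C'" and "x \<in> h ` J"
    then obtain a where a: "x = h a" "a \<in> J" by auto
    have "ml' r x = h (ml (h' r) a)" using a r h_mult[OF h'_mem[OF r] subsetD[OF J(1) a(2)]] hh' by simp
    thus "ml' r x \<in> h ` J" using J(5)[of "h' r" a] h'_mem r a by auto
  qed
qed

lemma left_semihereditary_transfer:
  assumes sh: "left_semihereditary C' pl' z' ml'"
  shows "left_semihereditary C pl z ml"
  unfolding left_semihereditary_def
proof (intro allI impI)
  fix I assume "fg_left_ideal C pl z ml I"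
  then obtain X where X: "finite X" "X \<subseteq> C" and I: "I = \<Inter> {J. left_ideal C pl z ml J \<and> X \<subseteq> J}"
    unfolding fg_left_ideal_def by auto
  interpret inv: ring_iso C' pl' z' ml' C pl z ml h' h by (rule inverse_iso)
  have IC: "I \<subseteq> C" unfolding I using ideal_C X by blast
  have "h ` I = \<Inter> {J. left_ideal C' pl' z' ml' J \<and> h ` X \<subseteq> J}"
  proof
    show "h ` I \<subseteq> \<Inter> {J. left_ideal C' pl' z' ml' J \<and> h ` X \<subseteq> J}"
    proof (intro subsetI InterI)
      fix x J assume "x \<in> h ` I" and "J \<in> {J. left_ideal C' pl' z' ml' J \<and> h ` X \<subseteq> J}"
      then obtain a where a: "x = h a" "a \<in> I" and J: "left_ideal C' pl' z' ml' J" "h ` X \<subseteq> J" by auto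
      have "X \<subseteq> h' ` J"
      proof
        fix x assume "x \<in> X"
        thus "x \<in> h' ` J" using J(2) X(2) h'h[of x] by (intro image_eqI[of _ _ "h x"]) auto
      qed
      hence "a \<in> h' ` J" using a inv.left_ideal_image[OF J(1)] unfolding I by blast
      then obtain j where j: "j \<in> J" "a = h' j" by auto
      moreover have "j \<in> C'" using j J by (auto simp: left_ideal_def)
      ultimately show "x \<in> J" using a hh' by simp
    qed
    show "\<Inter> {J. left_ideal C' pl' z' ml' J \<and> h ` X \<subseteq> J} \<subseteq> h ` I"
    proof
      fix x assume x: "x \<in> \<Inter> {J. left_ideal C' pl' z' ml' J \<and> h ` X \<subseteq> J}"
      have "h ` X \<subseteq> C'" using X h_mem by auto
      hence xC: "x \<in> C'" using x ideal_C' by blast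
      have "h' x \<in> J" if "left_ideal C pl z ml J" "X \<subseteq> J" for J
      proof -
        have "x \<in> h ` J" using x left_ideal_image[OF that(1)] that(2) by blast
        then obtain a where "a \<in> J" "x = h a" by auto
        thus ?thesis using h'h[of a] that by (auto simp: left_ideal_def)
      qed
      hence "h' x \<in> I" unfolding I by blast
      thus "x \<in> h ` I" using hh'[OF xC] by (metis imageI)
    qed
  qed
  moreover have "finite (h ` X)" "h ` X \<subseteq> C'" using X h_mem by auto
  ultimately have "fg_left_ideal C' pl' z' ml' (h ` I)" unfolding fg_left_ideal_def by blast
  hence "left_projective C' pl' z' ml' (h ` I)" using sh by (auto simp: left_semihereditary_def)
  then obtain n :: nat and \<iota> \<pi> where data: "projective_data C' pl' z' ml' (h ` I) n \<iota> \<pi>"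
    unfolding left_projective_iff by auto
  note d = projective_dataD[OF data]
  let ?F = "free_mod C z n" and ?F' = "free_mod C' z' n"
  have hF: "(\<lambda>i. h (v i)) \<in> ?F'" if "v \<in> ?F" for v
    using that h_mem h_zero by (auto simp: free_mod_def)
  have \<iota>F: "\<iota> (h x) \<in> ?F'" if "x \<in> I" for x using d(1) that by auto
  have \<iota>C: "\<iota> (h x) i \<in> C'" if "x \<in> I" for x i
    using \<iota>F[OF that] closed'(1) by (cases "i < n") (auto simp: free_mod_def)
  have FC: "v i \<in> C" if "v \<in> ?F" for v i
    using that closed(1) by (cases "i < n") (auto simp: free_mod_def)
  have hIC: "x \<in> C'" if "x \<in> h ` I" for x using that IC h_mem by auto
  have \<pi>C: "\<pi> v \<in> C'" if "v \<in> ?F'" for v using d(4) hIC that by blast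
  have "projective_data C pl z ml I n (\<lambda>x i. h' (\<iota> (h x) i)) (\<lambda>v. h' (\<pi> (\<lambda>i. h (v i))))"
    unfolding projective_data_def
  proof (intro conjI ballI)
    fix x assume x: "x \<in> I"
    show "(\<lambda>i. h' (\<iota> (h x) i)) \<in> ?F"
      using \<iota>F[OF x] h'_mem inv.h_zero by (auto simp: free_mod_def)
    have "(\<lambda>i. h (h' (\<iota> (h x) i))) = \<iota> (h x)" using \<iota>C[OF x] hh' by auto
    thus "h' (\<pi> (\<lambda>i. h (h' (\<iota> (h x) i)))) = x" using d(7) x h'h IC by auto
    fix y assume y: "y \<in> I"
    have "h (pl x y) = pl' (h x) (h y)" using h_add x y IC by auto
    hence "\<iota> (h (pl x y)) = (\<lambda>i. pl' (\<iota> (h x) i) (\<iota> (h y) i))" using d(2) x y by auto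
    thus "(\<lambda>i. h' (\<iota> (h (pl x y)) i)) = (\<lambda>i. pl (h' (\<iota> (h x) i)) (h' (\<iota> (h y) i)))"
      using inv.h_add[OF \<iota>C[OF x] \<iota>C[OF y]] by auto
  next
    fix r x assume r: "r \<in> C" and x: "x \<in> I"
    have "h (ml r x) = ml' (h r) (h x)" using h_mult r x IC by auto
    hence "\<iota> (h (ml r x)) = (\<lambda>i. if i < n then ml' (h r) (\<iota> (h x) i) else z')"
      using d(3) h_mem[OF r] x by auto
    thus "(\<lambda>i. h' (\<iota> (h (ml r x)) i)) = (\<lambda>i. if i < n then ml r (h' (\<iota> (h x) i)) else z)"
      using inv.h_mult[OF h_mem[OF r] \<iota>C[OF x]] h'h[OF r] inv.h_zero by auto
  next
    fix v assume v: "v \<in> ?F"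
    have "\<pi> (\<lambda>i. h (v i)) \<in> h ` I" using d(4) hF[OF v] by auto
    thus "h' (\<pi> (\<lambda>i. h (v i))) \<in> I" using h'h IC by auto
    {
      fix w assume w: "w \<in> ?F"
      have "(\<lambda>i. h (pl (v i) (w i))) = (\<lambda>i. pl' (h (v i)) (h (w i)))"
        using h_add FC[OF v] FC[OF w] by auto
      hence "\<pi> (\<lambda>i. h (pl (v i) (w i))) = pl' (\<pi> (\<lambda>i. h (v i))) (\<pi> (\<lambda>i. h (w i)))"
        using d(5) hF[OF v] hF[OF w] by simp
      thus "h' (\<pi> (\<lambda>i. h (pl (v i) (w i)))) = pl (h' (\<pi> (\<lambda>i. h (v i)))) (h' (\<pi> (\<lambda>i. h (w i))))"
        using inv.h_add[OF \<pi>C[OF hF[OF v]] \<pi>C[OF hF[OF w]]] by simp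
    }
    {
      fix r assume r: "r \<in> C"
      have "(\<lambda>i. h (if i < n then ml r (v i) else z)) = (\<lambda>i. if i < n then ml' (h r) (h (v i)) else z')"
        using h_mult[OF r FC[OF v]] h_zero by auto
      hence "\<pi> (\<lambda>i. h (if i < n then ml r (v i) else z)) = ml' (h r) (\<pi> (\<lambda>i. h (v i)))"
        using d(6) hF[OF v] h_mem[OF r] by simp
      thus "h' (\<pi> (\<lambda>i. h (if i < n then ml r (v i) else z))) = ml r (h' (\<pi> (\<lambda>i. h (v i))))"
        using inv.h_mult[OF h_mem[OF r] \<pi>C[OF hF[OF v]]] h'h[OF r] by simp
    }
  qed
  thus "left_projective C pl z ml I" unfolding left_projective_iff by blast
qed

end

context crossed
begin

text \<open>In the opposite ring put \<open>y_\<sigma> = x_(inv \<sigma>)\<close> and write scalars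
  on the right. The product of \<open>y_\<sigma>\<close> and \<open>y_\<tau>\<close> is
  \<open>x_(inv \<tau>) x_(inv \<sigma>)\<close>, and moving the factor
  \<open>f (inv \<tau>) (inv \<sigma>)\<close> to the right applies
  \<open>\<sigma> \<circ> \<tau>\<close> to it.\<close>

definition f_op :: "('k \<Rightarrow> 'k) \<Rightarrow> ('k \<Rightarrow> 'k) \<Rightarrow> 'k" where
  "f_op \<sigma> \<tau> = (\<sigma> \<circ> \<tau>) (f (inv \<tau>) (inv \<sigma>))"

lemma crossed_op: "crossed G R f_op"
proof
  fix \<sigma> \<tau> assume s: "\<sigma> \<in> G" "\<tau> \<in> G"
  show "f_op \<sigma> \<tau> \<in> R" unfolding f_op_def
    by (rule stable[OF comp_mem[OF s] f_mem[OF inv_mem[OF s(2)] inv_mem[OF s(1)]]])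
  show "f_op \<sigma> \<tau> \<noteq> 0" unfolding f_op_def using s aut_eq_0_iff[OF comp_mem[OF s]] by simp
next
  show "normalized_cocycle G f_op" unfolding normalized_cocycle_def
  proof (intro conjI ballI)
    fix \<sigma> \<tau> \<gamma> assume s: "\<sigma> \<in> G" "\<tau> \<in> G" "\<gamma> \<in> G"
    have "inv \<gamma> (f (inv \<tau>) (inv \<sigma>)) * f (inv \<gamma>) (inv \<tau> \<circ> inv \<sigma>) = f (inv \<gamma>) (inv \<tau>) * f (inv \<gamma> \<circ> inv \<tau>) (inv \<sigma>)"
      using cocycle[of "inv \<gamma>" "inv \<tau>" "inv \<sigma>"] s by simp
    from arg_cong[OF this, of "\<sigma> \<circ> \<tau> \<circ> \<gamma>"]
    show "\<sigma> (f_op \<tau> \<gamma>) * f_op \<sigma> (\<tau> \<circ> \<gamma>) = f_op \<sigma> \<tau> * f_op (\<sigma> \<circ> \<tau>) \<gamma>"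
      unfolding f_op_def using s by (simp add: mult.commute)
  next
    fix \<sigma> assume s: "\<sigma> \<in> G"
    show "f_op id \<sigma> = 1" "f_op \<sigma> id = 1" unfolding f_op_def using s by (auto simp: inv_id)
  qed
qed (rule stable)

text \<open>The coefficients of \<open>a\<close> in the basis \<open>x_(inv \<sigma>)\<close> with
  scalars written on the right.\<close>

definition flip :: "(('k \<Rightarrow> 'k) \<Rightarrow> 'k) \<Rightarrow> ('k \<Rightarrow> 'k) \<Rightarrow> 'k" where
  "flip a = (\<lambda>\<sigma>. if \<sigma> \<in> G then \<sigma> (a (inv \<sigma>)) else 0)"

lemma left_ideal_carrier: "left_ideal C cp_add cp_zero (cp_mult G f) C"
  unfolding left_ideal_def
proof (intro conjI ballI)
  fix x assume "x \<in> C"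
  hence "(\<lambda>\<rho>. - x \<rho>) \<in> C" "cp_add x (\<lambda>\<rho>. - x \<rho>) = cp_zero"
    by (auto simp: cp_carrier_def cp_add_def cp_zero_def)
  thus "\<exists>y\<in>C. cp_add x y = cp_zero" by blast
next
  fix r x assume "r \<in> C" "x \<in> C"
  thus "r \<star> x \<in> C" by (rule mult_closed)
qed (auto simp: cp_carrier_def cp_add_def cp_zero_def)

lemma ring_iso_op:
  "ring_iso C cp_add cp_zero (\<lambda>x y. cp_mult G f y x) C cp_add cp_zero (cp_mult G f_op) flip flip"
proof -
  interpret op: crossed G R f_op by (rule crossed_op)
  have mem: "flip x \<in> C" if "x \<in> C" for x
    using that by (auto simp: flip_def cp_carrier_def intro: stable)
  have flip2: "flip (flip x) = x" if "x \<in> C" for x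
    using that by (auto simp: flip_def cp_carrier_def fun_eq_iff)
  show ?thesis
  proof
    fix x y assume "x \<in> C" "y \<in> C"
    show "flip (cp_add x y) = cp_add (flip x) (flip y)"
      by (auto simp: flip_def cp_add_def fun_eq_iff)
    show "flip (y \<star> x) = cp_mult G f_op (flip x) (flip y)"
    proof
      fix \<rho>
      show "flip (y \<star> x) \<rho> = cp_mult G f_op (flip x) (flip y) \<rho>"
      proof (cases "\<rho> \<in> G")
        case True
        have "flip (y \<star> x) \<rho> = (\<Sum>\<sigma>\<in>G. \<rho> (y \<sigma>) * (\<rho> (\<sigma> (x (inv \<sigma> \<circ> inv \<rho>))) * \<rho> (f \<sigma> (inv \<sigma> \<circ> inv \<rho>))))"
          using True by (simp add: flip_def mult_act act_def)
        also have "\<dots> = (\<Sum>\<sigma>\<in>G. flip x (\<rho> \<circ> \<sigma>) * op.act (\<rho> \<circ> \<sigma>) (flip y) \<rho>)"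
        proof (rule sum.cong[OF refl])
          fix \<sigma> assume s: "\<sigma> \<in> G"
          have "op.act (\<rho> \<circ> \<sigma>) (flip y) \<rho> = (\<rho> \<circ> \<sigma>) (inv \<sigma> (y \<sigma>)) * f_op (\<rho> \<circ> \<sigma>) (inv \<sigma>)"
            using True s by (simp add: op.act_def flip_def o_assoc[symmetric])
          also have "\<dots> = \<rho> (y \<sigma>) * \<rho> (f \<sigma> (inv \<sigma> \<circ> inv \<rho>))"
            using True s by (simp add: f_op_def o_assoc[symmetric])
          finally show "\<rho> (y \<sigma>) * (\<rho> (\<sigma> (x (inv \<sigma> \<circ> inv \<rho>))) * \<rho> (f \<sigma> (inv \<sigma> \<circ> inv \<rho>)))
            = flip x (\<rho> \<circ> \<sigma>) * op.act (\<rho> \<circ> \<sigma>) (flip y) \<rho>"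
            using True s by (simp add: flip_def mult_ac)
        qed
        also have "\<dots> = (\<Sum>\<sigma>\<in>G. flip x \<sigma> * op.act \<sigma> (flip y) \<rho>)"
          using sum_left_shift[OF True, of "\<lambda>\<sigma>. flip x \<sigma> * op.act \<sigma> (flip y) \<rho>"] .
        finally show ?thesis by (simp add: op.mult_act)
      qed (simp add: flip_def op.mult_outside)
    qed
  next
    show "flip cp_zero = cp_zero" by (auto simp: flip_def cp_zero_def fun_eq_iff)
    show "left_ideal C cp_add cp_zero (cp_mult G f_op) C" by (rule op.left_ideal_carrier)
    show "left_ideal C cp_add cp_zero (\<lambda>x y. y \<star> x) C"
      using left_ideal_carrier mult_closed by (auto simp: left_ideal_def)
  qed (use mem flip2 in auto)
qed

text \<open>The opposite cocycle satisfies the same hypotheses, since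
  \<open>f_op \<sigma> (inv \<sigma>) = f \<sigma> (inv \<sigma>)\<close> and only \<open>sq\<close>
  mentions the cocycle.\<close>

theorem semihereditary_criterion:
  assumes finmax: "finite {N. maximal_ideal_in R N}"
    and val: "\<And>N z. maximal_ideal_in R N \<Longrightarrow> z \<noteq> 0 \<Longrightarrow> z \<in> localization R N \<or> inverse z \<in> localization R N"
    and sq: "\<And>N \<sigma>. maximal_ideal_in R N \<Longrightarrow> \<sigma> \<in> G \<Longrightarrow> f \<sigma> (inv \<sigma>) \<notin> ideal_prod N N"
    and M: "maximal_ideal_in R M"
    and t0: "t0 \<in> R" "\<And>c. c \<in> R \<Longrightarrow> c - 1 \<in> M \<Longrightarrow>
      (\<And>N. maximal_ideal_in R N \<Longrightarrow> N \<noteq> M \<Longrightarrow> c \<in> N) \<Longrightarrow> (\<Sum>\<sigma>\<in>G. \<sigma> (t0 * c)) \<notin> M"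
    and unit: "\<And>\<theta>. \<theta> \<in> R \<Longrightarrow> (\<And>\<sigma>. \<sigma> \<in> G \<Longrightarrow> \<sigma> \<theta> = \<theta>) \<Longrightarrow> \<theta> \<notin> M \<Longrightarrow> inverse \<theta> \<in> R"
  shows "crossed_product_semihereditary R G f"
proof -
  interpret op: crossed G R f_op by (rule crossed_op)
  interpret iso: ring_iso C cp_add cp_zero "\<lambda>x y. y \<star> x" C cp_add cp_zero "cp_mult G f_op" flip flip
    by (rule ring_iso_op)
  have sq': "f_op \<sigma> (inv \<sigma>) \<notin> ideal_prod N N" if "maximal_ideal_in R N" "\<sigma> \<in> G" for N \<sigma>
    using sq[OF that] that by (simp add: f_op_def)
  have "left_semihereditary C cp_add cp_zero (cp_mult G f)"
    by (rule left_semihereditary_criterion[OF finmax val sq M t0 unit])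
  moreover have "left_semihereditary C cp_add cp_zero (cp_mult G f_op)"
    by (rule op.left_semihereditary_criterion[OF finmax val sq' M t0 unit])
  hence "left_semihereditary C cp_add cp_zero (\<lambda>x y. y \<star> x)" by (rule iso.left_semihereditary_transfer)
  ultimately show ?thesis unfolding crossed_product_semihereditary_def semihereditary_def by blast
qed

end

section \<open>Integral elements\<close>

text \<open>Leibniz expansion: the polynomials with coefficients in \<open>V\<close> are closed
  under sums and products and contain the entries of the characteristic matrix.\<close>

lemma coeff_char_poly_mem:
  assumes V: "is_subring V" and A: "A \<in> carrier_mat n n" 
    and ent: "\<And>i j. i < n \<Longrightarrow> j < n \<Longrightarrow> A $$ (i, j) \<in> V"
  shows "coeff (char_poly A) k \<in> V"
proof -
  interpret subring_field V using V by unfold_locales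
  define P where "P = {p. \<forall>i. coeff p i \<in> V}"
  have add: "p + q \<in> P" if "p \<in> P" "q \<in> P" for p q using that by (auto simp: P_def)
  have mult: "p * q \<in> P" if "p \<in> P" "q \<in> P" for p q
    using that by (auto simp: P_def coeff_mult intro!: sum_mem mult_mem)
  have sum: "(\<Sum>i\<in>X. g i) \<in> P" if "\<And>i. i \<in> X \<Longrightarrow> g i \<in> P" for X :: "'c set" and g
    using that by (auto simp: P_def coeff_sum)
  have one: "1 \<in> P" by (auto simp: P_def coeff_1)
  have prod: "(\<Prod>i\<in>X. g i) \<in> P" if "\<And>i. i \<in> X \<Longrightarrow> g i \<in> P" for X :: "nat set" and g
    using that by (induction X rule: infinite_finite_induct) (auto intro: one mult)
  have uminus: "- p \<in> P" if "p \<in> P" for p using that by (auto simp: P_def)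
  have ent': "char_poly_matrix A $$ (i, j) \<in> P" if "i < n" "j < n" for i j
  proof -
    have "char_poly_matrix A $$ (i, j) = (if i = j then [:0, 1:] else 0) + [:- (A $$ (i, j)):]"
      using that A by (auto simp: char_poly_matrix_def)
    also have "\<dots> \<in> P"
      using ent[OF that] by (intro add) (auto simp: P_def coeff_pCons split: nat.split)
    finally show ?thesis .
  qed
  have "char_poly A = (\<Sum>p\<in>{p. p permutes {0..<n}}. signof p * (\<Prod>i = 0..<n. char_poly_matrix A $$ (i, p i)))"
    unfolding char_poly_def by (rule det_def') (use A in simp)
  also have "\<dots> \<in> P"
  proof (rule sum, rule mult, goal_cases)
    case (1 p)
    show ?case unfolding sign_def using one uminus[OF one] by auto
  next
    case (2 p)
    hence "p i < n" if "i < n" for i using permutes_in_image[of p "{0..<n}" i] that by auto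
    thus ?case by (intro prod ent') auto
  qed
  finally show ?thesis by (auto simp: P_def)
qed

definition vspan :: "'k::field set \<Rightarrow> 'k set \<Rightarrow> 'k set" where
  "vspan V B = {(\<Sum>b\<in>B. c b * b) | c. \<forall>b\<in>B. c b \<in> V}"

context subring_field
begin

lemma vspan_ideal_like:
  shows vspan_zero: "0 \<in> vspan R B"
    and vspan_add: "x \<in> vspan R B \<Longrightarrow> y \<in> vspan R B \<Longrightarrow> x + y \<in> vspan R B"
    and vspan_scale: "r \<in> R \<Longrightarrow> x \<in> vspan R B \<Longrightarrow> r * x \<in> vspan R B"
proof -
  show "0 \<in> vspan R B" unfolding vspan_def by (rule CollectI, rule exI[of _ "\<lambda>_. 0"]) auto
next
  assume "x \<in> vspan R B" "y \<in> vspan R B"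
  then obtain c d where "x = (\<Sum>b\<in>B. c b * b)" "y = (\<Sum>b\<in>B. d b * b)" "\<forall>b\<in>B. c b \<in> R" "\<forall>b\<in>B. d b \<in> R"
    unfolding vspan_def by auto
  thus "x + y \<in> vspan R B" unfolding vspan_def
    by (intro CollectI exI[of _ "\<lambda>b. c b + d b"]) (auto simp: sum.distrib distrib_right)
next
  assume r: "r \<in> R" and "x \<in> vspan R B"
  then obtain c where "x = (\<Sum>b\<in>B. c b * b)" "\<forall>b\<in>B. c b \<in> R" unfolding vspan_def by auto
  thus "r * x \<in> vspan R B" unfolding vspan_def using r
    by (intro CollectI exI[of _ "\<lambda>b. r * c b"]) (auto simp: sum_distrib_left mult.assoc)
qed

lemma vspan_sum: "(\<And>i. i \<in> X \<Longrightarrow> g i \<in> vspan R B) \<Longrightarrow> (\<Sum>i\<in>X. g i) \<in> vspan R B"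
  by (induction X rule: infinite_finite_induct) (auto intro: vspan_zero vspan_add)

lemma vspan_base:
  assumes "finite B" "b \<in> B"
  shows "b \<in> vspan R B"
proof -
  have "(\<Sum>a\<in>B. (if a = b then 1 else 0) * a) = (\<Sum>a\<in>B. if a = b then a else 0)"
    by (rule sum.cong) auto
  hence "b = (\<Sum>a\<in>B. (if a = b then 1 else 0) * a)" using assms by simp
  thus ?thesis unfolding vspan_def by (intro CollectI exI[of _ "\<lambda>a. if a = b then 1 else 0"]) auto
qed

lemma vspan_stable:
  assumes B: "\<And>b. b \<in> B \<Longrightarrow> x * b \<in> vspan R B" and s: "s \<in> vspan R B"
  shows "x * s \<in> vspan R B"
proof -
  obtain c where c: "s = (\<Sum>b\<in>B. c b * b)" "\<forall>b\<in>B. c b \<in> R" using s unfolding vspan_def by auto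
  have "x * s = (\<Sum>b\<in>B. c b * (x * b))" using c by (simp add: sum_distrib_left mult_ac)
  also have "\<dots> \<in> vspan R B" using c by (intro vspan_sum vspan_scale B) auto
  finally show ?thesis .
qed

text \<open>Determinant trick: the vector of generators is nonzero and is an eigenvector, with
  eigenvalue \<open>x\<close>, of a matrix over \<open>R\<close>; so \<open>x\<close> is a root of a
  monic characteristic polynomial over \<open>R\<close>.\<close>

lemma integral_of_vspan:
  assumes B: "finite B" "b0 \<in> B" "b0 \<noteq> 0" and st: "\<And>b. b \<in> B \<Longrightarrow> x * b \<in> vspan R B"
  shows "x \<in> integral_closure R"
proof -
  define n where "n = card B"
  obtain e where e: "bij_betw e {0..<n} B" using ex_bij_betw_nat_finite[OF B(1)] unfolding n_def by auto
  have "\<exists>c. x * b = (\<Sum>a\<in>B. c a * a) \<and> (\<forall>a\<in>B. c a \<in> R)" if "b \<in> B" for b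
    using st[OF that] unfolding vspan_def by auto
  then obtain c where c: "\<And>b. b \<in> B \<Longrightarrow> x * b = (\<Sum>a\<in>B. c b a * a) \<and> (\<forall>a\<in>B. c b a \<in> R)" by metis
  define A where "A = mat n n (\<lambda>(i, j). c (e i) (e j))"
  define v where "v = vec n e"
  have A: "A \<in> carrier_mat n n" and v: "v \<in> carrier_vec n" by (auto simp: A_def v_def)
  have eB: "e i \<in> B" if "i < n" for i using e that by (auto simp: bij_betw_def)
  have "A *\<^sub>v v = x \<cdot>\<^sub>v v"
  proof (rule eq_vecI)
    fix i assume "i < dim_vec (x \<cdot>\<^sub>v v)"
    hence i: "i < n" by (simp add: v_def)
    have "(A *\<^sub>v v) $ i = (\<Sum>j = 0..<n. c (e i) (e j) * e j)"
      using i by (simp add: A_def v_def scalar_prod_def)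
    also have "\<dots> = (\<Sum>a\<in>B. c (e i) a * a)"
      by (rule sum.reindex_bij_betw[OF e])
    also have "\<dots> = x * e i" using c[OF eB[OF i]] by simp
    finally show "(A *\<^sub>v v) $ i = (x \<cdot>\<^sub>v v) $ i" using i by (simp add: v_def)
  qed (simp add: A_def v_def)
  moreover have "v \<noteq> 0\<^sub>v n"
  proof
    assume v0: "v = 0\<^sub>v n"
    obtain i where i: "i < n" "e i = b0" using e B(2) by (auto simp: bij_betw_def image_iff)
    have "v $ i = 0" using v0 i by simp
    thus False using i B(3) by (simp add: v_def)
  qed
  ultimately have "eigenvalue A x" using v A unfolding eigenvalue_def eigenvector_def by auto
  hence "poly (char_poly A) x = 0" using eigenvalue_root_char_poly[OF A] by simp
  moreover have "lead_coeff (char_poly A) = 1" using degree_monic_char_poly[OF A] by simp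
  moreover have "coeff (char_poly A) k \<in> R" for k
    by (rule coeff_char_poly_mem[OF subring A]) (use c eB in \<open>auto simp: A_def\<close>)
  ultimately show ?thesis unfolding integral_closure_def by blast
qed

lemma integral_relation:
  fixes x :: 'k
  assumes p: "lead_coeff p = 1" "poly p x = 0"
  obtains "degree p > 0" "x ^ degree p = (\<Sum>i<degree p. - coeff p i * x ^ i)"
proof -
  have d: "degree p > 0"
  proof (rule ccontr)
    assume "\<not> degree p > 0"
    then obtain a where "p = [:a:]" using degree_eq_zeroE by auto
    thus False using p by simp
  qed
  have "0 = (\<Sum>i\<le>degree p. coeff p i * x ^ i)" using p by (simp add: poly_altdef)
  also have "\<dots> = x ^ degree p + (\<Sum>i<degree p. coeff p i * x ^ i)"
    using p by (simp add: lessThan_Suc_atMost[symmetric])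
  finally have "x ^ degree p = (\<Sum>i<degree p. - coeff p i * x ^ i)"
    by (simp add: sum_negf eq_neg_iff_add_eq_0)
  thus thesis using d that by blast
qed

text \<open>The monomials \<open>x ^ i * y ^ j\<close> below the two degrees span a module stable
  under \<open>x\<close> and \<open>y\<close>, hence under their sum and product.\<close>

lemma integral_closure_add_mult:
  assumes x: "x \<in> integral_closure R" and y: "y \<in> integral_closure R"
  shows "x + y \<in> integral_closure R" "x * y \<in> integral_closure R"
proof -
  obtain p where p: "lead_coeff p = 1" "\<And>i. coeff p i \<in> R" "poly p x = 0"
    using x by (auto simp: integral_closure_def)
  obtain q where q: "lead_coeff q = 1" "\<And>i. coeff q i \<in> R" "poly q y = 0"
    using y by (auto simp: integral_closure_def)
  define d e where "d = degree p" and "e = degree q"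
  have d: "d > 0" "x ^ d = (\<Sum>i<d. - coeff p i * x ^ i)"
    using integral_relation[OF p(1,3)] unfolding d_def by blast+
  have e: "e > 0" "y ^ e = (\<Sum>i<e. - coeff q i * y ^ i)"
    using integral_relation[OF q(1,3)] unfolding e_def by blast+
  define B where "B = (\<lambda>(i, j). x ^ i * y ^ j) ` ({..<d} \<times> {..<e})"
  have B: "finite B" by (simp add: B_def)
  have base: "x ^ i * y ^ j \<in> vspan R B" if "i < d" "j < e" for i j
    using that by (intro vspan_base[OF B]) (auto simp: B_def)
  have xB: "x * b \<in> vspan R B" if bB: "b \<in> B" for b
  proof -
    obtain i j where ij: "i < d" "j < e" "b = x ^ i * y ^ j" using bB by (auto simp: B_def)
    show ?thesis
    proof (cases "Suc i < d")
      case True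
      thus ?thesis using base[of "Suc i" j] ij by (simp add: mult_ac)
    next
      case False
      hence "Suc i = d" using ij by simp
      hence "x * b = x ^ d * y ^ j" using ij by (auto simp: mult_ac)
      also have "\<dots> = (\<Sum>l<d. - coeff p l * (x ^ l * y ^ j))"
        unfolding d(2) by (simp add: sum_distrib_right mult.assoc)
      also have "\<dots> \<in> vspan R B" using p ij by (intro vspan_sum vspan_scale base uminus_mem) auto
      finally show ?thesis .
    qed
  qed
  have yB: "y * b \<in> vspan R B" if bB: "b \<in> B" for b
  proof -
    obtain i j where ij: "i < d" "j < e" "b = x ^ i * y ^ j" using bB by (auto simp: B_def)
    show ?thesis
    proof (cases "Suc j < e")
      case True
      thus ?thesis using base[of i "Suc j"] ij by (simp add: mult_ac)
    next
      case False
      hence "Suc j = e" using ij by simp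
      hence "y * b = x ^ i * y ^ e" using ij by (auto simp: mult_ac)
      also have "\<dots> = (\<Sum>l<e. - coeff q l * (x ^ i * y ^ l))"
        unfolding e(2) by (simp add: sum_distrib_left mult_ac)
      also have "\<dots> \<in> vspan R B" using q ij by (intro vspan_sum vspan_scale base uminus_mem) auto
      finally show ?thesis .
    qed
  qed
  have one: "1 \<in> B" unfolding B_def using d e by (intro image_eqI[of _ _ "(0, 0)"]) auto
  show "x + y \<in> integral_closure R"
    by (rule integral_of_vspan[OF B one]) (use xB yB in \<open>auto simp: distrib_right intro: vspan_add\<close>)
  show "x * y \<in> integral_closure R"
    by (rule integral_of_vspan[OF B one]) (use vspan_stable[OF xB yB] in \<open>auto simp: mult.assoc\<close>)
qed

lemma sub_integral_closure: "x \<in> R \<Longrightarrow> x \<in> integral_closure R"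
  unfolding integral_closure_def
  by (intro CollectI exI[of _ "[:- x, 1:]"]) (auto simp: coeff_pCons split: nat.split)

lemma subring_integral_closure: "is_subring (integral_closure R)"
  unfolding is_subring_def
proof (intro conjI ballI)
  fix x y assume x: "x \<in> integral_closure R" and y: "y \<in> integral_closure R"
  show "x + y \<in> integral_closure R" "x * y \<in> integral_closure R"
    using integral_closure_add_mult[OF x y] .
  have "(- 1) * x \<in> integral_closure R"
    using integral_closure_add_mult(2)[OF sub_integral_closure[of "- 1"] x] by auto
  thus "- x \<in> integral_closure R" by simp
qed (auto intro: sub_integral_closure)

text \<open>Dividing the monic equation by \<open>x ^ (degree p - 1)\<close> writes \<open>x\<close>
  as a polynomial in \<open>inverse x\<close> over \<open>R\<close>. This is why valuation rings are
  integrally closed.\<close>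

lemma integral_inverse_mem:
  assumes "lead_coeff p = 1" "\<And>i. coeff p i \<in> R" "poly p x = 0" "inverse x \<in> R"
  shows "x \<in> R"
proof (cases "x = 0")
  case False
  let ?d = "degree p"
  obtain d: "?d > 0" "x ^ ?d = (\<Sum>i<?d. - coeff p i * x ^ i)" by (rule integral_relation[OF assms(1,3)])
  have "x = x ^ ?d * inverse x ^ (?d - 1)"
    using False d(1) by (cases ?d) (simp_all add: field_simps)
  also have "\<dots> = (\<Sum>i<?d. - coeff p i * (x ^ i * inverse x ^ (?d - 1)))"
    unfolding d(2) by (simp add: sum_distrib_right mult.assoc)
  also have "\<dots> = (\<Sum>i<?d. - coeff p i * inverse x ^ (?d - 1 - i))"
  proof (rule sum.cong[OF refl])
    fix i assume "i \<in> {..<?d}"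
    hence "?d - 1 = i + (?d - 1 - i)" by simp
    hence "inverse x ^ (?d - 1) = inverse x ^ i * inverse x ^ (?d - 1 - i)" by (metis power_add)
    hence "x ^ i * inverse x ^ (?d - 1) = inverse x ^ (?d - 1 - i)" using False by (simp add: power_inverse)
    thus "- coeff p i * (x ^ i * inverse x ^ (?d - 1)) = - coeff p i * inverse x ^ (?d - 1 - i)" by simp
  qed
  also have "\<dots> \<in> R" using assms by (intro sum_mem mult_mem uminus_mem power_mem)
  finally show ?thesis .
qed auto

text \<open>Products of generators of the closure with powers of \<open>x\<close> span a module over
  \<open>R\<close> itself that is stable under \<open>x\<close>; finite generation avoids adjoining
  the coefficients of \<open>p\<close> first.\<close>

lemma integrally_closed_of_fg:
  assumes fg: "fg_module R (integral_closure R)"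
    and p: "lead_coeff p = 1" "\<And>i. coeff p i \<in> integral_closure R" "poly p x = 0"
  shows "x \<in> integral_closure R"
proof -
  interpret S: subring_field "integral_closure R" using subring_integral_closure by unfold_locales
  obtain B0 where B0': "finite B0" "B0 \<subseteq> integral_closure R"
    "\<forall>s\<in>integral_closure R. \<exists>c. (\<forall>b\<in>B0. c b \<in> R) \<and> s = (\<Sum>b\<in>B0. c b * b)"
    using fg unfolding fg_module_def by (elim exE conjE)
  have "s \<in> vspan R B0" if "s \<in> integral_closure R" for s
    using bspec[OF B0'(3) that] unfolding vspan_def by auto
  hence B0: "finite B0" "B0 \<subseteq> integral_closure R" "integral_closure R \<subseteq> vspan R B0" using B0' by auto
  let ?d = "degree p"
  obtain d: "?d > 0" "x ^ ?d = (\<Sum>i<?d. - coeff p i * x ^ i)" by (rule integral_relation[OF p(1,3)])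
  define B where "B = (\<lambda>(b, i). b * x ^ i) ` (B0 \<times> {..<?d})"
  have B: "finite B" using B0 by (simp add: B_def)
  have base: "s * x ^ i \<in> vspan R B" if s: "s \<in> integral_closure R" and i: "i < ?d" for s i
  proof -
    obtain c where c: "s = (\<Sum>b\<in>B0. c b * b)" "\<forall>b\<in>B0. c b \<in> R" using B0'(3) s by auto
    have "s * x ^ i = (\<Sum>b\<in>B0. c b * (b * x ^ i))" unfolding c by (simp add: sum_distrib_right mult.assoc)
    also have "\<dots> \<in> vspan R B"
      using c i by (intro vspan_sum vspan_scale vspan_base[OF B]) (auto simp: B_def)
    finally show ?thesis .
  qed
  have "x * b \<in> vspan R B" if bB: "b \<in> B" for b
  proof -
    obtain b' i where bi: "b' \<in> B0" "i < ?d" "b = b' * x ^ i" using bB by (auto simp: B_def)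
    have b': "b' \<in> integral_closure R" using bi B0 by auto
    show ?thesis
    proof (cases "Suc i < ?d")
      case True
      thus ?thesis using base[OF b' True] bi by (simp add: mult_ac)
    next
      case False
      hence "Suc i = ?d" using bi by simp
      hence "x * b = b' * x ^ ?d" using bi by (metis mult.left_commute power_Suc)
      also have "\<dots> = (\<Sum>l<?d. (b' * - coeff p l) * x ^ l)"
        unfolding d(2) by (simp add: sum_distrib_left mult.assoc)
      also have "\<dots> \<in> vspan R B" using p b' by (intro vspan_sum base S.mult_mem S.uminus_mem) auto
      finally show ?thesis .
    qed
  qed
  moreover obtain b0 where "b0 \<in> B0" "b0 \<noteq> 0"
  proof (rule ccontr)
    assume "\<not> thesis"
    hence "\<forall>b\<in>B0. b = 0" using that by blast
    hence "vspan R B0 \<subseteq> {0}" unfolding vspan_def by (auto intro!: sum.neutral)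
    hence "(1 :: 'k) \<in> {0}" using subsetD[OF B0(3) S.one_mem] by blast
    thus False by simp
  qed
  hence "b0 * x ^ 0 \<in> B" "b0 * x ^ 0 \<noteq> 0" using d(1) unfolding B_def by force+
  ultimately show ?thesis using integral_of_vspan[OF B] by blast
qed

end

section \<open>The integral closure of a valuation domain in a finite Galois extension\<close>

lemma field_aut_sum: "field_aut \<sigma> \<Longrightarrow> \<sigma> (\<Sum>i\<in>A. g i) = (\<Sum>i\<in>A. \<sigma> (g i))"
  by (induction A rule: infinite_finite_induct) (auto simp: field_aut_zero field_aut_def)

lemma field_aut_power: "field_aut \<sigma> \<Longrightarrow> \<sigma> (x ^ n) = \<sigma> x ^ n"
  by (induction n) (auto simp: field_aut_def)

lemma field_aut_poly:
  assumes "field_aut \<sigma>" "\<And>i. \<sigma> (coeff p i) = coeff p i"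
  shows "\<sigma> (poly p x) = poly p (\<sigma> x)"
proof -
  have "\<sigma> (coeff p i * x ^ i) = coeff p i * \<sigma> x ^ i" for i
    using assms field_aut_power[OF assms(1)] by (auto simp: field_aut_def)
  thus ?thesis unfolding poly_altdef by (simp only: field_aut_sum[OF assms(1)])
qed

locale val_ext =
  fixes V :: "'k::field set" and G :: "('k \<Rightarrow> 'k) set"
  assumes valuation: "valuation_domain V"
    and galois: "finite_galois (frac_field V) G"
    and fg: "fg_module V (integral_closure V)"
begin

abbreviation "F \<equiv> frac_field V"
abbreviation "S \<equiv> integral_closure V"

sublocale V: subring_field V
  using valuation by unfold_locales (simp add: valuation_domain_def)

sublocale S: subring_field S
  using V.subring_integral_closure by unfold_locales

lemma V_sub_F: "x \<in> V \<Longrightarrow> x \<in> F"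
  unfolding frac_field_def by (intro CollectI exI[of _ x] exI[of _ 1]) auto

lemma subring_F: "is_subring F"
  unfolding is_subring_def
proof (intro conjI ballI)
  fix x y assume "x \<in> F" "y \<in> F"
  then obtain a b c d where *: "x = a / b" "a \<in> V" "b \<in> V" "b \<noteq> 0" "y = c / d" "c \<in> V" "d \<in> V" "d \<noteq> 0"
    unfolding frac_field_def by blast
  have "x + y = (a * d + c * b) / (b * d)" "x * y = (a * c) / (b * d)" "- x = (- a) / b"
    using * by (auto simp: field_simps)
  moreover have "a * d + c * b \<in> V" "b * d \<in> V" "a * c \<in> V" "- a \<in> V" "b * d \<noteq> 0" using * by auto
  ultimately show "x + y \<in> F" "x * y \<in> F" "- x \<in> F" unfolding frac_field_def using * by blast+
qed (auto intro: V_sub_F)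

sublocale F: subring_field F
  using subring_F by unfold_locales

lemma F_inverse: "x \<in> F \<Longrightarrow> inverse x \<in> F"
proof -
  assume "x \<in> F"
  then obtain a b where *: "x = a / b" "a \<in> V" "b \<in> V" "b \<noteq> 0" unfolding frac_field_def by blast
  show ?thesis
  proof (cases "a = 0")
    case False
    have "inverse x = b / a" using * by simp
    thus ?thesis unfolding frac_field_def using * False by blast
  qed (use * in auto)
qed

lemma F_divide: "x \<in> F \<Longrightarrow> y \<in> F \<Longrightarrow> x / y \<in> F"
  using F_inverse[of y] by (auto simp: divide_inverse)

lemma V_val: "x \<in> F \<Longrightarrow> x \<in> V \<or> inverse x \<in> V"
  using valuation by (cases "x = 0") (auto simp: valuation_domain_def)

text \<open>The non-units of \<open>V\<close>; 0 is listed separately because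
  \<open>inverse 0\<close> is 0, which lies in \<open>V\<close>.\<close>

definition JV :: "'k set" where
  "JV = {x \<in> V. x = 0 \<or> inverse x \<notin> V}"

sublocale VJ: local_subring V JV
proof
  have mult: "r * x \<in> JV" if "r \<in> V" "x \<in> JV" for r x
  proof (cases "r * x = 0")
    case False
    have "inverse (r * x) \<notin> V"
    proof
      assume "inverse (r * x) \<in> V"
      hence "r * inverse (r * x) \<in> V" using that by auto
      moreover have "r * inverse (r * x) = inverse x" using False by (simp add: field_simps)
      ultimately have "inverse x \<in> V" by (simp only:)
      thus False using that False by (auto simp: JV_def)
    qed
    thus ?thesis using that by (auto simp: JV_def)
  qed (use that in \<open>auto simp: JV_def\<close>)
  have add: "x + y \<in> JV" if x: "x \<in> JV" and y: "y \<in> JV" and xy: "x / y \<in> V" "y \<noteq> 0" for x y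
  proof -
    have "x + y = (x / y + 1) * y" using xy by (simp add: field_simps)
    thus ?thesis using mult[of "x / y + 1" y] xy y by auto
  qed
  show "ideal_in V JV" unfolding ideal_in_def
  proof (intro conjI ballI)
    fix x y assume x: "x \<in> JV" and y: "y \<in> JV"
    show "x + y \<in> JV"
    proof (cases "x = 0 \<or> y = 0")
      case False
      have "x \<in> F" "y \<in> F" using x y V_sub_F by (auto simp: JV_def)
      hence "x / y \<in> V \<or> y / x \<in> V" using V_val[OF F_divide[of x y]] by auto
      thus ?thesis using add[OF x y] add[OF y x] False by (auto simp: add.commute)
    qed (use x y in auto)
  next
    fix r x assume "r \<in> V" "x \<in> JV"
    thus "r * x \<in> JV" by (rule mult)
  qed (auto simp: JV_def)
  show "1 \<notin> JV" by (simp add: JV_def)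
qed (auto simp: JV_def)

lemma G_eq: "G = aut_group F" and fixed_F: "fixed_field G = F"
  using galois by (auto simp: finite_galois_def)

lemma fixedI: "(\<And>\<sigma>. \<sigma> \<in> G \<Longrightarrow> \<sigma> x = x) \<Longrightarrow> x \<in> F"
  using fixed_F by (auto simp: fixed_field_def)

lemma fixedD: "x \<in> F \<Longrightarrow> \<sigma> \<in> G \<Longrightarrow> \<sigma> x = x"
  using G_eq by (auto simp: aut_group_def)

lemma G_aut: "\<sigma> \<in> G \<Longrightarrow> field_aut \<sigma>"
  using G_eq by (auto simp: aut_group_def)

lemma ex_basis:
  obtains n and b :: "nat \<Rightarrow> 'k" where "\<forall>x. \<exists>c. (\<forall>i<n. c i \<in> F) \<and> x = (\<Sum>i<n. c i * b i)"
proof -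
  obtain n where "has_degree F n" using galois by (auto simp: finite_galois_def)
  then obtain b :: "nat \<Rightarrow> 'k" where "\<forall>x. \<exists>c. (\<forall>i<n. c i \<in> F) \<and> x = (\<Sum>i<n. c i * b i)"
    unfolding has_degree_def by (elim exE conjE)
  thus thesis by (rule that)
qed

text \<open>\<open>K\<close> is itself a finitely spanned \<open>F\<close>-module, stable under
  multiplication by any \<open>x\<close>.\<close>

lemma algebraic: "x \<in> integral_closure F"
proof -
  obtain n and b :: "nat \<Rightarrow> 'k" where b: "\<forall>x. \<exists>c. (\<forall>i<n. c i \<in> F) \<and> x = (\<Sum>i<n. c i * b i)"
    by (rule ex_basis)
  let ?B = "b ` {..<n}"
  have span: "y \<in> vspan F ?B" for y
  proof -
    obtain c where c: "\<forall>i<n. c i \<in> F" "y = (\<Sum>i<n. c i * b i)" using b by blast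
    show ?thesis unfolding c(2)
      using c(1) by (intro F.vspan_sum F.vspan_scale F.vspan_base) auto
  qed
  have "\<exists>b0\<in>?B. b0 \<noteq> 0"
  proof (rule ccontr)
    assume "\<not> ?thesis"
    hence "vspan F ?B \<subseteq> {0}" unfolding vspan_def by (auto intro!: sum.neutral)
    thus False using span[of 1] by auto
  qed
  then obtain b0 where "b0 \<in> ?B" "b0 \<noteq> 0" by blast
  thus ?thesis using F.integral_of_vspan[of ?B b0 x] span by blast
qed

text \<open>An automorphism is determined by its values on a finite spanning set, and each value is
  a root of a nonzero polynomial over \<open>F\<close> fixed in advance.\<close>

lemma finite_G: "finite G"
proof -
  obtain n and b :: "nat \<Rightarrow> 'k" where b: "\<forall>x. \<exists>c. (\<forall>i<n. c i \<in> F) \<and> x = (\<Sum>i<n. c i * b i)"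
    by (rule ex_basis)
  have "\<exists>p. p \<noteq> 0 \<and> (\<forall>i. coeff p i \<in> F) \<and> poly p x = 0" for x
  proof -
    obtain p where p: "lead_coeff p = 1" "\<And>i. coeff p i \<in> F" "poly p x = 0"
      using algebraic[of x] by (auto simp: integral_closure_def)
    have "p \<noteq> 0" using p(1) by auto
    thus ?thesis using p by blast
  qed
  then obtain p where p: "\<And>x. p x \<noteq> 0 \<and> (\<forall>i. coeff (p x) i \<in> F) \<and> poly (p x) x = 0" by metis
  let ?P = "PiE {..<n} (\<lambda>i. {z. poly (p (b i)) z = 0})"
  have "finite ?P" using p poly_roots_finite by (intro finite_PiE) auto
  moreover have "(\<lambda>\<sigma>. restrict (\<lambda>i. \<sigma> (b i)) {..<n}) ` G \<subseteq> ?P"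
  proof (intro image_subsetI)
    fix \<sigma> assume s: "\<sigma> \<in> G"
    have "poly (p (b i)) (\<sigma> (b i)) = 0" for i
      using field_aut_poly[OF G_aut[OF s], of "p (b i)" "b i"] p[of "b i"] fixedD[OF _ s]
        field_aut_zero[OF G_aut[OF s]] by auto
    thus "restrict (\<lambda>i. \<sigma> (b i)) {..<n} \<in> ?P" by auto
  qed
  moreover have "inj_on (\<lambda>\<sigma>. restrict (\<lambda>i. \<sigma> (b i)) {..<n}) G"
  proof (rule inj_onI, rule ext)
    fix \<sigma> \<tau> x assume s: "\<sigma> \<in> G" "\<tau> \<in> G"
      and eq: "restrict (\<lambda>i. \<sigma> (b i)) {..<n} = restrict (\<lambda>i. \<tau> (b i)) {..<n}"
    have eq': "\<sigma> (b i) = \<tau> (b i)" if "i < n" for i using fun_cong[OF eq, of i] that by simp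
    obtain c where c: "\<forall>i<n. c i \<in> F" "x = (\<Sum>i<n. c i * b i)" using b by blast
    have *: "\<rho> x = (\<Sum>i<n. c i * \<rho> (b i))" if "\<rho> \<in> G" for \<rho>
      unfolding c(2) field_aut_sum[OF G_aut[OF that]]
      using c(1) fixedD[OF _ that] G_aut[OF that] by (intro sum.cong) (auto simp: field_aut_def)
    show "\<sigma> x = \<tau> x" unfolding *[OF s(1)] *[OF s(2)] by (rule sum.cong) (auto simp: eq')
  qed
  ultimately show ?thesis using inj_on_finite by blast
qed

sublocale G: aut_grp G
proof
  show "finite G" by (rule finite_G)
  show "id \<in> G" unfolding G_eq aut_group_def by (auto simp: field_aut_def)
next
  fix \<sigma> \<tau> assume "\<sigma> \<in> G" "\<tau> \<in> G"
  thus "\<sigma> \<circ> \<tau> \<in> G" unfolding G_eq aut_group_def by (auto simp: field_aut_def bij_comp)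
next
  fix \<sigma> assume s: "\<sigma> \<in> G"
  thus "field_aut \<sigma>" by (rule G_aut)
  hence bij: "bij \<sigma>" and add: "\<And>x y. \<sigma> (x + y) = \<sigma> x + \<sigma> y" and mult: "\<And>x y. \<sigma> (x * y) = \<sigma> x * \<sigma> y"
    and one: "\<sigma> 1 = 1" by (auto simp: field_aut_def)
  have cancel: "inv \<sigma> (\<sigma> x) = x" "\<sigma> (inv \<sigma> x) = x" for x
    using bij by (auto simp: bij_is_inj bij_is_surj surj_f_inv_f)
  have "inv \<sigma> (x + y) = inv \<sigma> x + inv \<sigma> y" "inv \<sigma> (x * y) = inv \<sigma> x * inv \<sigma> y" for x y
    using add[of "inv \<sigma> x" "inv \<sigma> y"] mult[of "inv \<sigma> x" "inv \<sigma> y"] cancel by metis+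
  moreover have "inv \<sigma> 1 = 1" using one cancel by metis
  moreover have "inv \<sigma> x = x" if "x \<in> F" for x using fixedD[OF that s] cancel by metis
  ultimately show "inv \<sigma> \<in> G" unfolding G_eq aut_group_def using bij
    by (auto simp: field_aut_def bij_imp_bij_inv)
qed

lemma S_stable: "\<sigma> \<in> G \<Longrightarrow> x \<in> S \<Longrightarrow> \<sigma> x \<in> S"
proof -
  assume s: "\<sigma> \<in> G" and "x \<in> S"
  then obtain p where p: "lead_coeff p = 1" "\<And>i. coeff p i \<in> V" "poly p x = 0"
    by (auto simp: integral_closure_def)
  have "poly p (\<sigma> x) = 0"
    using field_aut_poly[OF G_aut[OF s], of p x] p fixedD[OF V_sub_F s] field_aut_zero[OF G_aut[OF s]] by auto
  thus "\<sigma> x \<in> S" using p unfolding integral_closure_def by blast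
qed

lemma S_Int_F: "x \<in> S \<Longrightarrow> x \<in> F \<Longrightarrow> x \<in> V"
proof -
  assume "x \<in> S" and x: "x \<in> F"
  then obtain p where p: "lead_coeff p = 1" "\<And>i. coeff p i \<in> V" "poly p x = 0"
    by (auto simp: integral_closure_def)
  show "x \<in> V" using V_val[OF x] V.integral_inverse_mem[OF p] by blast
qed

lemma S_fixed: "x \<in> S \<Longrightarrow> (\<And>\<sigma>. \<sigma> \<in> G \<Longrightarrow> \<sigma> x = x) \<Longrightarrow> x \<in> V"
  using S_Int_F fixedI by blast

text \<open>Lying over, by norms: otherwise \<open>v * s - 1\<close> lies in \<open>M\<close> for
  some \<open>s\<close>; its norm lies in \<open>M\<close> and in \<open>V\<close>, yet is plus or
  minus 1 modulo \<open>v\<close>, thus a unit.\<close>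

lemma JV_sub_maximal:
  assumes M: "maximal_ideal_in S M" and v: "v \<in> JV"
  shows "v \<in> M"
proof (rule ccontr)
  interpret M: maximal_ideal_field S M using M by unfold_locales
  assume vM: "v \<notin> M"
  have vV: "v \<in> V" using v VJ.ideal_sub by blast
  have vS: "v \<in> S" using vV by (rule V.sub_integral_closure)
  obtain s where s: "s \<in> S" "v * s - 1 \<in> M" using M.inverse_mod[OF vS vM] by blast
  have v0: "v \<noteq> 0" using vM by auto
  define n where "n = (\<Prod>\<sigma>\<in>G. \<sigma> (v * s - 1))"
  have S1: "\<sigma> (v * s - 1) \<in> S" if "\<sigma> \<in> G" for \<sigma>
    by (rule S_stable[OF that]) (use s vS in auto)
  have nM: "n \<in> M" unfolding n_def
    by (rule M.ideal_prod_mem[of G id]) (use S1 s in auto)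
  have nS: "n \<in> S" unfolding n_def using S1 by (rule S.prod_mem)
  have nV: "n \<in> V" using S_fixed[OF nS] G.norm_fixed unfolding n_def by blast
  \<comment> \<open>As \<open>v\<close> is fixed by \<open>G\<close>, every conjugate of
    \<open>v * s - 1\<close> is -1 modulo \<open>v\<close>.\<close>
  have "\<exists>r\<in>S. (\<Prod>\<sigma>\<in>A. \<sigma> (v * s - 1)) = (- 1) ^ card A + v * r" if "finite A" "A \<subseteq> G" for A
    using that
  proof (induction A rule: finite_induct)
    case empty
    show ?case by (intro bexI[of _ 0]) auto
  next
    case (insert \<sigma> A)
    then obtain r where r: "r \<in> S" "(\<Prod>\<sigma>\<in>A. \<sigma> (v * s - 1)) = (- 1) ^ card A + v * r" by auto
    have \<sigma>: "\<sigma> \<in> G" using insert by auto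
    have \<sigma>s: "\<sigma> s \<in> S" by (rule S_stable[OF \<sigma> s(1)])
    have "\<sigma> (v * s - 1) = v * \<sigma> s - 1" using \<sigma> fixedD[OF V_sub_F[OF vV] \<sigma>] by simp
    hence "(\<Prod>\<sigma>\<in>insert \<sigma> A. \<sigma> (v * s - 1)) = (v * \<sigma> s - 1) * ((- 1) ^ card A + v * r)" using insert r by simp
    also have "\<dots> = (- 1) ^ card (insert \<sigma> A) + v * (\<sigma> s * ((- 1) ^ card A + v * r) - r)"
      using insert by (simp add: algebra_simps)
    finally have "(\<Prod>\<sigma>\<in>insert \<sigma> A. \<sigma> (v * s - 1))
      = (- 1) ^ card (insert \<sigma> A) + v * (\<sigma> s * ((- 1) ^ card A + v * r) - r)" .
    moreover have "\<sigma> s * ((- 1) ^ card A + v * r) - r \<in> S"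
      using r(1) \<sigma>s vS by (intro S.diff_mem S.mult_mem S.add_mem S.power_mem S.uminus_mem) auto
    ultimately show ?case by metis
  qed
  from this[of G] obtain r where r: "r \<in> S" "n = (- 1) ^ card G + v * r" using finite_G by (auto simp: n_def)
  \<comment> \<open>\<open>r\<close> is integral and, as a quotient by \<open>v\<close>, also in
    \<open>F\<close>; hence the congruence modulo \<open>v\<close> already holds within
    \<open>V\<close>.\<close>
  have "n - (- 1) ^ card G \<in> V" using nV by auto
  hence "(n - (- 1) ^ card G) / v \<in> F" using F_divide V_sub_F vV by blast
  moreover have "(n - (- 1) ^ card G) / v = r" using r v0 by simp
  ultimately have rV: "r \<in> V" using S_Int_F r by simp
  have "n \<notin> JV"
  proof
    assume "n \<in> JV"
    hence "n - v * r \<in> JV" using VJ.ideal_diff[OF _ VJ.ideal_mult_right[OF rV v]] by blast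
    hence "(- 1) ^ card G \<in> JV" using r by simp
    hence "(- 1) ^ card G * (- 1) ^ card G \<in> JV" by (intro VJ.ideal_mult_left) auto
    thus False by (simp add: power_add[symmetric])
  qed
  hence "inverse n \<in> S" using VJ.inverse_mem[OF nV] V.sub_integral_closure by blast
  hence "inverse n * n \<in> M" using nM by blast
  moreover have "n \<noteq> 0" using \<open>n \<notin> JV\<close> by auto
  ultimately show False by simp
qed

lemma V_unit_of_notin:
  assumes "maximal_ideal_in S M" "v \<in> V" "v \<notin> M"
  shows "inverse v \<in> V"
  using JV_sub_maximal[OF assms(1)] assms VJ.inverse_mem by blast

text \<open>The elements \<open>c i\<close> and \<open>c i * z\<close> obtained by Horner's scheme from a polynomial over \<open>V\<close> that
  vanishes at \<open>z\<close> are integral; if some coefficient of the polynomial is 1, they exhibit \<open>z\<close> or its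
  inverse as a fraction over \<open>S\<close> with denominator outside \<open>M\<close>.\<close>

lemma localization_val:
  assumes M: "maximal_ideal_in S M" and z: "z \<noteq> 0"
  shows "z \<in> localization S M \<or> inverse z \<in> localization S M"
proof -
  interpret M: maximal_ideal_field S M using M by unfold_locales
  obtain p where p: "lead_coeff p = 1" "\<And>i. coeff p i \<in> F" "poly p z = 0"
    using algebraic[of z] by (auto simp: integral_closure_def)
  define d where "d = degree p"
  define A where "A = {i. i \<le> d \<and> coeff p i \<noteq> 0}"
  \<comment> \<open>Division by a coefficient of least value puts all coefficients into
    \<open>V\<close> and makes one of them 1.\<close>
  have "\<exists>j\<in>A. \<forall>i\<in>A. coeff p i / coeff p j \<in> V"
  proof (rule finite_total_preorder_least)
    show "finite A" by (simp add: A_def)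
    have "d \<in> A" using p by (simp add: A_def d_def)
    thus "A \<noteq> {}" by blast
  next
    fix i j assume "i \<in> A" "j \<in> A"
    show "coeff p j / coeff p i \<in> V \<or> coeff p i / coeff p j \<in> V"
      using V_val[OF F_divide[OF p(2) p(2)], of j i] by simp
  next
    fix i j k assume A: "i \<in> A" "j \<in> A" "k \<in> A" and 1: "coeff p j / coeff p i \<in> V" "coeff p k / coeff p j \<in> V"
    have "coeff p k / coeff p i = coeff p j / coeff p i * (coeff p k / coeff p j)" using A by (simp add: A_def)
    thus "coeff p k / coeff p i \<in> V" using V.mult_mem[OF 1] by simp
  qed
  then obtain j where j: "j \<in> A" "\<And>i. i \<in> A \<Longrightarrow> coeff p i / coeff p j \<in> V" by blast
  define a where "a = (\<lambda>i. coeff p i / coeff p j)"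
  have aV: "a i \<in> V" for i
    using j(2)[of i] coeff_eq_0[of p i] by (cases "i \<in> A") (auto simp: A_def a_def d_def not_le)
  have aj: "a j = 1" "j \<le> d" using j(1) by (auto simp: a_def A_def)
  have az: "(\<Sum>i\<le>d. a i * z ^ i) = 0"
  proof -
    have "(\<Sum>i\<le>d. a i * z ^ i) = (\<Sum>i\<le>d. coeff p i * z ^ i) / coeff p j"
      by (simp add: a_def sum_divide_distrib)
    also have "(\<Sum>i\<le>d. coeff p i * z ^ i) = 0" using p(3) by (simp add: poly_altdef d_def)
    finally show ?thesis by simp
  qed
  \<comment> \<open>Horner tails: \<open>c 0\<close> is the value of the polynomial at
    \<open>z\<close>, hence 0, and \<open>c (Suc d)\<close> is an empty sum.\<close>
  define c where "c = (\<lambda>i. \<Sum>l = i..d. a l * z ^ (l - i))"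
  have c_step: "c i = a i + c (Suc i) * z" if "i \<le> d" for i
  proof -
    have "c i = a i + (\<Sum>l = Suc i..d. a l * z ^ (l - i))"
      unfolding c_def using that by (subst sum.atLeast_Suc_atMost) auto
    also have "(\<Sum>l = Suc i..d. a l * z ^ (l - i)) = c (Suc i) * z"
      unfolding c_def sum_distrib_right
    proof (rule sum.cong[OF refl])
      fix l assume "l \<in> {Suc i..d}"
      hence "l - i = Suc (l - Suc i)" by auto
      thus "a l * z ^ (l - i) = a l * z ^ (l - Suc i) * z" by simp
    qed
    finally show ?thesis .
  qed
  have c0: "c 0 = 0" using az by (simp add: c_def atMost_atLeast0)
  have rel: "c m * z ^ m = - (\<Sum>l<m. a l * z ^ l)" if "m \<le> Suc d" for m
    using that
  proof (induction m)
    case 0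
    thus ?case using c0 by simp
  next
    case (Suc m)
    have "c (Suc m) * z ^ Suc m = (c m - a m) * z ^ m" using c_step[of m] Suc by (simp add: algebra_simps)
    also have "\<dots> = c m * z ^ m - a m * z ^ m" by (simp add: algebra_simps)
    also have "\<dots> = - (\<Sum>l<Suc m. a l * z ^ l)" using Suc by simp
    finally show ?case .
  qed
  have aS: "a l \<in> S" for l using V.sub_integral_closure[OF aV] .
  have cz: "c m * z \<in> S" if cS: "c m \<in> S" and m: "0 < m" "m \<le> Suc d" for m
  proof -
    \<comment> \<open>\<open>rel\<close> multiplied by \<open>c m ^ (m - 1)\<close>, read as a monic
      equation of degree \<open>m\<close> for \<open>c m * z\<close> over \<open>S\<close>.\<close>
    define q where "q = monom 1 m + (\<Sum>l<m. monom (a l * c m ^ (m - 1 - l)) l)"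
    have co: "coeff q i = (if i = m then 1 else if i < m then a i * c m ^ (m - 1 - i) else 0)" for i
    proof -
      have "coeff (\<Sum>l<m. monom (a l * c m ^ (m - 1 - l)) l) i = (\<Sum>l<m. if l = i then a i * c m ^ (m - 1 - i) else 0)"
        unfolding coeff_sum by (rule sum.cong) auto
      also have "\<dots> = (if i < m then a i * c m ^ (m - 1 - i) else 0)" by (simp add: sum.delta')
      finally show ?thesis unfolding q_def by auto
    qed
    have "degree q = m"
    proof (rule antisym)
      show "degree q \<le> m" by (rule degree_le) (auto simp: co)
      show "m \<le> degree q" by (rule le_degree) (simp add: co)
    qed
    hence "lead_coeff q = 1" by (simp add: co)
    moreover have "coeff q i \<in> S" for i unfolding co using aS cS by auto
    moreover have "poly q (c m * z) = 0"
    proof -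
      have "(\<Sum>l<m. a l * c m ^ (m - 1 - l) * (c m * z) ^ l) = (\<Sum>l<m. c m ^ (m - 1) * (a l * z ^ l))"
      proof (rule sum.cong[OF refl])
        fix l assume "l \<in> {..<m}"
        hence "m - 1 = (m - 1 - l) + l" by simp
        hence "c m ^ (m - 1) = c m ^ (m - 1 - l) * c m ^ l" by (metis power_add)
        thus "a l * c m ^ (m - 1 - l) * (c m * z) ^ l = c m ^ (m - 1) * (a l * z ^ l)"
          by (simp add: power_mult_distrib mult_ac)
      qed
      also have "\<dots> = - (c m ^ (m - 1) * (c m * z ^ m))"
        unfolding rel[OF m(2)] by (simp add: sum_distrib_left)
      also have "\<dots> = - ((c m * z) ^ m)"
        using m(1) by (cases m) (simp_all add: power_mult_distrib mult_ac)
      finally show ?thesis by (simp add: q_def poly_sum poly_monom)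
    qed
    ultimately show ?thesis using V.integrally_closed_of_fg[OF fg] by blast
  qed
  \<comment> \<open>Downward induction, with \<open>i\<close> counting the steps below
    \<open>Suc d\<close>.\<close>
  have cS: "c (Suc d - i) \<in> S" if "i \<le> Suc d" for i
    using that
  proof (induction i)
    case 0
    show ?case by (simp add: c_def)
  next
    case (Suc i)
    let ?m = "Suc d - i"
    have m: "0 < ?m" "?m \<le> Suc d" "Suc (Suc d - Suc i) = ?m" using Suc.prems by auto
    have "c (Suc d - Suc i) = a (Suc d - Suc i) + c ?m * z" using c_step[of "Suc d - Suc i"] m by simp
    moreover have "c ?m * z \<in> S" using cz[of ?m] m Suc by auto
    ultimately show ?case using aS by auto
  qed
  hence cS: "c i \<in> S" if "i \<le> Suc d" for i using cS[of "Suc d - i"] that by simp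
  \<comment> \<open>One of \<open>c j\<close> and \<open>c (Suc j) * z\<close> is outside
    \<open>M\<close>; the former serves as a denominator of \<open>z\<close>, the latter as one of
    \<open>inverse z\<close>.\<close>
  have eq: "1 = c j - c (Suc j) * z" using c_step[OF aj(2)] aj by simp
  show ?thesis
  proof (cases "c j \<in> M")
    case False
    hence "j > 0" using c0 by (cases j) auto
    hence "c j * z \<in> S" using cz[of j] cS[of j] aj by auto
    hence "(c j * z) / c j \<in> localization S M" using False cS[of j] aj by (intro M.locI) auto
    moreover have "c j \<noteq> 0" using False by auto
    ultimately show ?thesis by simp
  next
    case True
    have czS: "c (Suc j) * z \<in> S" using cz[of "Suc j"] cS[of "Suc j"] aj by auto
    have nM: "c (Suc j) * z \<notin> M"
    proof
      assume "c (Suc j) * z \<in> M"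
      hence "1 \<in> M" unfolding eq using True by (rule M.ideal_diff[rotated])
      thus False by simp
    qed
    hence "c (Suc j) / (c (Suc j) * z) \<in> localization S M" using czS cS[of "Suc j"] aj by (intro M.locI) auto
    moreover have "c (Suc j) \<noteq> 0" using nM by auto
    hence "c (Suc j) / (c (Suc j) * z) = inverse z" using z by (simp add: field_simps)
    ultimately show ?thesis by simp
  qed
qed

lemma ex_maximal: "\<exists>M. maximal_ideal_in S M"
proof -
  have "ideal_in S {0}" "1 \<notin> ({0} :: 'k set)" by (auto simp: ideal_in_def)
  thus ?thesis using S.ex_maximal_ideal by blast
qed

end

section \<open>Tame inertia\<close>

text \<open>Induction on \<open>p\<close> keeps the remainder in \<open>R\<close> without dividing
  by factorials.\<close>

lemma poly_taylor:
  fixes x h :: "'k::field"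
  assumes R: "is_subring R" and "\<And>i. coeff p i \<in> R" "x \<in> R" "h \<in> R"
  shows "\<exists>r\<in>R. poly p (x + h) = poly p x + h * poly (pderiv p) x + h * h * r"
  using assms(2)
proof (induction p)
  case 0
  interpret subring_field R using R by unfold_locales
  show ?case by (intro bexI[of _ 0]) auto
next
  case (pCons a p)
  interpret subring_field R using R by unfold_locales
  have co: "coeff p i \<in> R" for i using pCons.prems[of "Suc i"] by simp
  then obtain r where r: "r \<in> R" "poly p (x + h) = poly p x + h * poly (pderiv p) x + h * h * r"
    using pCons.IH by blast
  have P': "poly (pderiv p) x \<in> R"
    using co assms(3) by (intro poly_mem) (auto simp: coeff_pderiv intro!: mult_mem simp del: of_nat_Suc)
  have "poly (pCons a p) (x + h) = poly (pCons a p) x + h * poly (pderiv (pCons a p)) x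
      + h * h * (poly (pderiv p) x + x * r + h * r)"
    unfolding poly_pCons r(2) pderiv_pCons poly_add by (simp add: algebra_simps)
  moreover have "poly (pderiv p) x + x * r + h * r \<in> R" using P' r(1) assms(3,4) by auto
  ultimately show ?case by blast
qed

context local_subring
begin

text \<open>Artin's elimination, carried out modulo \<open>J\<close> instead of in a residue field:
  the relation at \<open>x * y\<close> minus \<open>\<chi> k y\<close> times the relation at
  \<open>x\<close> no longer involves \<open>k\<close>, and each \<open>c j\<close> has acquired the
  factor \<open>\<chi> j y - \<chi> k y\<close>.\<close>

lemma independent_characters:
  assumes "finite I"
    and X: "\<And>x y. x \<in> X \<Longrightarrow> y \<in> X \<Longrightarrow> x * y \<in> X"
    and "\<And>i x. i \<in> I \<Longrightarrow> x \<in> X \<Longrightarrow> \<chi> i x \<in> Q"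
    and "\<And>i x y. i \<in> I \<Longrightarrow> x \<in> X \<Longrightarrow> y \<in> X \<Longrightarrow> \<chi> i (x * y) = \<chi> i x * \<chi> i y"
    and "\<And>i j. i \<in> I \<Longrightarrow> j \<in> I \<Longrightarrow> i \<noteq> j \<Longrightarrow> \<exists>x\<in>X. \<chi> i x - \<chi> j x \<notin> J"
    and "\<And>i. i \<in> I \<Longrightarrow> \<exists>x\<in>X. \<chi> i x \<notin> J"
    and "\<And>i. i \<in> I \<Longrightarrow> c i \<in> Q" and "\<And>x. x \<in> X \<Longrightarrow> (\<Sum>i\<in>I. c i * \<chi> i x) \<in> J"
  shows "\<forall>i\<in>I. c i \<in> J"
  using assms(1,3-)
proof (induction I arbitrary: c rule: finite_induct)
  case (insert k I)
  note Q = insert.prems(1) and mult = insert.prems(2) and distinct = insert.prems(3)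
    and nonzero = insert.prems(4) and c = insert.prems(5) and rel = insert.prems(6)
  have IJ: "c i \<in> J" if i: "i \<in> I" for i
  proof -
    have "i \<noteq> k" using i insert by auto
    then obtain y where y: "y \<in> X" "\<chi> i y - \<chi> k y \<notin> J" using distinct[of i k] i by auto
    have "\<forall>j\<in>I. c j * (\<chi> j y - \<chi> k y) \<in> J"
    proof (rule insert.IH)
      fix x assume x: "x \<in> X"
      have "(\<Sum>j\<in>insert k I. c j * \<chi> j (x * y)) - \<chi> k y * (\<Sum>j\<in>insert k I. c j * \<chi> j x) \<in> J"
        using rel[OF X[OF x y(1)]] ideal_mult_left[OF Q[of k y] rel[OF x]] y by auto
      also have "(\<Sum>j\<in>insert k I. c j * \<chi> j (x * y)) - \<chi> k y * (\<Sum>j\<in>insert k I. c j * \<chi> j x)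
          = (\<Sum>j\<in>insert k I. c j * (\<chi> j y - \<chi> k y) * \<chi> j x)"
        unfolding sum_distrib_left sum_subtractf[symmetric]
        using mult x y by (intro sum.cong) (auto simp: algebra_simps)
      also have "\<dots> = (\<Sum>j\<in>I. c j * (\<chi> j y - \<chi> k y) * \<chi> j x)" using insert.hyps by simp
      finally show "(\<Sum>j\<in>I. c j * (\<chi> j y - \<chi> k y) * \<chi> j x) \<in> J" .
    next
      fix j assume "j \<in> I"
      thus "c j * (\<chi> j y - \<chi> k y) \<in> Q" using c Q y by (intro mult_mem diff_mem) auto
    qed (use Q mult distinct nonzero in auto)
    hence "c i * (\<chi> i y - \<chi> k y) \<in> J" using i by blast
    moreover have "\<chi> i y - \<chi> k y \<in> Q" using Q i y by (intro diff_mem) auto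
    ultimately show ?thesis using J_prime[of "c i" "\<chi> i y - \<chi> k y"] c[of i] i y(2) by auto
  qed
  obtain x where x: "x \<in> X" "\<chi> k x \<notin> J" using nonzero[of k] by auto
  have "(\<Sum>j\<in>I. c j * \<chi> j x) \<in> J" using IJ Q x by (intro ideal_sum ideal_mult_right) auto
  moreover have "c k * \<chi> k x + (\<Sum>j\<in>I. c j * \<chi> j x) \<in> J" using rel[OF x(1)] insert.hyps by simp
  ultimately have "c k * \<chi> k x \<in> J" using ideal_diff by fastforce
  hence "c k \<in> J" using J_prime[of "c k" "\<chi> k x"] c[of k] Q[of k x] x by auto
  thus ?case using IJ by auto
qed simp

end

context val_ext
begin

text \<open>Makes the results on images of ideals and localizations available where no
  \<open>f\<close> is given.\<close>

lemma crossed_trivial: "crossed G S (\<lambda>_ _. 1)"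
  by unfold_locales (auto simp: normalized_cocycle_def intro: S_stable)

end

text \<open>\<open>ram_index\<close> is a \<open>card\<close>, which is 0 for an infinite set, so
  \<open>ram_pos\<close> says that the index of value groups is finite.\<close>

locale tame_max = val_ext V G + max: maximal_ideal_field "integral_closure V" M
  for V :: "'k::field set" and G M +
  assumes ram_pos: "ram_index V (localization (integral_closure V) M) > 0"
    and tame: "of_nat (ram_index V (localization (integral_closure V) M)) \<notin> jacobson V"
    and separable: "residue_separable V (localization (integral_closure V) M)"
begin

abbreviation "R \<equiv> localization S M"
abbreviation "J \<equiv> loc_ideal S M"
abbreviation "T \<equiv> inertia_group G R"
abbreviation "D \<equiv> decomp_group G R"
abbreviation "e \<equiv> ram_index V R"

sublocale R: val_ring R J
  using localization_val[OF max.maximal] by unfold_locales auto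

lemma jacobson_R: "jacobson R = J"
  by (rule max.loc.jacobson_eq)

lemma S_sub_R: "x \<in> S \<Longrightarrow> x \<in> R"
  by (rule max.sub_loc)

lemma V_sub_R: "x \<in> V \<Longrightarrow> x \<in> R"
  using S_sub_R V.sub_integral_closure by blast

lemma JV_sub_J: "x \<in> JV \<Longrightarrow> x \<in> J"
  using JV_sub_maximal[OF max.maximal] max.ideal_sub_loc by blast

lemma V_notin_J: "x \<in> V \<Longrightarrow> x \<notin> JV \<Longrightarrow> x \<notin> J"
  using VJ.inverse_mem[of x] max.loc.unit_notin_J[OF V_sub_R V_sub_R] by (cases "x = 0") auto

lemma e_notin_J: "of_nat e \<notin> J"
  using tame unfolding VJ.jacobson_eq by (intro V_notin_J) auto

text \<open>As \<open>\<sigma>\<close> maps the localization at \<open>M\<close> onto that at its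
  image, stability embeds the latter in the former. An element of \<open>M\<close> outside the image
  would then be invertible at \<open>M\<close>; maximality gives equality.\<close>

lemma decomp_iff: "\<sigma> \<in> D \<longleftrightarrow> \<sigma> \<in> G \<and> \<sigma> ` M = M"
proof -
  interpret t: crossed G S "\<lambda>_ _. 1" by (rule crossed_trivial)
  have "\<sigma> ` M = M" if s: "\<sigma> \<in> G" and sub: "\<sigma> ` R \<subseteq> R"
  proof -
    have max': "maximal_ideal_in S (\<sigma> ` M)" by (rule t.maximal_image[OF s max.maximal])
    interpret m: maximal_ideal_field S "\<sigma> ` M" using max' by unfold_locales
    have sub': "localization S (\<sigma> ` M) \<subseteq> R" using sub t.localization_image[OF s, of M] by simp
    have "M \<subseteq> \<sigma> ` M"
    proof
      fix x assume x: "x \<in> M"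
      show "x \<in> \<sigma> ` M"
      proof (rule ccontr)
        assume n: "x \<notin> \<sigma> ` M"
        hence "1 / x \<in> R" using m.locI[of 1 x] max.ideal_sub[OF x] sub' by auto
        moreover have "x \<noteq> 0" using n by auto
        ultimately have "x \<notin> J" using max.loc.unit_notin_J[OF S_sub_R[OF max.ideal_sub[OF x]]] by (simp add: divide_inverse)
        thus False using max.ideal_sub_loc[OF x] by simp
      qed
    qed
    thus ?thesis using max.maximal max' unfolding maximal_ideal_in_def by blast
  qed
  moreover have "\<sigma> ` R \<subseteq> R" if "\<sigma> \<in> G" "\<sigma> ` M = M"
    using t.localization_image[OF that(1), of M] that(2) by simp
  ultimately show ?thesis unfolding decomp_group_def by blast
qed

sublocale D: aut_grp D
proof
  show "finite D" using finite_G by (simp add: decomp_group_def)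
  show "id \<in> D" unfolding decomp_iff by simp
  fix \<sigma> assume s: "\<sigma> \<in> D"
  thus "field_aut \<sigma>" using G_aut by (simp add: decomp_iff)
  have sG: "\<sigma> \<in> G" using s by (simp add: decomp_iff)
  have "inv \<sigma> ` \<sigma> ` M = M" by (simp only: image_image G.inv_aut[OF sG] image_ident)
  hence "inv \<sigma> ` M = M" using s unfolding decomp_iff by simp
  thus "inv \<sigma> \<in> D" using s by (simp add: decomp_iff)
  fix \<tau> assume "\<tau> \<in> D"
  moreover have "(\<sigma> \<circ> \<tau>) ` M = \<sigma> ` \<tau> ` M" by (simp only: image_comp)
  ultimately show "\<sigma> \<circ> \<tau> \<in> D" using s unfolding decomp_iff by simp
qed

lemma D_G: "\<sigma> \<in> D \<Longrightarrow> \<sigma> \<in> G"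
  by (simp add: decomp_iff)

lemma D_R: "\<sigma> \<in> D \<Longrightarrow> x \<in> R \<Longrightarrow> \<sigma> x \<in> R"
  by (auto simp: decomp_group_def)

lemma D_J: "\<sigma> \<in> D \<Longrightarrow> x \<in> R \<Longrightarrow> \<sigma> x \<in> J \<longleftrightarrow> x \<in> J"
proof -
  assume s: "\<sigma> \<in> D" and x: "x \<in> R"
  have "inverse (\<sigma> x) \<in> R \<longleftrightarrow> inverse x \<in> R"
    using D_R[OF s, of "inverse x"] D_R[OF D.inv_mem[OF s], of "inverse (\<sigma> x)"] D_G[OF s] s by auto
  thus ?thesis using max.loc.nonunit_iff[OF x] max.loc.nonunit_iff[OF D_R[OF s x]] s by auto
qed

lemma D_M: "\<sigma> \<in> D \<Longrightarrow> x \<in> S \<Longrightarrow> \<sigma> x \<in> M \<longleftrightarrow> x \<in> M"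
  using D_J[OF _ S_sub_R] max.loc_ideal_Int max.ideal_sub_loc S_stable[OF D_G] by metis

lemma T_cong: "\<tau> \<in> T \<Longrightarrow> x \<in> R \<Longrightarrow> \<tau> x - x \<in> J"
  by (simp add: inertia_group_def jacobson_R)

lemma T_D: "\<tau> \<in> T \<Longrightarrow> \<tau> \<in> D"
proof -
  assume t: "\<tau> \<in> T"
  have "\<tau> x \<in> R" if "x \<in> R" for x
    using max.loc.add_mem[OF max.loc.ideal_sub[OF T_cong[OF t that]] that] by simp
  thus "\<tau> \<in> D" using t by (auto simp: decomp_group_def inertia_group_def)
qed

text \<open>The quotient rule carries the congruence from \<open>S\<close> to fractions, whose
  denominators stay outside \<open>M\<close> by the congruence itself.\<close>

lemma T_of_S_cong:
  assumes t: "\<tau> \<in> G" and cong: "\<And>x. x \<in> S \<Longrightarrow> \<tau> x - x \<in> M"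
  shows "\<tau> \<in> T"
  unfolding inertia_group_def jacobson_R
proof (intro CollectI conjI ballI)
  fix x assume "x \<in> R"
  then obtain a b where ab: "x = a / b" "a \<in> S" "b \<in> S" "b \<notin> M" "b \<noteq> 0" by (rule max.locE)
  have tb: "\<tau> b \<in> S" "\<tau> a \<in> S" using S_stable[OF t] ab by auto
  have "\<tau> b \<notin> M"
  proof
    assume "\<tau> b \<in> M"
    hence "\<tau> b - (\<tau> b - b) \<in> M" using cong[OF ab(3)] by (rule max.ideal_diff)
    thus False using ab by simp
  qed
  hence den: "b * \<tau> b \<in> S" "b * \<tau> b \<notin> M" "\<tau> b \<noteq> 0" using max.mult_notin[OF ab(3) tb(1)] ab tb by auto
  have "(\<tau> a - a) * b - a * (\<tau> b - b) \<in> M"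
    using cong[OF ab(2)] cong[OF ab(3)] ab(2,3) max.ideal_diff[OF max.ideal_mult_right max.ideal_mult_left] by blast
  moreover have "\<tau> x - x = ((\<tau> a - a) * b - a * (\<tau> b - b)) / (b * \<tau> b)"
    unfolding ab(1) using ab(5) den t by (simp add: field_simps)
  ultimately show "\<tau> x - x \<in> J" using max.loc_idealI[OF _ den(1,2)] by simp
qed (rule t)

sublocale T: aut_grp T
proof
  show "finite T" using finite_G by (simp add: inertia_group_def)
  show "id \<in> T" by (simp add: inertia_group_def jacobson_R)
  fix \<sigma> assume s: "\<sigma> \<in> T"
  thus "field_aut \<sigma>" using G_aut by (simp add: inertia_group_def)
  have sD: "\<sigma> \<in> D" by (rule T_D[OF s])
  have "inv \<sigma> x - x \<in> J" if x: "x \<in> R" for x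
  proof -
    have "inv \<sigma> x \<in> R" by (rule D_R[OF D.inv_mem[OF sD] x])
    from T_cong[OF s this] have "x - inv \<sigma> x \<in> J" using sD by simp
    thus ?thesis using max.loc.ideal_uminus by fastforce
  qed
  thus "inv \<sigma> \<in> T" using G.inv_mem[OF D_G[OF sD]] by (simp add: inertia_group_def jacobson_R)
  fix \<tau> assume t: "\<tau> \<in> T"
  have "\<sigma> (\<tau> x) - x \<in> J" if x: "x \<in> R" for x
    using max.loc.ideal_add[OF T_cong[OF s D_R[OF T_D[OF t] x]] T_cong[OF t x]] by simp
  thus "\<sigma> \<circ> \<tau> \<in> T" using G.comp_mem[OF D_G[OF sD] D_G[OF T_D[OF t]]]
    by (simp add: inertia_group_def jacobson_R)
qed

lemma T_G: "\<tau> \<in> T \<Longrightarrow> \<tau> \<in> G"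
  by (simp add: inertia_group_def)

section \<open>Ramification theory of the inertia group\<close>

lemma aut_eq_id_of_R:
  assumes t: "\<tau> \<in> G" and fxd: "\<And>x. x \<in> R \<Longrightarrow> \<tau> x = x"
  shows "\<tau> = id"
proof
  fix z show "\<tau> z = id z"
  proof (cases "z \<in> R")
    case False
    hence "z \<noteq> 0" "inverse z \<in> R" using R.val[of z] by auto
    hence "inverse (\<tau> z) = inverse z" using fxd[of "inverse z"] t by simp
    thus ?thesis by simp
  qed (use fxd in simp)
qed

text \<open>Finite generation of \<open>S\<close> makes the minimal value of \<open>\<tau> x - x\<close> an attained one; this is the
  engine of the descent arguments below.\<close>

lemma ex_min_diff:
  assumes t: "\<tau> \<in> T" "\<tau> \<noteq> id"
  obtains x0 where "x0 \<in> R" "\<tau> x0 - x0 \<noteq> 0" "\<And>x. x \<in> R \<Longrightarrow> (\<tau> x - x) / (\<tau> x0 - x0) \<in> R"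
proof -
  obtain B where B: "finite B" "B \<subseteq> S" and span: "\<forall>s\<in>S. \<exists>c. (\<forall>b\<in>B. c b \<in> V) \<and> s = (\<Sum>b\<in>B. c b * b)"
    using fg unfolding fg_module_def by (elim exE conjE)
  define A where "A = {b \<in> B. \<tau> b - b \<noteq> 0}"
  have tG: "\<tau> \<in> G" by (rule T_G[OF t(1)])
  have diff: "\<exists>c. (\<forall>b\<in>B. c b \<in> V) \<and> \<tau> s - s = (\<Sum>b\<in>B. c b * (\<tau> b - b))" if s: "s \<in> S" for s
  proof -
    obtain c where c: "\<forall>b\<in>B. c b \<in> V" "s = (\<Sum>b\<in>B. c b * b)" using span s by blast
    have "\<tau> (c b) = c b" if "b \<in> B" for b using fixedD[OF V_sub_F tG] c that by blast
    hence "\<tau> s - s = (\<Sum>b\<in>B. c b * (\<tau> b - b))"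
      unfolding c(2) using tG by (simp add: sum_subtractf[symmetric] right_diff_distrib)
    thus ?thesis using c by blast
  qed
  have R_diff: "\<exists>s n. s \<in> S \<and> n \<in> S \<and> n \<notin> M \<and> \<tau> x - x = (\<tau> s - s) / n" if x: "x \<in> R" for x
  proof -
    obtain a b where ab: "x = a / b" "a \<in> S" "b \<in> S" "b \<notin> M" "b \<noteq> 0" using x by (rule max.locE)
    \<comment> \<open>The denominator is replaced by its norm over \<open>T\<close>, which
      \<open>\<tau>\<close> fixes and which stays outside \<open>M\<close>; the difference of the
      fraction is then a difference on \<open>S\<close> divided by a unit at
      \<open>M\<close>.\<close>
    define n where "n = (\<Prod>\<sigma>\<in>T. \<sigma> b)"
    define b' where "b' = (\<Prod>\<sigma>\<in>T-{id}. \<sigma> b)"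
    have \<sigma>b: "\<sigma> b \<in> S" "\<sigma> b \<notin> M" if "\<sigma> \<in> T" for \<sigma>
      using S_stable[OF T_G[OF that] ab(3)] D_M[OF T_D[OF that] ab(3)] ab(4) by auto
    have n: "n \<in> S" "n \<notin> M" unfolding n_def using \<sigma>b by (auto intro!: S.prod_mem max.prod_notin)
    have b': "b' \<in> S" unfolding b'_def using \<sigma>b by (auto intro!: S.prod_mem)
    have nb: "n = b * b'" unfolding n_def b'_def by (subst prod.remove[of T id]) auto
    have fxd: "\<tau> n = n" using T.norm_fixed[OF t(1)] unfolding n_def .
    have n0: "n \<noteq> 0" using n by auto
    have "x = a * b' / n" using ab nb n0 by (simp add: field_simps)
    hence "\<tau> x - x = (\<tau> (a * b') - a * b') / n"
      using tG fxd by (simp add: diff_divide_distrib)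
    moreover have "a * b' \<in> S" using ab b' by auto
    ultimately show ?thesis using n by blast
  qed
  have "A \<noteq> {}"
  proof
    assume "A = {}"
    hence zero: "\<tau> b - b = 0" if "b \<in> B" for b using that by (auto simp: A_def)
    have "\<tau> s - s = 0" if s: "s \<in> S" for s
    proof -
      obtain c where "\<tau> s - s = (\<Sum>b\<in>B. c b * (\<tau> b - b))" using diff[OF s] by blast
      thus ?thesis using zero by simp
    qed
    hence "\<tau> x = x" if "x \<in> R" for x using R_diff[OF that] by auto
    thus False using aut_eq_id_of_R[OF tG] t(2) by blast
  qed
  have "\<exists>a\<in>A. \<forall>b\<in>A. (\<tau> b - b) / (\<tau> a - a) \<in> R"
  proof (rule finite_total_preorder_least)
    show "finite A" using B by (simp add: A_def)
    show "A \<noteq> {}" by fact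
  next
    fix a b assume "a \<in> A" "b \<in> A"
    thus "(\<tau> b - b) / (\<tau> a - a) \<in> R \<or> (\<tau> a - a) / (\<tau> b - b) \<in> R"
      using R.val[of "(\<tau> b - b) / (\<tau> a - a)"] by (auto simp: A_def)
  next
    fix a b c assume A: "a \<in> A" "b \<in> A" "c \<in> A"
      and 1: "(\<tau> b - b) / (\<tau> a - a) \<in> R" "(\<tau> c - c) / (\<tau> b - b) \<in> R"
    have "(\<tau> c - c) / (\<tau> a - a) = (\<tau> b - b) / (\<tau> a - a) * ((\<tau> c - c) / (\<tau> b - b))"
      using A by (simp add: A_def)
    thus "(\<tau> c - c) / (\<tau> a - a) \<in> R" using max.loc.mult_mem[OF 1] by simp
  qed
  then obtain a where a: "a \<in> A" "\<And>b. b \<in> A \<Longrightarrow> (\<tau> b - b) / (\<tau> a - a) \<in> R" by blast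
  have bR: "(\<tau> b - b) / (\<tau> a - a) \<in> R" if "b \<in> B" for b
    using a(2)[of b] that by (cases "b \<in> A") (auto simp: A_def)
  show thesis
  proof (rule that)
    show "a \<in> R" using a B S_sub_R by (auto simp: A_def)
    show "\<tau> a - a \<noteq> 0" using a by (simp add: A_def)
    fix x assume "x \<in> R"
    then obtain s n where sn: "s \<in> S" "n \<in> S" "n \<notin> M" "\<tau> x - x = (\<tau> s - s) / n" using R_diff by blast
    obtain c where c: "\<forall>b\<in>B. c b \<in> V" "\<tau> s - s = (\<Sum>b\<in>B. c b * (\<tau> b - b))" using diff[OF sn(1)] by blast
    have "(\<tau> x - x) / (\<tau> a - a) = (\<Sum>b\<in>B. c b * ((\<tau> b - b) / (\<tau> a - a))) * (1 / n)"
      unfolding sn(4) c(2) by (simp add: sum_divide_distrib mult.commute[of n])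
    also have "\<dots> \<in> R"
      using c(1) bR V_sub_R max.locI[OF S.one_mem sn(2,3)] by (intro max.loc.mult_mem max.loc.sum_mem) auto
    finally show "(\<tau> x - x) / (\<tau> a - a) \<in> R" .
  qed
qed

text \<open>Let \<open>p\<close> be a separable equation for the residue of \<open>x0\<close>. Then
  \<open>p(x0)\<close> lies in \<open>J\<close>, and by Taylor expansion its difference is that of
  \<open>x0\<close> times a unit, namely \<open>p'(x0)\<close> up to an element of
  \<open>J\<close>.\<close>

lemma ex_min_diff_in_J:
  assumes t: "\<tau> \<in> T" and x0: "x0 \<in> R" "\<tau> x0 - x0 \<noteq> 0"
  obtains z where "z \<in> J" "(\<tau> z - z) / (\<tau> x0 - x0) \<in> R" "(\<tau> z - z) / (\<tau> x0 - x0) \<notin> J"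
proof -
  obtain p u w where p: "\<forall>i. coeff p i \<in> V" "poly p x0 \<in> J"
    and uw: "\<forall>i. coeff u i \<in> V" "\<forall>i. coeff w i \<in> V" "\<forall>i. coeff (u * p + w * pderiv p - 1) i \<in> JV"
    using separable x0(1) unfolding residue_separable_def jacobson_R VJ.jacobson_eq by blast
  define y0 where "y0 = \<tau> x0 - x0"
  have y0: "y0 \<in> J" "y0 \<noteq> 0" "\<tau> x0 = x0 + y0" using T_cong[OF t x0(1)] x0(2) by (auto simp: y0_def)
  let ?z = "poly p x0" and ?d = "poly (pderiv p) x0"
  have V': "poly q x0 \<in> R" if "\<forall>i. coeff q i \<in> V" for q
    using that V_sub_R x0 by (intro max.loc.poly_mem) auto
  have dR: "?d \<in> R"
    using p(1) by (intro V') (auto simp: coeff_pderiv intro!: V.mult_mem simp del: of_nat_Suc)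
  have "poly (u * p + w * pderiv p - 1) x0 \<in> J"
    unfolding poly_altdef using uw(3) JV_sub_J x0(1)
    by (intro max.loc.ideal_sum max.loc.ideal_mult_right max.loc.power_mem) auto
  hence 1: "poly u x0 * ?z + poly w x0 * ?d - 1 \<in> J" by simp
  \<comment> \<open>The Bezout relation is evaluated at \<open>x0\<close>, where \<open>p\<close>
    vanishes modulo \<open>J\<close>.\<close>
  have dJ: "?d \<notin> J"
  proof
    assume "?d \<in> J"
    hence "poly u x0 * ?z + poly w x0 * ?d \<in> J"
      using p(2) V' uw by (intro max.loc.ideal_add max.loc.ideal_mult_left) auto
    from max.loc.ideal_diff[OF this 1] show False by simp
  qed
  obtain r where r: "r \<in> R" "poly p (x0 + y0) = ?z + y0 * ?d + y0 * y0 * r"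
    using poly_taylor[OF max.loc.subring, of p x0 y0] p(1) V_sub_R x0(1) max.loc.ideal_sub[OF y0(1)] by blast
  have "\<tau> ?z = poly p (\<tau> x0)"
    by (rule field_aut_poly) (use G_aut T_G[OF t] fixedD[OF V_sub_F] p(1) in auto)
  hence "(\<tau> ?z - ?z) / y0 = ?d + y0 * r" using r(2) y0 by (simp add: field_simps)
  moreover have "?d + y0 * r \<notin> J"
  proof
    assume "?d + y0 * r \<in> J"
    from max.loc.ideal_diff[OF this max.loc.ideal_mult_right[OF r(1) y0(1)]] show False using dJ by simp
  qed
  moreover have "?d + y0 * r \<in> R" using dR max.loc.ideal_sub[OF y0(1)] r by (intro max.loc.add_mem max.loc.mult_mem)
  ultimately show thesis using that[of ?z] p(2) by (simp add: y0_def)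
qed

text \<open>Multiplication by \<open>z\<close> permutes the \<open>e\<close> cosets of
  \<open>F^* U(R)\<close> in \<open>K^*\<close>. In the product over all cosets the representatives
  cancel, leaving \<open>z ^ e\<close> in the trivial coset.\<close>

lemma power_e:
  assumes z: "z \<noteq> 0"
  obtains a u where "a \<in> F" "a \<noteq> 0" "u \<in> R" "u \<notin> J" "z ^ e = a * u"
proof -
  define rel where "rel = {(x, y). x \<noteq> 0 \<and> y \<noteq> 0 \<and> (\<exists>a\<in>F - {0}. \<exists>u\<in>units_in R. x = a * u * y)}"
  define X where "X = (UNIV - {0 :: 'k}) // rel"
  have e: "e = card X" by (simp add: ram_index_def X_def rel_def)
  have finX: "finite X" using ram_pos e card_ge_0_finite by metis
  have relI: "(x, y) \<in> rel" if "x \<noteq> 0" "y \<noteq> 0" "a \<in> F" "a \<noteq> 0" "u \<in> R" "u \<notin> J" "x = a * u * y" for x y a u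
  proof -
    have "u \<in> units_in R" using that by (simp add: max.loc.units_in_iff)
    thus ?thesis using that unfolding rel_def by blast
  qed
  have relE: "\<exists>a u. a \<in> F \<and> a \<noteq> 0 \<and> u \<in> R \<and> u \<notin> J \<and> x = a * u * y" "x \<noteq> 0" "y \<noteq> 0" if "(x, y) \<in> rel" for x y
    using that unfolding rel_def by (auto simp: max.loc.units_in_iff)
  have u0: "u \<noteq> 0" if "u \<notin> J" for u using that by auto
  have inv_unit: "inverse u \<in> R \<and> inverse u \<notin> J" if "u \<in> R" "u \<notin> J" for u
    using max.loc.inverse_mem[OF that] max.loc.unit_notin_J[of "inverse u"] that by auto
  have equiv: "equiv (UNIV - {0}) rel"
  proof (rule equivI)
    show "rel \<subseteq> (UNIV - {0}) \<times> (UNIV - {0})" by (auto simp: rel_def)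
    show "refl_on (UNIV - {0}) rel"
      by (rule refl_onI) (auto intro!: relI[of _ _ 1 1])
    show "sym rel"
    proof (rule symI)
      fix x y assume xy: "(x, y) \<in> rel"
      then obtain a u where au: "a \<in> F" "a \<noteq> 0" "u \<in> R" "u \<notin> J" "x = a * u * y" using relE by blast
      show "(y, x) \<in> rel"
        by (rule relI[of _ _ "inverse a" "inverse u"])
          (use au relE[OF xy] F_inverse inv_unit u0 in \<open>auto simp: field_simps\<close>)
    qed
    show "trans rel"
    proof (rule transI)
      fix x y w assume xy: "(x, y) \<in> rel" and yw: "(y, w) \<in> rel"
      obtain a u where au: "a \<in> F" "a \<noteq> 0" "u \<in> R" "u \<notin> J" "x = a * u * y" using relE[OF xy] by blast
      obtain b v where bv: "b \<in> F" "b \<noteq> 0" "v \<in> R" "v \<notin> J" "y = b * v * w" using relE[OF yw] by blast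
      show "(x, w) \<in> rel"
        by (rule relI[of _ _ "a * b" "u * v"])
          (use au bv relE[OF xy] relE[OF yw] max.loc.J_prime in \<open>auto simp: mult_ac\<close>)
    qed
  qed
  define r where "r = (\<lambda>C :: 'k set. SOME x. x \<in> C)"
  have rC: "r C \<in> C" if "C \<in> X" for C
  proof -
    have "C \<noteq> {}" using that in_quotient_imp_non_empty[OF equiv] by (simp add: X_def)
    thus ?thesis unfolding r_def by (simp add: some_in_eq)
  qed
  have r0: "r C \<noteq> 0" if "C \<in> X" for C
    using rC[OF that] that in_quotient_imp_subset[OF equiv] by (auto simp: X_def)
  have C_eq: "C = rel `` {x}" if CX: "C \<in> X" and xC: "x \<in> C" for C x
  proof -
    obtain y where "C = rel `` {y}" using CX unfolding X_def by (rule quotientE)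
    thus ?thesis using xC equiv_class_eq[OF equiv] by auto
  qed
  \<comment> \<open>The permutation of the cosets, with \<open>r C\<close> as representative of
    \<open>C\<close>.\<close>
  define m where "m = (\<lambda>C. rel `` {z * r C})"
  have mX: "m C \<in> X" if "C \<in> X" for C
    unfolding m_def X_def using z r0[OF that] by (intro quotientI) auto
  have rm: "(z * r C, r (m C)) \<in> rel" if "C \<in> X" for C
    using rC[OF mX[OF that]] unfolding m_def by auto
  have inj: "inj_on m X"
  proof (rule inj_onI)
    fix C C' assume C: "C \<in> X" "C' \<in> X" and eq: "m C = m C'"
    have zz: "(z * r C, z * r C') \<in> rel"
      using eq eq_equiv_class[OF _ equiv, of "z * r C" "z * r C'"] z r0[OF C(1)] r0[OF C(2)] unfolding m_def by auto
    obtain a u where au: "a \<in> F" "a \<noteq> 0" "u \<in> R" "u \<notin> J" "z * r C = a * u * (z * r C')"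
      using relE(1)[OF zz] by blast
    have "(r C, r C') \<in> rel"
      by (rule relI[of _ _ a u]) (use au z r0 C in auto)
    hence "rel `` {r C} = rel `` {r C'}" by (rule equiv_class_eq[OF equiv])
    thus "C = C'" using C_eq[OF C(1) rC[OF C(1)]] C_eq[OF C(2) rC[OF C(2)]] by simp
  qed
  have surj: "m ` X = X" using endo_inj_surj[OF finX _ inj] mX by blast
  have "\<exists>a u. a \<in> F \<and> a \<noteq> 0 \<and> u \<in> R \<and> u \<notin> J \<and> z * r C = a * u * r (m C)" if "C \<in> X" for C
    using relE(1)[OF rm[OF that]] .
  then obtain a u where au: "\<And>C. C \<in> X \<Longrightarrow> a C \<in> F \<and> a C \<noteq> 0 \<and> u C \<in> R \<and> u C \<notin> J \<and> z * r C = a C * u C * r (m C)"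
    by metis
  have "z ^ e * (\<Prod>C\<in>X. r C) = (\<Prod>C\<in>X. z * r C)" by (simp add: prod.distrib e)
  also have "\<dots> = (\<Prod>C\<in>X. a C * u C * r (m C))" using au by (intro prod.cong) auto
  also have "\<dots> = (\<Prod>C\<in>X. a C) * (\<Prod>C\<in>X. u C) * (\<Prod>C\<in>X. r (m C))" by (simp add: prod.distrib)
  also have "(\<Prod>C\<in>X. r (m C)) = (\<Prod>C\<in>X. r C)" using prod.reindex[OF inj, of r] surj by simp
  finally have "z ^ e = (\<Prod>C\<in>X. a C) * (\<Prod>C\<in>X. u C)" using r0 finX by simp
  moreover have "(\<Prod>C\<in>X. a C) \<in> F" "(\<Prod>C\<in>X. a C) \<noteq> 0" using au finX by (auto intro!: F.prod_mem)
  moreover have "(\<Prod>C\<in>X. u C) \<in> R \<and> (\<Prod>C\<in>X. u C) \<notin> J"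
    using finX au
  proof (induction X rule: finite_induct)
    case (insert C Y)
    thus ?case using max.loc.J_prime[of "u C" "\<Prod>C\<in>Y. u C"] by auto
  qed auto
  ultimately show thesis using that by blast
qed

text \<open>By \<open>power_e\<close> the \<open>e\<close>-th power of the quotient is
  \<open>\<tau> u / u\<close> with a unit \<open>u\<close>, because \<open>\<tau>\<close> fixes
  \<open>F\<close>.\<close>

lemma T_quotient_unit:
  assumes t: "\<tau> \<in> T" and y: "y \<noteq> 0"
  shows "\<tau> y / y \<in> R" "\<tau> y / y \<notin> J"
proof -
  obtain a u where au: "a \<in> F" "a \<noteq> 0" "u \<in> R" "u \<notin> J" "y ^ e = a * u" using y by (rule power_e)
  have tG: "\<tau> \<in> G" by (rule T_G[OF t])
  have tu: "\<tau> u \<in> R" "\<tau> u \<notin> J" using D_R[OF T_D[OF t] au(3)] D_J[OF T_D[OF t] au(3)] au(4) by auto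
  have u0: "u \<noteq> 0" "\<tau> u \<noteq> 0" using au tu by auto
  have "\<tau> y ^ e = a * \<tau> u" using arg_cong[OF au(5), of \<tau>] tG fixedD[OF au(1) tG] by simp
  hence "(\<tau> y / y) ^ e = a * \<tau> u / (a * u)" by (simp only: power_divide au(5))
  hence pow: "(\<tau> y / y) ^ e = \<tau> u / u" using au by simp
  have q: "\<tau> u / u \<in> R" "\<tau> u / u \<notin> J" "u / \<tau> u \<notin> J" "u / \<tau> u \<in> R"
    using max.loc.divide_mem[OF tu(1) au(3,4)] max.loc.divide_mem[OF au(3) tu]
      max.loc.unit_notin_J[of "\<tau> u / u"] max.loc.unit_notin_J[of "u / \<tau> u"] u0 by auto
  show 1: "\<tau> y / y \<in> R"
  proof (rule ccontr)
    assume "\<tau> y / y \<notin> R"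
    hence J: "inverse (\<tau> y / y) \<in> J" using R.notin_inverse by blast
    have "inverse (\<tau> y / y) ^ e \<in> J"
      using ram_pos max.loc.ideal_mult_left[OF max.loc.power_mem[OF max.loc.ideal_sub[OF J]] J, of "e - 1"]
      by (metis One_nat_def Suc_pred power_Suc2)
    moreover have "inverse (\<tau> y / y) ^ e = u / \<tau> u" using pow by (metis inverse_divide power_inverse)
    ultimately show False using q by simp
  qed
  show "\<tau> y / y \<notin> J"
  proof
    assume J: "\<tau> y / y \<in> J"
    have "(\<tau> y / y) ^ e \<in> J"
      using ram_pos max.loc.ideal_mult_left[OF max.loc.power_mem[OF 1] J, of "e - 1"]
      by (metis One_nat_def Suc_pred power_Suc2)
    thus False using pow q by simp
  qed
qed

text \<open>With \<open>d = \<tau> z / z - 1\<close> and \<open>z ^ e = a * u\<close>, expanding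
  \<open>(1 + d) ^ e = \<tau> u / u\<close> gives
  \<open>d * (e + d * r) = (\<tau> u - u) / u\<close>. By tameness the bracket is a unit, so
  \<open>d\<close> has the value of a difference on \<open>R\<close>.\<close>

lemma quotient_diff_divisible:
  assumes t: "\<tau> \<in> T" and x0: "\<tau> x0 - x0 \<noteq> 0" "\<And>x. x \<in> R \<Longrightarrow> (\<tau> x - x) / (\<tau> x0 - x0) \<in> R"
    and z: "z \<noteq> 0" "\<tau> z / z - 1 \<in> J"
  shows "(\<tau> z / z - 1) / (\<tau> x0 - x0) \<in> R"
proof -
  obtain a u where au: "a \<in> F" "a \<noteq> 0" "u \<in> R" "u \<notin> J" "z ^ e = a * u" using z(1) by (rule power_e)
  have tG: "\<tau> \<in> G" by (rule T_G[OF t])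
  define d where "d = \<tau> z / z - 1"
  have d: "d \<in> J" "d \<in> R" using z max.loc.ideal_sub by (auto simp: d_def)
  have u0: "u \<noteq> 0" using au by auto
  have "\<tau> z ^ e = a * \<tau> u" using arg_cong[OF au(5), of \<tau>] tG fixedD[OF au(1) tG] by simp
  hence "(\<tau> z / z) ^ e = a * \<tau> u / (a * u)" by (simp only: power_divide au(5))
  hence pow: "(1 + d) ^ e = \<tau> u / u" using au by (simp add: d_def)
  have "\<exists>r\<in>R. poly (monom 1 e) (1 + d) = poly (monom 1 e) 1 + d * poly (pderiv (monom 1 e)) 1 + d * d * r"
    by (rule poly_taylor[OF max.loc.subring]) (use d in auto)
  then obtain r where
    r: "r \<in> R" "poly (monom 1 e) (1 + d) = poly (monom 1 e) 1 + d * poly (pderiv (monom 1 e)) 1 + d * d * r"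
    by blast
  have "(1 + d) ^ e = 1 + d * of_nat e + d * d * r"
    using r(2) by (simp add: poly_monom pderiv_monom)
  hence "d * (of_nat e + d * r) = \<tau> u / u - 1" using pow by (simp add: algebra_simps)
  also have "\<dots> = (\<tau> u - u) / u" using u0 by (simp add: diff_divide_distrib)
  finally have eq: "d * (of_nat e + d * r) = (\<tau> u - u) / u" .
  have n: "of_nat e + d * r \<notin> J"
  proof
    assume "of_nat e + d * r \<in> J"
    from max.loc.ideal_diff[OF this max.loc.ideal_mult_right[OF r(1) d(1)]] show False using e_notin_J by simp
  qed
  have nR: "of_nat e + d * r \<in> R" using d r by (intro max.loc.add_mem max.loc.mult_mem) auto
  have un: "u * (of_nat e + d * r) \<in> R" "u * (of_nat e + d * r) \<notin> J"
    using nR n au max.loc.J_prime[of u] by auto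
  have n0: "of_nat e + d * r \<noteq> 0" using n by (metis max.loc.ideal_zero)
  have "d * w = x / u \<Longrightarrow> w \<noteq> 0 \<Longrightarrow> d = x / (u * w)" for w x
    using u0 by (simp add: field_simps)
  from this[OF eq n0] have "d = (\<tau> u - u) / (u * (of_nat e + d * r))" .
  hence "d / (\<tau> x0 - x0) = (\<tau> u - u) / (\<tau> x0 - x0) / (u * (of_nat e + d * r))"
    by (metis divide_divide_eq_left mult.commute)
  also have "\<dots> \<in> R" by (rule max.loc.divide_mem[OF x0(2)[OF au(3)] un])
  finally show ?thesis by (simp add: d_def)
qed

text \<open>If the character were trivial modulo \<open>J\<close>, then for \<open>z\<close> in
  \<open>J\<close> the difference \<open>z * (\<tau> z / z - 1)\<close> would have larger value than
  the least one, which \<open>ex_min_diff_in_J\<close> attains on \<open>J\<close>.\<close>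

lemma not_wild:
  assumes t: "\<tau> \<in> T" "\<tau> \<noteq> id"
  shows "\<exists>y. y \<noteq> 0 \<and> \<tau> y / y - 1 \<notin> J"
proof (rule ccontr)
  assume no: "\<not> ?thesis"
  obtain x0 where x0: "x0 \<in> R" "\<tau> x0 - x0 \<noteq> 0" "\<And>x. x \<in> R \<Longrightarrow> (\<tau> x - x) / (\<tau> x0 - x0) \<in> R"
    using ex_min_diff[OF t] by blast
  obtain z where z: "z \<in> J" "(\<tau> z - z) / (\<tau> x0 - x0) \<in> R" "(\<tau> z - z) / (\<tau> x0 - x0) \<notin> J"
    using ex_min_diff_in_J[OF t(1) x0(1,2)] by blast
  have z0: "z \<noteq> 0" using z(3) T_G[OF t(1)] by auto
  have "(\<tau> z / z - 1) / (\<tau> x0 - x0) \<in> R"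
    by (rule quotient_diff_divisible[OF t(1) x0(2,3) z0]) (use no z0 in auto)
  hence "z * ((\<tau> z / z - 1) / (\<tau> x0 - x0)) \<in> J" using z(1) by blast
  moreover have "z * ((\<tau> z / z - 1) / (\<tau> x0 - x0)) = (\<tau> z - z) / (\<tau> x0 - x0)"
    using z0 by (simp add: right_diff_distrib)
  ultimately show False using z(3) by metis
qed

text \<open>Write the \<open>z\<close> of \<open>ex_min_diff_in_J\<close> as
  \<open>\<omega> * w\<close>. If \<open>\<omega>\<close> had trivial quotient, both terms in the
  product rule for \<open>\<tau> z - z\<close> would be \<open>\<omega>\<close> times a multiple of
  the least difference.\<close>

lemma uniformizer_moved:
  assumes t: "\<tau> \<in> T" "\<tau> \<noteq> id"
    and P: "\<omega> \<in> J" "\<omega> \<noteq> 0" "\<And>a. a \<in> J \<Longrightarrow> a / \<omega> \<in> R"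
  shows "\<tau> \<omega> / \<omega> - 1 \<notin> J"
proof
  assume cong: "\<tau> \<omega> / \<omega> - 1 \<in> J"
  obtain x0 where x0: "x0 \<in> R" "\<tau> x0 - x0 \<noteq> 0" "\<And>x. x \<in> R \<Longrightarrow> (\<tau> x - x) / (\<tau> x0 - x0) \<in> R"
    using ex_min_diff[OF t] by blast
  obtain z where z: "z \<in> J" "(\<tau> z - z) / (\<tau> x0 - x0) \<in> R" "(\<tau> z - z) / (\<tau> x0 - x0) \<notin> J"
    using ex_min_diff_in_J[OF t(1) x0(1,2)] by blast
  have 1: "(\<tau> \<omega> / \<omega> - 1) / (\<tau> x0 - x0) \<in> R"
    by (rule quotient_diff_divisible[OF t(1) x0(2,3) P(2) cong])
  define w where "w = z / \<omega>"
  have w: "w \<in> R" "z = \<omega> * w" using P z by (auto simp: w_def)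
  have tw: "\<tau> w \<in> R" by (rule D_R[OF T_D[OF t(1)] w(1)])
  have "\<omega> * ((\<tau> w - w) / (\<tau> x0 - x0) + (\<tau> \<omega> / \<omega> - 1) / (\<tau> x0 - x0) * \<tau> w) \<in> J"
    using x0(3)[OF w(1)] 1 tw P(1) by blast
  also have "\<omega> * ((\<tau> w - w) / (\<tau> x0 - x0) + (\<tau> \<omega> / \<omega> - 1) / (\<tau> x0 - x0) * \<tau> w)
      = (\<tau> z - z) / (\<tau> x0 - x0)"
  proof -
    have "p * ((b - c) / y + (a / p - 1) / y * b) = (a * b - p * c) / y" if "p \<noteq> 0" "y \<noteq> 0" for p a b c y :: 'k
      using that by (simp add: field_simps)
    from this[OF P(2) x0(2)] show ?thesis unfolding w(2) using T_G[OF t(1)] by simp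
  qed
  finally show False using z(3) by simp
qed

text \<open>The characters \<open>\<tau> y / y\<close> are distinct modulo \<open>J\<close> by
  \<open>not_wild\<close>, hence independent, so their sum over \<open>T\<close> is nonzero at some
  \<open>y\<close>. Invariance of the sum forces every character to be trivial at this
  \<open>y\<close>, where the sum is therefore the order of \<open>T\<close>.\<close>

lemma card_T_notin_J: "of_nat (card T) \<notin> J"
proof -
  let ?\<chi> = "\<lambda>\<tau> y. \<tau> y / y :: 'k"
  have "\<exists>y. y \<noteq> 0 \<and> (\<Sum>\<tau>\<in>T. ?\<chi> \<tau> y) \<notin> J"
  proof (rule ccontr)
    assume "\<not> ?thesis"
    hence rel: "(\<Sum>\<tau>\<in>T. 1 * ?\<chi> \<tau> y) \<in> J" if "y \<in> UNIV - {0}" for y using that by auto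
    have "\<forall>\<tau>\<in>T. 1 \<in> J"
    proof (rule max.loc.independent_characters[where \<chi> = ?\<chi> and X = "UNIV - {0}"])
      fix \<sigma> \<tau> assume s: "\<sigma> \<in> T" "\<tau> \<in> T" "\<sigma> \<noteq> \<tau>"
      \<comment> \<open>The difference of the two characters is
        \<open>\<tau> (?\<rho> y / y - 1)\<close> times the unit
        \<open>\<tau> y / y\<close>.\<close>
      let ?\<rho> = "inv \<tau> \<circ> \<sigma>"
      have "?\<rho> \<noteq> id"
      proof
        assume "?\<rho> = id"
        hence "\<tau> \<circ> ?\<rho> = \<tau>" by simp
        thus False using s by simp
      qed
      moreover have \<rho>: "?\<rho> \<in> T" using s by auto
      ultimately obtain y where y: "y \<noteq> 0" "?\<rho> y / y - 1 \<notin> J" using not_wild by blast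
      have q: "?\<rho> y / y - 1 \<in> R" using T_quotient_unit(1)[OF \<rho> y(1)] by auto
      have tD: "\<tau> \<in> D" by (rule T_D[OF s(2)])
      have "\<tau> (?\<rho> y / y - 1) \<notin> J" using D_J[OF tD q] y(2) by simp
      moreover have "\<tau> (?\<rho> y / y - 1) \<in> R" by (rule D_R[OF tD q])
      ultimately have "\<tau> (?\<rho> y / y - 1) * (\<tau> y / y) \<notin> J"
        using max.loc.J_prime T_quotient_unit[OF s(2) y(1)] by blast
      also have "\<tau> (?\<rho> y / y - 1) * (\<tau> y / y) = \<sigma> y / y - \<tau> y / y"
        using tD y(1) by (simp add: field_simps)
      finally show "\<exists>x\<in>UNIV - {0}. ?\<chi> \<sigma> x - ?\<chi> \<tau> x \<notin> J" using y(1) by blast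
    next
      fix \<tau> assume t: "\<tau> \<in> T"
      show "\<exists>x\<in>UNIV - {0}. ?\<chi> \<tau> x \<notin> J" using T_quotient_unit(2)[OF t, of 1] by (intro bexI[of _ 1]) auto
    qed (use T_quotient_unit(1) rel in auto)
    hence "1 \<in> J" using T.id_mem by blast
    thus False by simp
  qed
  then obtain y where y: "y \<noteq> 0" "(\<Sum>\<tau>\<in>T. ?\<chi> \<tau> y) \<notin> J" by blast
  define s where "s = (\<Sum>\<tau>\<in>T. ?\<chi> \<tau> y)"
  have sR: "s \<in> R" unfolding s_def using T_quotient_unit(1)[OF _ y(1)] by (rule max.loc.sum_mem)
  \<comment> \<open>As \<open>T\<close> acts trivially on residues, passing from
    \<open>\<tau>\<close> to \<open>\<sigma> \<circ> \<tau>\<close> multiplies each summand by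
    \<open>?\<chi> \<sigma> y\<close> modulo \<open>J\<close>, but only permutes the sum; so
    \<open>s\<close> is congruent to \<open>s * ?\<chi> \<sigma> y\<close>.\<close>
  have triv: "?\<chi> \<sigma> y - 1 \<in> J" if \<sigma>: "\<sigma> \<in> T" for \<sigma>
  proof -
    have "?\<chi> (\<sigma> \<circ> \<tau>) y - ?\<chi> \<tau> y * ?\<chi> \<sigma> y \<in> J" if \<tau>: "\<tau> \<in> T" for \<tau>
    proof -
      have "(\<sigma> (?\<chi> \<tau> y) - ?\<chi> \<tau> y) * ?\<chi> \<sigma> y \<in> J"
        by (rule max.loc.ideal_mult_right[OF T_quotient_unit(1)[OF \<sigma> y(1)] T_cong[OF \<sigma> T_quotient_unit(1)[OF \<tau> y(1)]]])
      moreover have "(\<sigma> (?\<chi> \<tau> y) - ?\<chi> \<tau> y) * ?\<chi> \<sigma> y = ?\<chi> (\<sigma> \<circ> \<tau>) y - ?\<chi> \<tau> y * ?\<chi> \<sigma> y"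
        using \<sigma> y(1) by (simp add: field_simps)
      ultimately show ?thesis by simp
    qed
    hence "(\<Sum>\<tau>\<in>T. ?\<chi> (\<sigma> \<circ> \<tau>) y - ?\<chi> \<tau> y * ?\<chi> \<sigma> y) \<in> J" by (rule max.loc.ideal_sum)
    hence "(\<Sum>\<tau>\<in>T. ?\<chi> (\<sigma> \<circ> \<tau>) y) - s * ?\<chi> \<sigma> y \<in> J"
      by (simp only: sum_subtractf s_def sum_distrib_right)
    hence "s - s * ?\<chi> \<sigma> y \<in> J" using T.sum_left_shift[OF \<sigma>, of "\<lambda>\<tau>. ?\<chi> \<tau> y"] by (simp only: s_def)
    moreover have "s - s * ?\<chi> \<sigma> y = s * (1 - ?\<chi> \<sigma> y)" by (simp add: algebra_simps)
    moreover have "1 - ?\<chi> \<sigma> y \<in> R" using T_quotient_unit(1)[OF \<sigma> y(1)] by auto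
    ultimately have "1 - ?\<chi> \<sigma> y \<in> J" using max.loc.J_prime[OF sR] y(2) by (auto simp: s_def)
    from max.loc.ideal_uminus[OF this] show ?thesis by simp
  qed
  hence "(\<Sum>\<tau>\<in>T. ?\<chi> \<tau> y - 1) \<in> J" by (rule max.loc.ideal_sum)
  hence d: "s - of_nat (card T) \<in> J" by (simp add: sum_subtractf s_def)
  show ?thesis
  proof
    assume "of_nat (card T) \<in> J"
    from max.loc.ideal_add[OF d this] show False using y(2) by (simp add: s_def)
  qed
qed

text \<open>Modulo \<open>M\<close>, \<open>D\<close> acts through the cosets of \<open>T\<close>.
  Representatives are distinct characters of \<open>S\<close>, so some \<open>t\<close> has nonzero
  sum over them; modulo \<open>M\<close> the trace over \<open>D\<close> is this sum times the order
  of \<open>T\<close>, which is a unit.\<close>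

lemma ex_decomp_trace: "\<exists>t\<in>S. (\<Sum>\<sigma>\<in>D. \<sigma> t) \<notin> M"
proof -
  define eqv where "eqv = (\<lambda>\<sigma> \<tau>. \<forall>x\<in>S. \<sigma> x - \<tau> x \<in> M)"
  have eqv_refl: "eqv \<sigma> \<sigma>" for \<sigma> by (simp add: eqv_def)
  have eqv_sym: "eqv \<tau> \<sigma>" if "eqv \<sigma> \<tau>" for \<sigma> \<tau>
    using that max.ideal_uminus unfolding eqv_def by (metis minus_diff_eq)
  have eqv_trans: "eqv \<sigma> \<rho>" if "eqv \<sigma> \<tau>" "eqv \<tau> \<rho>" for \<sigma> \<tau> \<rho>
    unfolding eqv_def
  proof
    fix x assume x: "x \<in> S"
    from max.ideal_add[OF bspec[OF that(1)[unfolded eqv_def] x] bspec[OF that(2)[unfolded eqv_def] x]]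
    show "\<sigma> x - \<rho> x \<in> M" by simp
  qed
  \<comment> \<open>The choice is made from the set of all equivalent elements, so that equivalent
    automorphisms get the same representative.\<close>
  define r where "r = (\<lambda>\<sigma>. SOME \<rho>. \<rho> \<in> {\<rho> \<in> D. eqv \<rho> \<sigma>})"
  have r: "r \<sigma> \<in> D" "eqv (r \<sigma>) \<sigma>" if "\<sigma> \<in> D" for \<sigma>
  proof -
    have "\<sigma> \<in> {\<rho> \<in> D. eqv \<rho> \<sigma>}" using that eqv_refl by simp
    hence "r \<sigma> \<in> {\<rho> \<in> D. eqv \<rho> \<sigma>}" unfolding r_def by (rule someI[where P = "\<lambda>\<rho>. \<rho> \<in> {\<rho> \<in> D. eqv \<rho> \<sigma>}"])
    thus "r \<sigma> \<in> D" "eqv (r \<sigma>) \<sigma>" by auto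
  qed
  have r_eq: "r \<sigma> = r \<tau>" if "eqv \<sigma> \<tau>" for \<sigma> \<tau>
  proof -
    have "{\<rho> \<in> D. eqv \<rho> \<sigma>} = {\<rho> \<in> D. eqv \<rho> \<tau>}" using that eqv_trans eqv_sym by blast
    thus ?thesis unfolding r_def by simp
  qed
  define D0 where "D0 = r ` D"
  have D0: "D0 \<subseteq> D" using r by (auto simp: D0_def)
  have r_D0: "r \<rho> = \<rho>" if "\<rho> \<in> D0" for \<rho> using that r r_eq unfolding D0_def by auto
  \<comment> \<open>\<open>\<sigma>\<close> is equivalent to \<open>\<rho>\<close> when
    \<open>inv \<rho> \<circ> \<sigma>\<close> is trivial modulo \<open>M\<close>, that is,
    inertial; hence each class contributes \<open>card T\<close> summands.\<close>
  have fib: "{\<sigma> \<in> D. r \<sigma> = \<rho>} = (\<lambda>\<tau>. \<rho> \<circ> \<tau>) ` T" if \<rho>: "\<rho> \<in> D0" for \<rho>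
  proof
    have \<rho>D: "\<rho> \<in> D" using \<rho> D0 by auto
    show "{\<sigma> \<in> D. r \<sigma> = \<rho>} \<subseteq> (\<lambda>\<tau>. \<rho> \<circ> \<tau>) ` T"
    proof
      fix \<sigma> assume "\<sigma> \<in> {\<sigma> \<in> D. r \<sigma> = \<rho>}"
      hence \<sigma>: "\<sigma> \<in> D" "r \<sigma> = \<rho>" by auto
      have "eqv \<sigma> \<rho>" using r(2)[OF \<sigma>(1)] \<sigma>(2) eqv_sym by simp
      have "inv \<rho> \<circ> \<sigma> \<in> T"
      proof (rule T_of_S_cong)
        show "inv \<rho> \<circ> \<sigma> \<in> G" by (rule D_G[OF D.comp_mem[OF D.inv_mem[OF \<rho>D] \<sigma>(1)]])
        fix x assume x: "x \<in> S"
        have "\<sigma> x - \<rho> x \<in> M" using \<open>eqv \<sigma> \<rho>\<close> x by (simp add: eqv_def)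
        moreover have "\<sigma> x - \<rho> x \<in> S" using S_stable[OF D_G[OF \<sigma>(1)] x] S_stable[OF D_G[OF \<rho>D] x] by auto
        ultimately have "inv \<rho> (\<sigma> x - \<rho> x) \<in> M" using D_M[OF D.inv_mem[OF \<rho>D]] by blast
        thus "(inv \<rho> \<circ> \<sigma>) x - x \<in> M" using \<rho>D by simp
      qed
      moreover have "\<sigma> = \<rho> \<circ> (inv \<rho> \<circ> \<sigma>)" using \<rho>D by simp
      ultimately show "\<sigma> \<in> (\<lambda>\<tau>. \<rho> \<circ> \<tau>) ` T" by blast
    qed
    show "(\<lambda>\<tau>. \<rho> \<circ> \<tau>) ` T \<subseteq> {\<sigma> \<in> D. r \<sigma> = \<rho>}"
    proof (intro image_subsetI CollectI conjI)
      fix \<tau> assume \<tau>: "\<tau> \<in> T"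
      show "\<rho> \<circ> \<tau> \<in> D" using \<rho>D T_D[OF \<tau>] by auto
      have "eqv (\<rho> \<circ> \<tau>) \<rho>" unfolding eqv_def
      proof
        fix x assume x: "x \<in> S"
        have "\<tau> x - x \<in> S" using S_stable[OF T_G[OF \<tau>] x] x by auto
        moreover have "\<tau> x - x \<in> M"
          using max.loc_ideal_Int[OF calculation T_cong[OF \<tau> S_sub_R[OF x]]] .
        ultimately have "\<rho> (\<tau> x - x) \<in> M" using D_M[OF \<rho>D] by blast
        thus "(\<rho> \<circ> \<tau>) x - \<rho> x \<in> M" using \<rho>D by simp
      qed
      thus "r (\<rho> \<circ> \<tau>) = \<rho>" using r_eq r_D0[OF \<rho>] by metis
    qed
  qed
  have "\<exists>t\<in>S. (\<Sum>\<rho>\<in>D0. \<rho> t) \<notin> J"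
  proof (rule ccontr)
    assume "\<not> ?thesis"
    hence rel: "(\<Sum>\<rho>\<in>D0. 1 * \<rho> t) \<in> J" if "t \<in> S" for t using that by auto
    have "\<forall>\<rho>\<in>D0. 1 \<in> J"
    proof (rule max.loc.independent_characters[where \<chi> = "\<lambda>\<rho>. \<rho>" and X = S])
      show "finite D0" by (simp add: D0_def)
      show "\<rho> x \<in> R" if "\<rho> \<in> D0" "x \<in> S" for \<rho> x
        by (rule S_sub_R[OF S_stable[OF D_G[OF subsetD[OF D0 that(1)]] that(2)]])
      show "\<rho> (x * y) = \<rho> x * \<rho> y" if "\<rho> \<in> D0" for \<rho> x y using subsetD[OF D0 that] by simp
      show "\<exists>x\<in>S. \<rho> x \<notin> J" if "\<rho> \<in> D0" for \<rho>
        using subsetD[OF D0 that] by (intro bexI[of _ 1]) auto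
      show "(\<Sum>\<rho>\<in>D0. 1 * \<rho> x) \<in> J" if "x \<in> S" for x by (rule rel[OF that])
      show "\<exists>x\<in>S. \<rho> x - \<rho>' x \<notin> J" if \<rho>: "\<rho> \<in> D0" "\<rho>' \<in> D0" "\<rho> \<noteq> \<rho>'" for \<rho> \<rho>'
      proof (rule ccontr)
        assume n: "\<not> ?thesis"
        have "eqv \<rho> \<rho>'" unfolding eqv_def
        proof
          fix x assume x: "x \<in> S"
          have "\<rho> x - \<rho>' x \<in> S"
            using S_stable[OF D_G[OF subsetD[OF D0 \<rho>(1)]] x] S_stable[OF D_G[OF subsetD[OF D0 \<rho>(2)]] x] by auto
          thus "\<rho> x - \<rho>' x \<in> M" using n x max.loc_ideal_Int by blast
        qed
        thus False using r_eq r_D0[OF \<rho>(1)] r_D0[OF \<rho>(2)] \<rho>(3) by metis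
      qed
    qed auto
    moreover have "r id \<in> D0" by (simp add: D0_def)
    ultimately show False by auto
  qed
  then obtain t where t: "t \<in> S" "(\<Sum>\<rho>\<in>D0. \<rho> t) \<notin> J" by blast
  have "(\<Sum>\<sigma>\<in>D. \<sigma> t) = (\<Sum>\<rho>\<in>D0. \<Sum>\<sigma>\<in>{\<sigma> \<in> D. r \<sigma> = \<rho>}. \<sigma> t)"
    unfolding D0_def by (rule sum.image_gen) simp
  also have "\<dots> = (\<Sum>\<rho>\<in>D0. \<Sum>\<tau>\<in>T. \<rho> (\<tau> t))"
  proof (rule sum.cong[OF refl])
    fix \<rho> assume \<rho>: "\<rho> \<in> D0"
    have inj: "inj_on (\<lambda>\<tau>. \<rho> \<circ> \<tau>) T"
      using subsetD[OF D0 \<rho>] by (intro inj_onI) (metis D.inv_comp_comp)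
    show "(\<Sum>\<sigma>\<in>{\<sigma> \<in> D. r \<sigma> = \<rho>}. \<sigma> t) = (\<Sum>\<tau>\<in>T. \<rho> (\<tau> t))"
      unfolding fib[OF \<rho>] by (subst sum.reindex[OF inj]) simp
  qed
  finally have sum_eq: "(\<Sum>\<sigma>\<in>D. \<sigma> t) = (\<Sum>\<rho>\<in>D0. \<Sum>\<tau>\<in>T. \<rho> (\<tau> t))" .
  have "(\<Sum>\<rho>\<in>D0. \<Sum>\<tau>\<in>T. \<rho> (\<tau> t) - \<rho> t) \<in> J"
  proof (intro max.loc.ideal_sum)
    fix \<rho> \<tau> assume \<rho>: "\<rho> \<in> D0" and \<tau>: "\<tau> \<in> T"
    have \<rho>D: "\<rho> \<in> D" using \<rho> D0 by auto
    have c: "\<tau> t - t \<in> J" by (rule T_cong[OF \<tau> S_sub_R[OF t(1)]])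
    have "\<rho> (\<tau> t - t) \<in> J" using D_J[OF \<rho>D max.loc.ideal_sub[OF c]] c by simp
    thus "\<rho> (\<tau> t) - \<rho> t \<in> J" using \<rho>D by simp
  qed
  moreover have "(\<Sum>\<rho>\<in>D0. \<Sum>\<tau>\<in>T. \<rho> (\<tau> t) - \<rho> t) = (\<Sum>\<sigma>\<in>D. \<sigma> t) - of_nat (card T) * (\<Sum>\<rho>\<in>D0. \<rho> t)"
    unfolding sum_eq by (simp add: sum_subtractf sum_distrib_left)
  ultimately have d: "(\<Sum>\<sigma>\<in>D. \<sigma> t) - of_nat (card T) * (\<Sum>\<rho>\<in>D0. \<rho> t) \<in> J" by simp
  have "(\<Sum>\<rho>\<in>D0. \<rho> t) \<in> R"
    by (rule max.loc.sum_mem) (rule S_sub_R[OF S_stable[OF D_G[OF subsetD[OF D0]] t(1)]])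
  hence n: "of_nat (card T) * (\<Sum>\<rho>\<in>D0. \<rho> t) \<notin> J"
    using max.loc.J_prime[of "of_nat (card T)"] card_T_notin_J t(2) by auto
  have "(\<Sum>\<sigma>\<in>D. \<sigma> t) \<notin> J"
  proof
    assume "(\<Sum>\<sigma>\<in>D. \<sigma> t) \<in> J"
    from max.loc.ideal_diff[OF this d] show False using n by simp
  qed
  thus ?thesis using t(1) max.ideal_sub_loc by blast
qed

section \<open>Orders in the inertia group and the cocycle restricted to it\<close>

lemma funpow_T: "\<tau> \<in> T \<Longrightarrow> \<tau> ^^ n \<in> T"
proof (induction n)
  case 0
  thus ?case by (simp add: id_def[symmetric])
next
  case (Suc n)
  thus ?case using T.comp_mem[of \<tau> "\<tau> ^^ n"] unfolding funpow.simps by blast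
qed

lemma ex_order:
  assumes t: "\<tau> \<in> T"
  obtains l where "l > 0" "\<tau> ^^ l = id" "\<And>j. 0 < j \<Longrightarrow> j < l \<Longrightarrow> \<tau> ^^ j \<noteq> id"
proof -
  have "\<not> inj (\<lambda>n. \<tau> ^^ n)"
  proof
    assume "inj (\<lambda>n. \<tau> ^^ n)"
    hence "infinite (range (\<lambda>n. \<tau> ^^ n))" using finite_imageD infinite_UNIV_nat by blast
    moreover have "range (\<lambda>n. \<tau> ^^ n) \<subseteq> T" using funpow_T[OF t] by auto
    ultimately show False using T.finite_G finite_subset by blast
  qed
  then obtain a b where ab: "\<tau> ^^ a = \<tau> ^^ b" "a < b" unfolding inj_def by (metis nat_neq_iff)
  have "\<tau> ^^ (b - a) = id"
  proof -
    have "\<tau> ^^ a \<circ> \<tau> ^^ (b - a) = \<tau> ^^ (a + (b - a))" by (rule funpow_add[symmetric])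
    also have "\<dots> = \<tau> ^^ a" using ab by simp
    finally have "\<tau> ^^ a \<circ> \<tau> ^^ (b - a) = \<tau> ^^ a" .
    hence "inv (\<tau> ^^ a) \<circ> (\<tau> ^^ a \<circ> \<tau> ^^ (b - a)) = inv (\<tau> ^^ a) \<circ> \<tau> ^^ a" by simp
    thus ?thesis using funpow_T[OF t, of a] by simp
  qed
  hence ex: "\<exists>l. l > 0 \<and> \<tau> ^^ l = id" using ab by (intro exI[of _ "b - a"]) auto
  define l where "l = (LEAST l. l > 0 \<and> \<tau> ^^ l = id)"
  have "l > 0 \<and> \<tau> ^^ l = id" unfolding l_def by (rule LeastI_ex[OF ex])
  moreover have "\<tau> ^^ j \<noteq> id" if "0 < j" "j < l" for j
    using not_less_Least[of j "\<lambda>l. l > 0 \<and> \<tau> ^^ l = id"] that unfolding l_def by auto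
  ultimately show thesis using that by blast
qed

text \<open>If \<open>f(\<tau>, \<tau>\<^sup>-\<^sup>1)\<close> were a uniformizer, then \<open>x_\<tau>\<close> to the order \<open>l\<close> of \<open>\<tau>\<close> would be an element
  of the fixed field of \<open>\<tau>\<close> whose value is a multiple \<open>j\<close> of the value of the uniformizer with
  \<open>0 < j < l\<close>. Tame ramification rules this out.\<close>

lemma inertia_cocycle_unit:
  assumes cr: "crossed G S f"
    and sq: "\<And>\<sigma>. \<sigma> \<in> T \<Longrightarrow> f \<sigma> (inv \<sigma>) \<notin> ideal_prod M M"
    and t: "\<tau> \<in> T"
  shows "f \<tau> (inv \<tau>) \<notin> M"
proof
  interpret crossed G S f by (rule cr)
  define \<omega> where "\<omega> = f \<tau> (inv \<tau>)"
  assume "f \<tau> (inv \<tau>) \<in> M"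
  hence \<omega>M: "\<omega> \<in> M" by (simp add: \<omega>_def)
  have tG: "\<tau> \<in> G" and tD: "\<tau> \<in> D" using T_G[OF t] T_D[OF t] .
  have \<omega>0: "\<omega> \<noteq> 0" using tG by (simp add: \<omega>_def)
  have \<omega>J: "\<omega> \<in> J" using max.ideal_sub_loc[OF \<omega>M] .
  have \<omega>S: "\<omega> \<in> S" using max.ideal_sub[OF \<omega>M] .
  \<comment> \<open>\<open>\<omega>\<close> is a uniformizer: if it did not divide \<open>a\<close>,
    then \<open>\<omega> / a\<close> would lie in \<open>J\<close> and \<open>\<omega>\<close> in
    the square of \<open>M\<close>.\<close>
  have \<omega>_div: "a / \<omega> \<in> R" if a: "a \<in> J" for a
  proof (rule ccontr)
    assume n: "a / \<omega> \<notin> R"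
    hence "a \<noteq> 0" by auto
    have "inverse (a / \<omega>) \<in> J" using R.notin_inverse[OF n] by simp
    hence "\<omega> / a \<in> J" by simp
    hence "\<omega> \<in> ideal_prod M M" using max.loc_sq_mult[OF \<omega>S a, of "\<omega> / a"] \<open>a \<noteq> 0\<close> by simp
    thus False using sq[OF t] by (simp add: \<omega>_def)
  qed
  have f_sq: "f \<sigma> \<rho> \<notin> ideal_prod M M" if s: "\<sigma> \<in> T" "\<rho> \<in> T" for \<sigma> \<rho>
  proof
    assume 1: "f \<sigma> \<rho> \<in> ideal_prod M M"
    have "\<sigma> (f (inv \<sigma>) (\<sigma> \<circ> \<rho>)) \<in> S"
      by (rule stable[OF T_G[OF s(1)] f_mem]) (use s T_G in auto)
    from max.sq.ideal_mult_right[OF this 1] show False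
      using f_dvd[OF T_G[OF s(1)] T_G[OF s(2)]] sq[OF s(1)] by simp
  qed
  obtain l where l: "l > 0" "\<tau> ^^ l = id" "\<And>j. 0 < j \<Longrightarrow> j < l \<Longrightarrow> \<tau> ^^ j \<noteq> id"
    using ex_order[OF t] by blast
  have pT: "\<tau> ^^ i \<in> T" and pG: "\<tau> ^^ i \<in> G" for i using funpow_T[OF t] T_G by auto
  define g where "g = (\<lambda>i. f (\<tau> ^^ i) \<tau>)"
  define h where "h = (\<lambda>i. f \<tau> (\<tau> ^^ i))"
  have g0: "g i \<noteq> 0" and gS: "g i \<in> S" for i using pG tG by (auto simp: g_def)
  have h0: "h i \<noteq> 0" for i using pG tG by (simp add: h_def)
  \<comment> \<open>Cocycle identity for \<open>\<tau>\<close>, \<open>\<tau> ^^ i\<close>,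
    \<open>\<tau>\<close>. Multiplied over a full period, the factors \<open>h\<close> cancel and
    invariance of \<open>u\<close> remains.\<close>
  have cyc: "\<tau> (g i) * h (Suc i) = h i * g (Suc i)" for i
    using cocycle[OF tG pG tG, of i] by (simp add: g_def h_def funpow_swap1[of \<tau>] funpow_Suc_right[symmetric] del: funpow.simps) (simp add: funpow_Suc_right)
  have shift: "(\<Prod>i<l. p (Suc i)) = (\<Prod>i<l. p i)" if "p l = p 0" "p 0 \<noteq> 0" for p :: "nat \<Rightarrow> 'k"
  proof -
    have "p 0 * (\<Prod>i<l. p (Suc i)) = (\<Prod>i<Suc l. p i)" by (rule prod.lessThan_Suc_shift[symmetric])
    also have "\<dots> = p 0 * (\<Prod>i<l. p i)" using that by (simp add: mult.commute)
    finally show ?thesis using that by simp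
  qed
  have gl: "g l = g 0" "h l = h 0" using l(2) by (auto simp: g_def h_def id_def)
  \<comment> \<open>The scalar with \<open>x_\<tau>^l = u x_1\<close>.\<close>
  define u where "u = (\<Prod>i<l. g i)"
  have "\<tau> u * (\<Prod>i<l. h (Suc i)) = (\<Prod>i<l. h i) * (\<Prod>i<l. g (Suc i))"
    unfolding u_def using tG by (simp add: prod.distrib[symmetric] cyc)
  hence "\<tau> u * (\<Prod>i<l. h i) = (\<Prod>i<l. h i) * u"
    unfolding shift[OF gl(1) g0] shift[OF gl(2) h0] u_def .
  hence u_fixed: "\<tau> u = u" using h0 by simp
  \<comment> \<open>A factor \<open>g i\<close> in \<open>M\<close> is \<open>\<omega>\<close> times
    a unit, as it avoids the square; so \<open>j\<close> is the exponent of \<open>\<omega>\<close>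
    in \<open>u\<close>.\<close>
  define A where "A = {i \<in> {..<l}. g i \<in> M}"
  define j where "j = card A"
  define \<epsilon> where "\<epsilon> = (\<Prod>i<l. if i \<in> A then g i / \<omega> else g i)"
  have fac: "(if i \<in> A then g i / \<omega> else g i) \<in> R \<and> (if i \<in> A then g i / \<omega> else g i) \<notin> J" if i: "i < l" for i
  proof (cases "i \<in> A")
    case True
    have gJ: "g i \<in> J" using True max.ideal_sub_loc by (simp add: A_def)
    have "g i / \<omega> \<notin> J"
    proof
      assume "g i / \<omega> \<in> J"
      hence "g i \<in> ideal_prod M M" using max.loc_sq_mult[OF gS \<omega>J, of "g i / \<omega>"] \<omega>0 by simp
      thus False using f_sq[OF pT t] by (simp add: g_def)
    qed
    thus ?thesis using True \<omega>_div[OF gJ] by simp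
  next
    case False
    hence "g i \<notin> J" using i max.loc_ideal_Int[OF gS] by (auto simp: A_def)
    thus ?thesis using False S_sub_R[OF gS] by simp
  qed
  have \<epsilon>R: "\<epsilon> \<in> R" unfolding \<epsilon>_def using fac by (intro max.loc.prod_mem) auto
  have \<epsilon>J: "\<epsilon> \<notin> J"
  proof -
    have "(\<Prod>i\<in>X. if i \<in> A then g i / \<omega> else g i) \<in> R \<and> (\<Prod>i\<in>X. if i \<in> A then g i / \<omega> else g i) \<notin> J"
      if "finite X" "X \<subseteq> {..<l}" for X
      using that
    proof (induction X rule: finite_induct)
      case (insert i X)
      define p where "p = (\<Prod>i\<in>X. if i \<in> A then g i / \<omega> else g i)"
      define q where "q = (if i \<in> A then g i / \<omega> else g i)"
      have "p \<in> R" "p \<notin> J" using insert by (auto simp: p_def)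
      moreover have "q \<in> R" "q \<notin> J" using fac[of i] insert by (auto simp: q_def)
      ultimately have "q * p \<in> R" "q * p \<notin> J" using max.loc.J_prime[of q p] by auto
      thus ?case using insert by (simp add: p_def q_def)
    qed simp
    thus ?thesis unfolding \<epsilon>_def by blast
  qed
  have u_eq: "u = \<omega> ^ j * \<epsilon>"
  proof -
    have "u = (\<Prod>i<l. (if i \<in> A then \<omega> else 1) * (if i \<in> A then g i / \<omega> else g i))"
      unfolding u_def using \<omega>0 by (intro prod.cong) auto
    also have "\<dots> = (\<Prod>i<l. if i \<in> A then \<omega> else 1) * \<epsilon>" by (simp only: prod.distrib \<epsilon>_def)
    also have "(\<Prod>i<l. if i \<in> A then \<omega> else 1) = (\<Prod>i\<in>A. \<omega>)"
      by (rule prod.mono_neutral_cong_right) (auto simp: A_def)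
    finally show ?thesis by (simp add: j_def)
  qed
  \<comment> \<open>\<open>g (l - 1)\<close> is \<open>f (inv \<tau>) \<tau>\<close>, which
    \<open>\<tau>\<close> maps to \<open>\<omega>\<close>. This gives \<open>0 < j\<close>.\<close>
  have "l - 1 \<in> A"
  proof -
    have "\<tau> ^^ (l - 1) = inv \<tau>"
    proof -
      have "\<tau> \<circ> \<tau> ^^ (l - 1) = id" using l(1,2) by (metis Suc_pred' funpow.simps(2))
      hence "inv \<tau> \<circ> (\<tau> \<circ> \<tau> ^^ (l - 1)) = inv \<tau>" by simp
      thus ?thesis using tG by simp
    qed
    hence "\<tau> (g (l - 1)) = \<omega>" using f_inv[OF tG] by (simp add: g_def \<omega>_def)
    hence "g (l - 1) \<in> M" using D_M[OF tD gS, of "l - 1"] \<omega>M by simp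
    thus ?thesis using l(1) by (simp add: A_def)
  qed
  hence j0: "0 < j" unfolding j_def by (intro card_gt_0_iff[THEN iffD2]) (auto simp: A_def)
  \<comment> \<open>By normalization \<open>g 0 = f id \<tau> = 1\<close>. This gives
    \<open>j < l\<close>.\<close>
  have "0 \<notin> A" using tG by (simp add: A_def g_def id_def[symmetric])
  hence "A \<subseteq> {..<l} - {0}" by (auto simp: A_def)
  hence "card A \<le> card ({..<l} - {0})" by (intro card_mono) auto
  hence jl: "j < l" using l(1) by (simp add: j_def)
  define \<chi> where "\<chi> = \<tau> \<omega> / \<omega>"
  have \<chi>R: "\<chi> \<in> R" unfolding \<chi>_def by (rule T_quotient_unit(1)[OF t \<omega>0])
  have te: "\<tau> \<epsilon> \<in> R" "\<tau> \<epsilon> \<notin> J" using D_R[OF tD \<epsilon>R] D_J[OF tD \<epsilon>R] \<epsilon>J by auto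
  have te0: "\<tau> \<epsilon> \<noteq> 0" using te(2) by auto
  \<comment> \<open>Invariance of \<open>u\<close> turns \<open>\<chi> ^ j\<close> into
    \<open>\<epsilon> / \<tau> \<epsilon>\<close>, which is 1 modulo \<open>J\<close> since
    \<open>\<epsilon>\<close> is a unit and \<open>\<tau>\<close> inertial.\<close>
  have "\<tau> \<omega> ^ j * \<tau> \<epsilon> = \<omega> ^ j * \<epsilon>" using u_fixed tG unfolding u_eq by simp
  hence "\<chi> ^ j = \<epsilon> / \<tau> \<epsilon>" using \<omega>0 te0 by (simp add: \<chi>_def power_divide field_simps)
  hence "\<chi> ^ j - 1 = - (\<tau> \<epsilon> - \<epsilon>) * (1 / \<tau> \<epsilon>)" using te0 by (simp add: field_simps)
  also have "\<dots> \<in> J"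
    using max.loc.ideal_mult_right[OF max.loc.divide_mem[OF max.loc.one_mem te] max.loc.ideal_uminus[OF T_cong[OF t \<epsilon>R]]] .
  finally have \<chi>j: "\<chi> ^ j - 1 \<in> J" .
  \<comment> \<open>As \<open>\<tau>\<close> is trivial on residues, the quotients of
    \<open>\<omega>\<close> are multiplicative in powers of \<open>\<tau>\<close>; so
    \<open>\<tau> ^^ j\<close>, which is not the identity, would have trivial quotient at
    \<open>\<omega>\<close>.\<close>
  have pow: "(\<tau> ^^ i) \<omega> / \<omega> - \<chi> ^ i \<in> J" for i
  proof (induction i)
    case 0
    show ?case using \<omega>0 by simp
  next
    case (Suc i)
    define q where "q = (\<tau> ^^ i) \<omega> / \<omega>"
    have qR: "q \<in> R" unfolding q_def by (rule T_quotient_unit(1)[OF pT \<omega>0])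
    have "(\<tau> q - q) + (q - \<chi> ^ i) \<in> J" using T_cong[OF t qR] Suc unfolding q_def by (rule max.loc.ideal_add)
    hence "((\<tau> q - q) + (q - \<chi> ^ i)) * \<chi> \<in> J" by (rule max.loc.ideal_mult_right[OF \<chi>R])
    moreover have "((\<tau> q - q) + (q - \<chi> ^ i)) * \<chi> = \<tau> q * \<chi> - \<chi> ^ Suc i" by (simp add: algebra_simps)
    moreover have "\<tau> q * \<chi> = (\<tau> ^^ Suc i) \<omega> / \<omega>" using tG \<omega>0 by (simp add: q_def \<chi>_def)
    ultimately show ?case by (simp only:)
  qed
  have "(\<tau> ^^ j) \<omega> / \<omega> - 1 \<in> J" using max.loc.ideal_add[OF pow[of j] \<chi>j] by simp
  moreover have "(\<tau> ^^ j) \<omega> / \<omega> - 1 \<notin> J"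
    by (rule uniformizer_moved[OF pT l(3)[OF j0 jl] \<omega>J \<omega>0 \<omega>_div])
  ultimately show False by simp
qed

text \<open>A valuation ring is integrally closed; conversely, \<open>x\<close> in \<open>R\<close>
  is a root of the product of all \<open>X - \<sigma> x\<close> over the inertia group, whose
  coefficients are invariant and lie in \<open>R\<close>.\<close>

lemma T_ring_eq: "T_ring G S M = R"
proof
  let ?U = "fixed_field T \<inter> R"
  show "T_ring G S M \<subseteq> R"
  proof
    fix x assume "x \<in> T_ring G S M"
    then obtain p where p: "lead_coeff p = 1" "\<And>i. coeff p i \<in> R" "poly p x = 0"
      unfolding T_ring_def integral_closure_def by auto
    show "x \<in> R" using R.val[of x] max.loc.integral_inverse_mem[OF p] by (cases "x = 0") auto
  qed
  show "R \<subseteq> T_ring G S M"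
  proof
    fix x assume x: "x \<in> R"
    \<comment> \<open>The roots are kept as a function \<open>g\<close>, because
      \<open>\<tau>\<close> acts on the coefficients by changing \<open>g\<close> to
      \<open>\<tau> \<circ> g\<close>; over the whole group this only permutes the factors.\<close>
    define P where "P = (\<lambda>(A :: ('k \<Rightarrow> 'k) set) g. \<Prod>\<sigma>\<in>A. [:- (g \<sigma>), 1:] :: 'k poly)"
    have step: "coeff ([:- a, 1:] * q) i = - a * coeff q i + (case i of 0 \<Rightarrow> 0 | Suc j \<Rightarrow> coeff q j)" for a :: 'k and q i
      by (cases i) auto
    have deg: "lead_coeff (P A g) = 1" if "finite A" for A g
      using that unfolding P_def by (induction A rule: finite_induct) (simp_all add: lead_coeff_mult del: mult_pCons_left)
    have PR: "\<forall>i. coeff (P A g) i \<in> R" if "finite A" "\<And>\<sigma>. \<sigma> \<in> A \<Longrightarrow> g \<sigma> \<in> R" for A g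
      using that
    proof (induction A rule: finite_induct)
      case empty
      show ?case by (simp add: P_def coeff_1)
    next
      case (insert \<sigma> A)
      have "P (insert \<sigma> A) g = [:- (g \<sigma>), 1:] * P A g" using insert by (simp add: P_def)
      thus ?case using insert by (auto simp: step split: nat.split simp del: mult_pCons_left
          intro!: max.loc.add_mem max.loc.mult_mem)
    qed
    have Pt: "\<forall>i. \<tau> (coeff (P A g) i) = coeff (P A (\<lambda>\<sigma>. \<tau> (g \<sigma>))) i" if "\<tau> \<in> T" "finite A" for A g \<tau>
      using that(2)
    proof (induction A rule: finite_induct)
      case empty
      show ?case using that(1) by (simp add: P_def coeff_1)
    next
      case (insert \<sigma> A)
      have "P (insert \<sigma> A) k = [:- (k \<sigma>), 1:] * P A k" for k using insert by (simp add: P_def)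
      thus ?case using insert that(1) by (auto simp: step split: nat.split simp del: mult_pCons_left)
    qed
    let ?p = "P T (\<lambda>\<sigma>. \<sigma> x)"
    have "\<tau> (coeff ?p i) = coeff ?p i" if t: "\<tau> \<in> T" for \<tau> i
    proof -
      have "P T (\<lambda>\<sigma>. \<tau> (\<sigma> x)) = ?p"
        using T.prod_left_shift[OF t, of "\<lambda>\<sigma>. [:- \<sigma> x, 1:]"] by (simp add: P_def)
      thus ?thesis using Pt[OF t T.finite_G, of "\<lambda>\<sigma>. \<sigma> x"] by simp
    qed
    moreover have "coeff ?p i \<in> R" for i using PR[OF T.finite_G, of "\<lambda>\<sigma>. \<sigma> x"] D_R[OF T_D x] by blast
    ultimately have "\<forall>i. coeff ?p i \<in> ?U" by (simp add: fixed_field_def)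
    moreover have "poly ?p x = 0"
      unfolding P_def poly_prod by (rule prod_zero) (auto intro!: bexI[of _ id])
    ultimately show "x \<in> T_ring G S M"
      unfolding T_ring_def integral_closure_def[of ?U] using deg[OF T.finite_G, of "\<lambda>\<sigma>. \<sigma> x"] by blast
  qed
qed

section \<open>The crossed product of the inertia group over the localization\<close>

lemma crossed_inertia:
  assumes "crossed G S f"
  shows "crossed T R f"
proof -
  interpret crossed G S f by (rule assms)
  show ?thesis
  proof unfold_locales
    show "normalized_cocycle T f" using normalized T_G unfolding normalized_cocycle_def by blast
  qed (use D_R[OF T_D] S_sub_R f_mem T_G in auto)
qed

text \<open>\<open>R\<close> is local and \<open>T\<close> acts trivially modulo \<open>J\<close>,
  so the trace of any \<open>c\<close> congruent to 1 is congruent to the order of \<open>T\<close>,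
  a unit; therefore 1 can serve as \<open>t0\<close>.\<close>

lemma inertia_semihereditary:
  assumes cr: "crossed G S f" and unit: "\<And>\<sigma>. \<sigma> \<in> T \<Longrightarrow> f \<sigma> (inv \<sigma>) \<notin> M"
  shows "crossed_product_semihereditary R T f"
proof -
  interpret crossed T R f by (rule crossed_inertia[OF cr])
  interpret S: crossed G S f by (rule cr)
  note max_iff = max.loc.maximal_iff
  show ?thesis
  proof (rule semihereditary_criterion[where M = J and ?t0.0 = 1])
    show "finite {N. maximal_ideal_in R N}" by (simp add: max_iff)
    show "z \<in> localization R N \<or> inverse z \<in> localization R N" if "maximal_ideal_in R N" "z \<noteq> 0" for N z
      using that R.val by (simp add: max_iff max.loc.localization_eq)
    show "f \<sigma> (inv \<sigma>) \<notin> ideal_prod N N" if N: "maximal_ideal_in R N" and s: "\<sigma> \<in> T" for N \<sigma>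
    proof
      assume "f \<sigma> (inv \<sigma>) \<in> ideal_prod N N"
      hence "f \<sigma> (inv \<sigma>) \<in> J" using N max.loc.ideal_prod_sub by (simp add: max_iff)
      thus False using max.loc_ideal_Int S.f_mem T_G[OF s] unit[OF s] by blast
    qed
    show "maximal_ideal_in R J" by (simp add: max_iff)
    show "(\<Sum>\<sigma>\<in>T. \<sigma> (1 * c)) \<notin> J" if c: "c \<in> R" "c - 1 \<in> J" for c
    proof
      assume s: "(\<Sum>\<sigma>\<in>T. \<sigma> (1 * c)) \<in> J"
      have "(\<Sum>\<sigma>\<in>T. (\<sigma> c - c) + (c - 1)) \<in> J"
        using T_cong[OF _ c(1)] c(2) by (intro max.loc.ideal_sum max.loc.ideal_add)
      hence "(\<Sum>\<sigma>\<in>T. \<sigma> (1 * c)) - of_nat (card T) \<in> J" by (simp add: sum_subtractf)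
      from max.loc.ideal_diff[OF s this] show False using card_T_notin_J by simp
    qed
    show "inverse \<theta> \<in> R" if "\<theta> \<in> R" "\<theta> \<notin> J" for \<theta> using max.loc.inverse_mem that .
  qed auto
qed

text \<open>Necessity, applied over \<open>R\<close> and \<open>J\<close>, keeps the values out of
  the square of \<open>J\<close>, a fortiori out of that of \<open>M\<close>; on the inertia group
  this already forces units.\<close>

lemma inertia_unit_of_semihereditary:
  assumes cr: "crossed G S f" and sh: "crossed_product_semihereditary R T f" and t: "\<tau> \<in> T"
  shows "f \<tau> (inv \<tau>) \<notin> M"
proof (rule inertia_cocycle_unit[OF cr _ t])
  interpret crossed T R f by (rule crossed_inertia[OF cr])
  fix \<sigma> assume s: "\<sigma> \<in> T"
  have "f \<sigma> (inv \<sigma>) \<notin> ideal_prod J J"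
    by (rule semihereditary_notin_square[OF _ s])
      (use sh in \<open>auto simp: crossed_product_semihereditary_def semihereditary_def max.loc.maximal_iff\<close>)
  moreover have "ideal_prod M M \<subseteq> ideal_prod J J"
    using max.ideal_sub_loc unfolding ideal_prod_def by blast
  ultimately show "f \<sigma> (inv \<sigma>) \<notin> ideal_prod M M" by blast
qed

text \<open>Write \<open>\<sigma> = \<tau> \<circ> \<rho>\<close> with \<open>\<tau>\<close>
  inertial. Two cocycle identities make
  \<open>f \<tau> (inv \<tau>) * \<tau> (f \<rho> (inv \<rho>))\<close> a multiple of
  \<open>f \<sigma> (inv \<sigma>)\<close>. The first factor cancels because the square of
  \<open>M\<close> is primary, and \<open>\<tau>\<close> preserves \<open>M\<close>.\<close>

lemma square_of_coset_reps:
  assumes cr: "crossed G S f" and unit: "\<And>\<sigma>. \<sigma> \<in> T \<Longrightarrow> f \<sigma> (inv \<sigma>) \<notin> M"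
    and Rs: "right_coset_reps G T Rs" and sq: "\<forall>\<rho>\<in>Rs. f \<rho> (inv \<rho>) \<notin> ideal_prod M M"
    and s: "\<sigma> \<in> G"
  shows "f \<sigma> (inv \<sigma>) \<notin> ideal_prod M M"
proof
  interpret crossed G S f by (rule cr)
  assume *: "f \<sigma> (inv \<sigma>) \<in> ideal_prod M M"
  have "\<exists>\<rho>. \<rho> \<in> Rs \<and> (\<exists>\<tau>\<in>T. \<rho> = \<tau> \<circ> \<sigma>)" using Rs s unfolding right_coset_reps_def by blast
  then obtain \<rho> \<eta> where \<rho>: "\<rho> \<in> Rs" and \<eta>: "\<eta> \<in> T" "\<rho> = \<eta> \<circ> \<sigma>" by blast
  define \<tau> where "\<tau> = inv \<eta>"
  have \<tau>: "\<tau> \<in> T" "\<tau> \<in> G" "\<tau> \<in> D" using \<eta>(1) T_G T_D unfolding \<tau>_def by auto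
  have \<sigma>: "\<sigma> = \<tau> \<circ> \<rho>" unfolding \<tau>_def \<eta>(2) using \<eta>(1) by simp
  have \<rho>G: "\<rho> \<in> G" using Rs \<rho> unfolding right_coset_reps_def by blast
  have inv\<sigma>: "inv \<sigma> = inv \<rho> \<circ> inv \<tau>" unfolding \<sigma> using \<tau>(2) \<rho>G by simp
  have 1: "\<tau> (f \<rho> (inv \<rho>)) = f \<tau> \<rho> * f \<sigma> (inv \<rho>)"
    using cocycle[OF \<tau>(2) \<rho>G G.inv_mem[OF \<rho>G]] \<tau>(2) \<rho>G by (simp add: \<sigma>)
  have 2: "\<sigma> (f (inv \<rho>) (inv \<tau>)) * f \<sigma> (inv \<sigma>) = f \<sigma> (inv \<rho>) * f \<tau> (inv \<tau>)"
    using cocycle[OF s G.inv_mem[OF \<rho>G] G.inv_mem[OF \<tau>(2)]] \<rho>G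
    unfolding inv\<sigma> by (simp add: \<sigma> o_assoc[symmetric])
  have "f \<tau> (inv \<tau>) * \<tau> (f \<rho> (inv \<rho>)) = f \<tau> \<rho> * (\<sigma> (f (inv \<rho>) (inv \<tau>)) * f \<sigma> (inv \<sigma>))"
    unfolding 1 2 by (simp add: mult_ac)
  also have "\<dots> \<in> ideal_prod M M"
    using * by (intro max.sq.ideal_mult_left f_mem stable[OF s] \<tau>(2) \<rho>G G.inv_mem)
  finally have 3: "f \<tau> (inv \<tau>) * \<tau> (f \<rho> (inv \<rho>)) \<in> ideal_prod M M" .
  have fR: "f \<rho> (inv \<rho>) \<in> S" and tfR: "\<tau> (f \<rho> (inv \<rho>)) \<in> S"
    using f_mem[OF \<rho>G G.inv_mem[OF \<rho>G]] stable[OF \<tau>(2)] by auto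
  have "\<tau> (f \<rho> (inv \<rho>)) \<in> ideal_prod M M"
    by (rule max.sq_primary[OF f_mem[OF \<tau>(2) G.inv_mem[OF \<tau>(2)]] unit[OF \<tau>(1)] tfR 3])
  from ideal_prod_image[OF G.inv_mem[OF \<tau>(2)] this]
  have "f \<rho> (inv \<rho>) \<in> ideal_prod (inv \<tau> ` M) (inv \<tau> ` M)" using \<tau>(2) by simp
  moreover have "inv \<tau> ` M = M" using D.inv_mem[OF \<tau>(3)] by (simp add: decomp_iff)
  ultimately show False using sq \<rho> by simp
qed

lemma ex_right_coset_reps: "\<exists>Rs. right_coset_reps G T Rs"
proof -
  \<comment> \<open>Chosen from the coset as a set, hence the same for all its elements.\<close>
  define r where "r = (\<lambda>\<sigma> :: 'k \<Rightarrow> 'k. SOME \<rho>. \<rho> \<in> (\<lambda>\<tau>. \<tau> \<circ> \<sigma>) ` T)"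
  have r: "r \<sigma> \<in> (\<lambda>\<tau>. \<tau> \<circ> \<sigma>) ` T" for \<sigma>
  proof -
    have "\<sigma> \<in> (\<lambda>\<tau>. \<tau> \<circ> \<sigma>) ` T" by (rule image_eqI[of _ _ id]) auto
    thus ?thesis unfolding r_def by (rule someI[of "\<lambda>\<rho>. \<rho> \<in> (\<lambda>\<tau>. \<tau> \<circ> \<sigma>) ` T"])
  qed
  have coset: "(\<lambda>\<tau>. \<tau> \<circ> (\<eta> \<circ> \<sigma>)) ` T = (\<lambda>\<tau>. \<tau> \<circ> \<sigma>) ` T" if \<eta>: "\<eta> \<in> T" for \<eta> \<sigma>
  proof
    show "(\<lambda>\<tau>. \<tau> \<circ> (\<eta> \<circ> \<sigma>)) ` T \<subseteq> (\<lambda>\<tau>. \<tau> \<circ> \<sigma>) ` T"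
    proof (rule image_subsetI)
      fix \<tau> assume "\<tau> \<in> T"
      thus "\<tau> \<circ> (\<eta> \<circ> \<sigma>) \<in> (\<lambda>\<tau>. \<tau> \<circ> \<sigma>) ` T" using \<eta> by (intro image_eqI[of _ _ "\<tau> \<circ> \<eta>"]) (auto simp: o_assoc)
    qed
    show "(\<lambda>\<tau>. \<tau> \<circ> \<sigma>) ` T \<subseteq> (\<lambda>\<tau>. \<tau> \<circ> (\<eta> \<circ> \<sigma>)) ` T"
    proof (rule image_subsetI)
      fix \<tau> assume "\<tau> \<in> T"
      thus "\<tau> \<circ> \<sigma> \<in> (\<lambda>\<tau>. \<tau> \<circ> (\<eta> \<circ> \<sigma>)) ` T" using \<eta>
        by (intro image_eqI[of _ _ "\<tau> \<circ> inv \<eta>"]) (auto simp: o_assoc[symmetric])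
    qed
  qed
  have "right_coset_reps G T (r ` G)"
    unfolding right_coset_reps_def
  proof (intro conjI ballI)
    show "r ` G \<subseteq> G"
    proof (rule image_subsetI)
      fix \<sigma> assume s: "\<sigma> \<in> G"
      obtain \<tau> where "\<tau> \<in> T" "r \<sigma> = \<tau> \<circ> \<sigma>" using r[of \<sigma>] by blast
      thus "r \<sigma> \<in> G" using s T_G by auto
    qed
    fix \<sigma> assume s: "\<sigma> \<in> G"
    show "\<exists>!\<rho>. \<rho> \<in> r ` G \<and> (\<exists>\<tau>\<in>T. \<rho> = \<tau> \<circ> \<sigma>)"
    proof (rule ex1I[of _ "r \<sigma>"])
      show "r \<sigma> \<in> r ` G \<and> (\<exists>\<tau>\<in>T. r \<sigma> = \<tau> \<circ> \<sigma>)" using r[of \<sigma>] s by blast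
      fix \<rho> assume "\<rho> \<in> r ` G \<and> (\<exists>\<tau>\<in>T. \<rho> = \<tau> \<circ> \<sigma>)"
      then obtain \<sigma>' \<tau> where 1: "\<rho> = r \<sigma>'" "\<tau> \<in> T" "\<rho> = \<tau> \<circ> \<sigma>" by blast
      obtain \<tau>' where 2: "\<tau>' \<in> T" "r \<sigma>' = \<tau>' \<circ> \<sigma>'" using r[of \<sigma>'] by blast
      have "(\<lambda>\<tau>. \<tau> \<circ> \<sigma>') ` T = (\<lambda>\<tau>. \<tau> \<circ> \<sigma>) ` T"
        using coset[OF 2(1), of \<sigma>'] coset[OF 1(2), of \<sigma>] 1 2 by simp
      thus "\<rho> = r \<sigma>" unfolding 1(1) r_def by simp
    qed
  qed
  thus ?thesis by blast
qed

lemma T_subset_H_group: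
  assumes "\<And>\<sigma>. \<sigma> \<in> T \<Longrightarrow> f \<sigma> (inv \<sigma>) \<notin> M"
  shows "T \<subseteq> H_group G S M f"
  using assms T_D unfolding H_group_def by blast

end

theorem theorem3p14:
  fixes V S :: "'k::field set"
    and G :: "('k \<Rightarrow> 'k) set"
    and f :: "('k \<Rightarrow> 'k) \<Rightarrow> ('k \<Rightarrow> 'k) \<Rightarrow> 'k"
  assumes val: "valuation_domain V"
    and gal: "finite_galois (frac_field V) G"
    and S_def: "S = integral_closure V"
    and tame: "tame_defectless V S"
    and fg: "fg_module V S"
    and f_vals: "\<forall>\<sigma>\<in>G. \<forall>\<tau>\<in>G. f \<sigma> \<tau> \<in> S \<and> f \<sigma> \<tau> \<noteq> 0"
    and cocycle: "normalized_cocycle G f"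
  shows "(crossed_product_semihereditary S G f \<longleftrightarrow>
           (\<forall>M. maximal_ideal_in S M \<longrightarrow>
              inertia_group G (localization S M) \<subseteq> H_group G S M f \<and>
              (\<exists>Rs. right_coset_reps G (inertia_group G (localization S M)) Rs \<and>
                    (\<forall>\<rho>\<in>Rs. f \<rho> (inv \<rho>) \<notin> ideal_prod M M))))
       \<and> ((\<forall>M. maximal_ideal_in S M \<longrightarrow>
              inertia_group G (localization S M) \<subseteq> H_group G S M f \<and>
              (\<exists>Rs. right_coset_reps G (inertia_group G (localization S M)) Rs \<and>
                    (\<forall>\<rho>\<in>Rs. f \<rho> (inv \<rho>) \<notin> ideal_prod M M)))
          \<longleftrightarrow>
           (\<forall>M. maximal_ideal_in S M \<longrightarrow>
              crossed_product_semihereditary (T_ring G S M)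
                 (inertia_group G (localization S M)) f \<and>
              (\<exists>Rs. right_coset_reps G (inertia_group G (localization S M)) Rs \<and>
                    (\<forall>\<rho>\<in>Rs. f \<rho> (inv \<rho>) \<notin> ideal_prod M M))))"
proof -
  interpret val_ext V G using val gal fg S_def by unfold_locales simp_all
  have cr: "crossed G S f"
    using f_vals cocycle S_stable unfolding S_def by unfold_locales auto
  interpret crossed G S f by (rule cr)
  have deg0: "\<not> has_degree (frac_field V) 0"
  proof
    assume "has_degree (frac_field V) 0"
    hence "\<forall>x :: 'k. x = 0" unfolding has_degree_def by simp
    hence "(1 :: 'k) = 0" by blast
    thus False by simp
  qed
  have tame_at: "tame_max V G M" and fin: "finite {N. maximal_ideal_in S N}" if M: "maximal_ideal_in S M" for M
  proof -
    obtain fd where fd: "has_degree (frac_field V)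
        (ram_index V (localization S M) * fd * card {N. maximal_ideal_in S N})"
      "of_nat (ram_index V (localization S M)) \<notin> jacobson V" "residue_separable V (localization S M)"
      using tame M unfolding tame_defectless_def by blast
    \<comment> \<open>A nonzero degree makes each factor nonzero, and a nonzero \<open>card\<close>
      means a finite set: this gives the finite ramification index and the finitely many maximal
      ideals.\<close>
    have "ram_index V (localization S M) * fd * card {N. maximal_ideal_in S N} \<noteq> 0"
      using fd(1) deg0 by metis
    hence pos: "ram_index V (localization S M) > 0" "card {N. maximal_ideal_in S N} > 0" by auto
    show "finite {N. maximal_ideal_in S N}" using pos(2) by (rule card_ge_0_finite)
    show "tame_max V G M"
      using M fd pos unfolding S_def by unfold_locales
  qed
  let ?T = "\<lambda>M. inertia_group G (localization S M)"
  let ?reps = "\<lambda>M. \<exists>Rs. right_coset_reps G (?T M) Rs \<and> (\<forall>\<rho>\<in>Rs. f \<rho> (inv \<rho>) \<notin> ideal_prod M M)"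
  have 12: "?T M \<subseteq> H_group G S M f \<and> ?reps M"
    if sh: "crossed_product_semihereditary S G f" and M: "maximal_ideal_in S M" for M
  proof -
    interpret tame_max V G M by (rule tame_at[OF M])
    have sq: "f \<sigma> (inv \<sigma>) \<notin> ideal_prod M M" if "\<sigma> \<in> G" for \<sigma>
      by (rule semihereditary_notin_square[OF _ that M])
        (use sh in \<open>simp add: crossed_product_semihereditary_def semihereditary_def\<close>)
    have "f \<tau> (inv \<tau>) \<notin> M" if "\<tau> \<in> ?T M" for \<tau>
      using inertia_cocycle_unit[OF cr[unfolded S_def] sq[OF T_G]] that unfolding S_def by blast
    hence "?T M \<subseteq> H_group G S M f" using T_subset_H_group[of f] unfolding S_def by blast
    \<comment> \<open>The square condition holds for all of \<open>G\<close>, so any set of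
      representatives will do.\<close>
    moreover obtain Rs where Rs: "right_coset_reps G (?T M) Rs" using ex_right_coset_reps unfolding S_def by blast
    ultimately show ?thesis using sq unfolding right_coset_reps_def by blast
  qed
  have 21: "crossed_product_semihereditary S G f"
    if *: "\<And>M. maximal_ideal_in S M \<Longrightarrow> ?T M \<subseteq> H_group G S M f \<and> ?reps M"
  proof -
    obtain M where M: "maximal_ideal_in S M" using ex_maximal unfolding S_def by blast
    interpret tame_max V G M by (rule tame_at[OF M])
    obtain t where t: "t \<in> S" "(\<Sum>\<sigma>\<in>D. \<sigma> t) \<notin> M" using ex_decomp_trace unfolding S_def by blast
    show ?thesis
    proof (rule semihereditary_criterion[OF fin[OF M] _ _ M t(1)])
      show "z \<in> localization S N \<or> inverse z \<in> localization S N" if "maximal_ideal_in S N" "z \<noteq> 0" for N z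
        using localization_val that unfolding S_def by blast
      show "f \<sigma> (inv \<sigma>) \<notin> ideal_prod N N" if N: "maximal_ideal_in S N" and s: "\<sigma> \<in> G" for N \<sigma>
      proof -
        interpret N: tame_max V G N by (rule tame_at[OF N])
        obtain Rs where Rs: "right_coset_reps G (?T N) Rs" "\<forall>\<rho>\<in>Rs. f \<rho> (inv \<rho>) \<notin> ideal_prod N N"
          using *[OF N] by blast
        have "f \<tau> (inv \<tau>) \<notin> N" if "\<tau> \<in> ?T N" for \<tau> using *[OF N] that unfolding H_group_def by blast
        thus ?thesis using N.square_of_coset_reps[OF cr[unfolded S_def] _ _ Rs(2) s] Rs(1) unfolding S_def by blast
      qed
      show "inverse \<theta> \<in> S" if \<theta>: "\<theta> \<in> S" "\<And>\<sigma>. \<sigma> \<in> G \<Longrightarrow> \<sigma> \<theta> = \<theta>" "\<theta> \<notin> M" for \<theta>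
      proof -
        have "\<theta> \<in> V" by (rule S_fixed) (use \<theta> S_def in auto)
        hence "inverse \<theta> \<in> V" using V_unit_of_notin M \<theta>(3) unfolding S_def by blast
        thus ?thesis unfolding S_def by (rule V.sub_integral_closure)
      qed
      show "(\<Sum>\<sigma>\<in>G. \<sigma> (t * c)) \<notin> M"
        if c: "c \<in> S" "c - 1 \<in> M" "\<And>N. maximal_ideal_in S N \<Longrightarrow> N \<noteq> M \<Longrightarrow> c \<in> N" for c
      proof
        assume sum: "(\<Sum>\<sigma>\<in>G. \<sigma> (t * c)) \<in> M"
        have tS: "t \<in> integral_closure V" using t(1) unfolding S_def .
        \<comment> \<open>For \<open>\<sigma>\<close> outside \<open>D\<close>,
          \<open>inv \<sigma>\<close> moves \<open>M\<close> to another maximal ideal, which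
          contains \<open>c\<close>; inside \<open>D\<close>, \<open>\<sigma> c\<close> is 1 modulo
          \<open>M\<close>. So the trace of \<open>t * c\<close> over \<open>G\<close> reduces to
          the trace of \<open>t\<close> over \<open>D\<close>.\<close>
        have out: "\<sigma> (t * c) \<in> M" if s: "\<sigma> \<in> G - D" for \<sigma>
        proof -
          have sG: "\<sigma> \<in> G" using s by simp
          have "inv \<sigma> ` M \<noteq> M"
          proof
            assume "inv \<sigma> ` M = M"
            hence "\<sigma> ` M = M" using image_inv_image[OF sG, of M] by simp
            thus False using s decomp_iff by auto
          qed
          hence "c \<in> inv \<sigma> ` M" using c(3)[OF maximal_image[OF G.inv_mem[OF sG] M]] by blast
          hence "\<sigma> c \<in> M" using sG by auto
          hence "\<sigma> t * \<sigma> c \<in> M" by (rule max.ideal_mult_left[OF S_stable[OF sG tS]])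
          thus ?thesis using sG by simp
        qed
        have ins: "\<sigma> (t * c) - \<sigma> t \<in> M" if s: "\<sigma> \<in> D" for \<sigma>
        proof -
          have "\<sigma> ` M = M" using s decomp_iff by blast
          hence "\<sigma> (c - 1) \<in> M" using c(2) by blast
          hence "\<sigma> t * \<sigma> (c - 1) \<in> M" by (rule max.ideal_mult_left[OF S_stable[OF D_G[OF s] tS]])
          thus ?thesis using s by (simp add: right_diff_distrib)
        qed
        have DG: "D \<subseteq> G" using D_G by blast
        have "(\<Sum>\<sigma>\<in>G. \<sigma> (t * c)) = (\<Sum>\<sigma>\<in>G - D. \<sigma> (t * c)) + (\<Sum>\<sigma>\<in>D. \<sigma> (t * c))"
          by (rule sum.subset_diff[OF DG finite_G])
        moreover have "(\<Sum>\<sigma>\<in>G - D. \<sigma> (t * c)) \<in> M" using out by (rule max.ideal_sum)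
        ultimately have 1: "(\<Sum>\<sigma>\<in>D. \<sigma> (t * c)) \<in> M" using max.ideal_diff[OF sum] by fastforce
        have "(\<Sum>\<sigma>\<in>D. \<sigma> (t * c) - \<sigma> t) \<in> M" using ins by (rule max.ideal_sum)
        hence 2: "(\<Sum>\<sigma>\<in>D. \<sigma> (t * c)) - (\<Sum>\<sigma>\<in>D. \<sigma> t) \<in> M" by (simp only: sum_subtractf)
        from max.ideal_diff[OF 1 2] show False using t(2) by simp
      qed
    qed
  qed
  \<comment> \<open>The clause on coset representatives is common to both conditions. Each of the
    remaining clauses says that \<open>f \<tau> (inv \<tau>)\<close> is outside \<open>M\<close> for
    all inertial \<open>\<tau>\<close>.\<close>
  have 23: "(?T M \<subseteq> H_group G S M f) \<longleftrightarrow> crossed_product_semihereditary (T_ring G S M) (?T M) f"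
    if M: "maximal_ideal_in S M" for M
  proof -
    interpret tame_max V G M by (rule tame_at[OF M])
    have cr': "crossed G (integral_closure V) f" using cr unfolding S_def .
    have "f \<tau> (inv \<tau>) \<notin> M" if "T \<subseteq> H_group G S M f" "\<tau> \<in> T" for \<tau>
      using that unfolding H_group_def by blast
    thus ?thesis
      using T_ring_eq inertia_semihereditary[OF cr'] inertia_unit_of_semihereditary[OF cr'] T_subset_H_group[of f]
      unfolding S_def by metis
  qed
  show ?thesis using 12 21 23 by blast
qed

end
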